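(* Let $R$ be a local ring of Krull dimension one with regular maximal ideal $M$, let $m\in M$ be a nonzerodivisor, and let $J=\bigcap_{i>0}m^iR$. The following are equivalent: (1) $R$ is a stable ring. (2) $R$ is a finitely stable ring with stable maximal ideal. (3) $R$ is a quadratic ring such that $\overline{R}$ has at most two maximal ideals. (4) $R\subseteq\overline{R}$ is a quadratic extension and $\overline{R}$ is a Dedekind ring with at most two maximal ideals. (5) $R/J$ is a stable ring.
   Context: All rings are commutative with identity; a local ring is a ring with a unique maximal ideal (not necessarily Noetherian). $Q(R)$ is the total ring of quotients, $\operatorname{Jac} R$ the Jacobson radical, and $\overline{R}$ the integral closure of $R$ in $Q(R)$. An ideal is regular if it contains a nonzerodivisor. A fractional ideal is an $R$-submodule $I$ of $Q(R)$ with $bI\subseteq R$ for some nonzerodivisor $b\in R$; for a regular one, $E(I)=\{q\in Q(R):qI\subseteq I\}$, and $I$ is stable if it is projective as an $E(I)$-module. $R$ is stable if every regular ideal of $R$ is stable, and finitely stable if every finitely generated regular ideal is stable. A ring $A$ is a Dedekind ring if every regular ideal of $A$ is invertible. An extension $R\subseteq S$ is quadratic if $xy\in xR+yR+R$ for all $x,y\in S$. If $\operatorname{Jac} R$ is regular, define $R_0=R$, $R_i=E(\operatorname{Jac} R_{i-1})$ for $i\ge1$, and $R_\infty=\bigcup_{i\ge1}R_i$. $R$ is a quadratic ring if $R$ is local, its maximal ideal is regular and stable, and $R\subseteq R_\infty$ is a quadratic extension. ($J$ does not depend on the choice of $m$.) *)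

theory Defs
  imports "HOL-Algebra.Algebra"
begin

definition nzd :: "('a,'b) ring_scheme \<Rightarrow> 'a \<Rightarrow> bool" where
  "nzd R x \<longleftrightarrow> x \<in> carrier R \<and> (\<forall>y\<in>carrier R. x \<otimes>\<^bsub>R\<^esub> y = \<zero>\<^bsub>R\<^esub> \<longrightarrow> y = \<zero>\<^bsub>R\<^esub>)"

definition regular_set :: "('a,'b) ring_scheme \<Rightarrow> 'a set \<Rightarrow> bool" where
  "regular_set R I \<longleftrightarrow> (\<exists>x\<in>I. nzd R x)"

definition local_ring :: "('a,'b) ring_scheme \<Rightarrow> bool" where
  "local_ring R \<longleftrightarrow> (\<exists>!M. maximalideal M R)"

definition krull_dim_one :: "('a,'b) ring_scheme \<Rightarrow> bool" where
  "krull_dim_one R \<longleftrightarrow>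
     (\<exists>P0 P1. primeideal P0 R \<and> primeideal P1 R \<and> P0 \<subset> P1) \<and>
     \<not> (\<exists>P0 P1 P2. primeideal P0 R \<and> primeideal P1 R \<and> primeideal P2 R \<and> P0 \<subset> P1 \<and> P1 \<subset> P2)"

definition Jac :: "('a,'b) ring_scheme \<Rightarrow> 'a set" where
  "Jac R = carrier R \<inter> \<Inter> {M. maximalideal M R}"

definition frac_rel :: "('a,'b) ring_scheme \<Rightarrow> (('a \<times> 'a) \<times> ('a \<times> 'a)) set" where
  "frac_rel R = {((a, s), (b, t)). a \<in> carrier R \<and> nzd R s \<and> b \<in> carrier R \<and> nzd R t \<and>
                                   a \<otimes>\<^bsub>R\<^esub> t = b \<otimes>\<^bsub>R\<^esub> s}"

definition frac :: "('a,'b) ring_scheme \<Rightarrow> 'a \<Rightarrow> 'a \<Rightarrow> ('a \<times> 'a) set" where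
  "frac R a s = frac_rel R `` {(a, s)}"

definition Q_mult :: "('a,'b) ring_scheme \<Rightarrow> ('a \<times> 'a) set \<Rightarrow> ('a \<times> 'a) set \<Rightarrow> ('a \<times> 'a) set" where
  "Q_mult R Xs Ys = \<Union> ((\<lambda>(p, q). frac R (fst p \<otimes>\<^bsub>R\<^esub> fst q) (snd p \<otimes>\<^bsub>R\<^esub> snd q)) ` (Xs \<times> Ys))"

definition Q_add :: "('a,'b) ring_scheme \<Rightarrow> ('a \<times> 'a) set \<Rightarrow> ('a \<times> 'a) set \<Rightarrow> ('a \<times> 'a) set" where
  "Q_add R Xs Ys = \<Union> ((\<lambda>(p, q). frac R ((fst p \<otimes>\<^bsub>R\<^esub> snd q) \<oplus>\<^bsub>R\<^esub> (fst q \<otimes>\<^bsub>R\<^esub> snd p))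
                             (snd p \<otimes>\<^bsub>R\<^esub> snd q)) ` (Xs \<times> Ys))"

text \<open>Q(R): equivalence classes of fractions a/s with s a nonzerodivisor. The operations
  are defined on classes as the union over all representatives (well defined).\<close>
definition TotQ :: "('a,'b) ring_scheme \<Rightarrow> (('a \<times> 'a) set) ring" where
  "TotQ R =
    \<lparr>carrier = (carrier R \<times> {s. nzd R s}) // frac_rel R,
     monoid.mult = Q_mult R,
     one = frac R \<one>\<^bsub>R\<^esub> \<one>\<^bsub>R\<^esub>,
     ring.zero = frac R \<zero>\<^bsub>R\<^esub> \<one>\<^bsub>R\<^esub>,
     ring.add = Q_add R\<rparr>"

definition qemb :: "('a,'b) ring_scheme \<Rightarrow> 'a \<Rightarrow> ('a \<times> 'a) set" where
  "qemb R a = frac R a \<one>\<^bsub>R\<^esub>"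

definition Rin :: "('a,'b) ring_scheme \<Rightarrow> ('a \<times> 'a) set set" where
  "Rin R = qemb R ` carrier R"

definition Eset :: "('q,'c) ring_scheme \<Rightarrow> 'q set \<Rightarrow> 'q set" where
  "Eset Q I = {q \<in> carrier Q. \<forall>x\<in>I. q \<otimes>\<^bsub>Q\<^esub> x \<in> I}"

definition free_mod :: "('q,'c) ring_scheme \<Rightarrow> 'q set \<Rightarrow> 'q set \<Rightarrow> ('q \<Rightarrow> 'q) set" where
  "free_mod Q A Xs = {\<phi>. (\<forall>x. \<phi> x \<in> A) \<and> (\<forall>x. x \<notin> Xs \<longrightarrow> \<phi> x = \<zero>\<^bsub>Q\<^esub>) \<and>
                        finite {x. \<phi> x \<noteq> \<zero>\<^bsub>Q\<^esub>}}"

text \<open>P (an A-submodule of Q, scalar action = multiplication in Q) is a projective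
  A-module: it is a retract (equivalently, a direct summand) of a free A-module.\<close>
definition projective_sub :: "('q,'c) ring_scheme \<Rightarrow> 'q set \<Rightarrow> 'q set \<Rightarrow> bool" where
  "projective_sub Q A P \<longleftrightarrow>
    (\<exists>(Xs :: 'q set) (f :: 'q \<Rightarrow> ('q \<Rightarrow> 'q)) (g :: ('q \<Rightarrow> 'q) \<Rightarrow> 'q).
       (\<forall>x\<in>P. f x \<in> free_mod Q A Xs) \<and>
       (\<forall>x\<in>P. \<forall>y\<in>P. f (x \<oplus>\<^bsub>Q\<^esub> y) = (\<lambda>i. f x i \<oplus>\<^bsub>Q\<^esub> f y i)) \<and>
       (\<forall>a\<in>A. \<forall>x\<in>P. f (a \<otimes>\<^bsub>Q\<^esub> x) = (\<lambda>i. a \<otimes>\<^bsub>Q\<^esub> f x i)) \<and>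
       (\<forall>\<phi>\<in>free_mod Q A Xs. g \<phi> \<in> P) \<and>
       (\<forall>\<phi>\<in>free_mod Q A Xs. \<forall>\<psi>\<in>free_mod Q A Xs. g (\<lambda>i. \<phi> i \<oplus>\<^bsub>Q\<^esub> \<psi> i) = g \<phi> \<oplus>\<^bsub>Q\<^esub> g \<psi>) \<and>
       (\<forall>a\<in>A. \<forall>\<phi>\<in>free_mod Q A Xs. g (\<lambda>i. a \<otimes>\<^bsub>Q\<^esub> \<phi> i) = a \<otimes>\<^bsub>Q\<^esub> g \<phi>) \<and>
       (\<forall>x\<in>P. g (f x) = x))"

definition stable_frac :: "('a,'b) ring_scheme \<Rightarrow> ('a \<times> 'a) set set \<Rightarrow> bool" where
  "stable_frac R I \<longleftrightarrow> projective_sub (TotQ R) (Eset (TotQ R) I) I"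

definition stable_ideal :: "('a,'b) ring_scheme \<Rightarrow> 'a set \<Rightarrow> bool" where
  "stable_ideal R I \<longleftrightarrow> stable_frac R (qemb R ` I)"

definition stable_ring :: "('a,'b) ring_scheme \<Rightarrow> bool" where
  "stable_ring R \<longleftrightarrow> (\<forall>I. ideal I R \<and> regular_set R I \<longrightarrow> stable_ideal R I)"

definition fin_stable_ring :: "('a,'b) ring_scheme \<Rightarrow> bool" where
  "fin_stable_ring R \<longleftrightarrow>
     (\<forall>I. ideal I R \<and> regular_set R I \<and> (\<exists>S. finite S \<and> S \<subseteq> carrier R \<and> I = Idl\<^bsub>R\<^esub> S)
          \<longrightarrow> stable_ideal R I)"

definition Rbar :: "('a,'b) ring_scheme \<Rightarrow> ('a \<times> 'a) set set" where
  "Rbar R = {q \<in> carrier (TotQ R). \<exists>(n::nat) c. (\<forall>i<n. c i \<in> Rin R) \<and>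
      q [^]\<^bsub>TotQ R\<^esub> n \<oplus>\<^bsub>TotQ R\<^esub> (\<Oplus>\<^bsub>TotQ R\<^esub> i\<in>{..<n}. c i \<otimes>\<^bsub>TotQ R\<^esub> q [^]\<^bsub>TotQ R\<^esub> i)
        = \<zero>\<^bsub>TotQ R\<^esub>}"

definition prodset :: "('q,'c) ring_scheme \<Rightarrow> 'q set \<Rightarrow> 'q set \<Rightarrow> 'q set" where
  "prodset Q I K = {z. \<exists>(n::nat) x y. (\<forall>i<n. x i \<in> I \<and> y i \<in> K) \<and>
                        z = (\<Oplus>\<^bsub>Q\<^esub> i\<in>{..<n}. x i \<otimes>\<^bsub>Q\<^esub> y i)}"

definition invertible_ideal :: "('a,'b) ring_scheme \<Rightarrow> 'a set \<Rightarrow> bool" where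
  "invertible_ideal A I \<longleftrightarrow>
     (\<exists>K. K \<subseteq> carrier (TotQ A) \<and>
          (\<forall>a\<in>Rin A. \<forall>k\<in>K. a \<otimes>\<^bsub>TotQ A\<^esub> k \<in> K) \<and>
          (\<forall>k\<in>K. \<forall>k'\<in>K. k \<oplus>\<^bsub>TotQ A\<^esub> k' \<in> K) \<and>
          prodset (TotQ A) (qemb A ` I) K = Rin A)"

definition dedekind_ring :: "('a,'b) ring_scheme \<Rightarrow> bool" where
  "dedekind_ring A \<longleftrightarrow> (\<forall>I. ideal I A \<and> regular_set A I \<longrightarrow> invertible_ideal A I)"

definition quadratic_ext :: "('q,'c) ring_scheme \<Rightarrow> 'q set \<Rightarrow> 'q set \<Rightarrow> bool" where
  "quadratic_ext Q S T \<longleftrightarrow> S \<subseteq> T \<and>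
     (\<forall>x\<in>T. \<forall>y\<in>T. \<exists>a\<in>S. \<exists>b\<in>S. \<exists>c\<in>S.
         x \<otimes>\<^bsub>Q\<^esub> y = (x \<otimes>\<^bsub>Q\<^esub> a) \<oplus>\<^bsub>Q\<^esub> (y \<otimes>\<^bsub>Q\<^esub> b) \<oplus>\<^bsub>Q\<^esub> c)"

fun Rseq :: "('a,'b) ring_scheme \<Rightarrow> nat \<Rightarrow> ('a \<times> 'a) set set" where
  "Rseq R 0 = Rin R"
| "Rseq R (Suc i) = Eset (TotQ R) (Jac ((TotQ R)\<lparr>carrier := Rseq R i\<rparr>))"

definition Rinf :: "('a,'b) ring_scheme \<Rightarrow> ('a \<times> 'a) set set" where
  "Rinf R = (\<Union>i\<in>{1..}. Rseq R i)"

definition quadratic_ring :: "('a,'b) ring_scheme \<Rightarrow> bool" where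
  "quadratic_ring R \<longleftrightarrow> local_ring R \<and>
     (\<forall>M. maximalideal M R \<longrightarrow> regular_set R M \<and> stable_ideal R M) \<and>
     quadratic_ext (TotQ R) (Rin R) (Rinf R)"

definition Rbar_ring :: "('a,'b) ring_scheme \<Rightarrow> (('a \<times> 'a) set) ring" where
  "Rbar_ring R = (TotQ R)\<lparr>carrier := Rbar R\<rparr>"

definition at_most_two_max :: "('a,'b) ring_scheme \<Rightarrow> bool" where
  "at_most_two_max A \<longleftrightarrow> finite {P. maximalideal P A} \<and> card {P. maximalideal P A} \<le> 2"

end

theory Submission
  imports Defs "HOL-Algebra.Free_Abelian_Groups"
begin

text \<open>
  The implications run (1) \<open>\<Rightarrow>\<close> (2) \<open>\<Rightarrow>\<close> (3) \<open>\<Rightarrow>\<close> (4) \<open>\<Rightarrow>\<close> (SP) \<open>\<Rightarrow>\<close> (1), where (SP) says that every regular ideal \<open>I\<close>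
  contains a regular \<open>x\<close> with \<open>I\<^sup>2 = xI\<close>. Write \<open>S\<close> for the integral closure. Under (2), for \<open>x, y\<close> in \<open>S\<close> the
  finitely generated module \<open>K = R + xR + yR\<close> is invertible over its ring \<open>A\<close> of multipliers, and lying over
  for \<open>A \<subseteq> S\<close> forces \<open>1 \<in> K\<^sup>-\<^sup>1\<close>, so that \<open>K = A\<close> is a ring and \<open>S\<close> is quadratic over \<open>R\<close>. Three maximal ideals
  of \<open>S\<close> would give a module of this kind that is not invertible, and \<open>S\<close> contains \<open>R\<^sub>\<infinity>\<close> since it is completely
  integrally closed. Under (3) the stable ideal \<open>M\<close> equals \<open>xR\<^sub>1\<close>, which makes the at most two maximal ideals
  of \<open>R\<^sub>\<infinity>\<close> principal; hence every regular ideal of \<open>R\<^sub>\<infinity>\<close> is principal and \<open>R\<^sub>\<infinity> = S\<close>. Under (4), if \<open>IS = yS\<close>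
  and \<open>x \<in> I\<close> is chosen with \<open>x/y\<close> a unit of \<open>S\<close>, then \<open>x\<^sup>-\<^sup>1I\<close> is a ring between \<open>R\<close> and \<open>S\<close> because \<open>S\<close> is
  quadratic, which is (SP). Finally (SP) holds for \<open>R\<close> if and only if it holds for \<open>R / J\<close>, as \<open>J = sJ\<close> for every
  regular \<open>s\<close>.

  The chain only concerns subsets of \<open>Q(R)\<close>. It is carried out in a type-class ring of integral polynomials that
  maps onto \<open>Q(R)\<close>, with subsets of \<open>Q(R)\<close> replaced by their preimages.
\<close>

section \<open>Additive subgroups, integrality and lying over\<close>

text \<open>Dimension one is used for a single fact: if \<open>s\<close> is regular modulo an ideal
  and \<open>x\<close> lies in \<open>M\<close>, then a power of \<open>x\<close> lies in that ideal
  plus \<open>sR\<close>. Modulo zero it yields Q(R) = R[1/m], so that powers of \<open>m\<close>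
  serve as the only denominators, and it is behind \<open>J = sJ\<close>. Modulo \<open>J\<close> it
  gives the same information for \<open>R / J\<close>, whose dimension is never computed. No chain
  condition is available, so lengths and discrete valuations cannot be used. What helps is the bound
  two: a group is not the union of two proper subgroups, so a module that reaches outside each of
  two maximal ideals has one element outside both. This is how invertible modules become principal.
  (SP) says that \<open>x^-1 I\<close> is closed under multiplication, hence equal to E(I), and so
  that \<open>I\<close> is free over E(I). It mentions no fractions, which matters because
  \<open>R\<close> and \<open>R / J\<close> have in general different total rings of
  quotients.\<close>

definition sgrp :: "'f::comm_ring_1 set \<Rightarrow> bool" where
  "sgrp Y \<longleftrightarrow> 0 \<in> Y \<and> (\<forall>x\<in>Y. \<forall>y\<in>Y. x - y \<in> Y)"

lemma sgrpI: "\<lbrakk>0 \<in> Y; \<And>x y. x \<in> Y \<Longrightarrow> y \<in> Y \<Longrightarrow> x - y \<in> Y\<rbrakk> \<Longrightarrow> sgrp Y"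
  by (auto simp: sgrp_def)

lemma sgrp_zero: "sgrp Y \<Longrightarrow> 0 \<in> Y"
  and sgrp_diff: "sgrp Y \<Longrightarrow> x \<in> Y \<Longrightarrow> y \<in> Y \<Longrightarrow> x - y \<in> Y"
  by (auto simp: sgrp_def)

lemma sgrp_minus: "sgrp Y \<Longrightarrow> x \<in> Y \<Longrightarrow> - x \<in> Y"
  using sgrp_diff[of Y 0 x] by (simp add: sgrp_zero)

lemma sgrp_add: "sgrp Y \<Longrightarrow> x \<in> Y \<Longrightarrow> y \<in> Y \<Longrightarrow> x + y \<in> Y"
  using sgrp_diff[of Y x "- y"] by (simp add: sgrp_minus)

lemma sgrp_add_cancel: "sgrp Y \<Longrightarrow> x \<in> Y \<Longrightarrow> x + y \<in> Y \<longleftrightarrow> y \<in> Y"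
  by (metis add_diff_cancel_left' sgrp_add sgrp_diff)

lemma sgrp_diff_cancel: "sgrp Y \<Longrightarrow> x - y \<in> Y \<Longrightarrow> x \<in> Y \<longleftrightarrow> y \<in> Y"
  using sgrp_add_cancel[of Y "x - y" y] by simp

definition subr :: "'f::comm_ring_1 set \<Rightarrow> bool" where
  "subr A \<longleftrightarrow> sgrp A \<and> 1 \<in> A \<and> (\<forall>x\<in>A. \<forall>y\<in>A. x * y \<in> A)"

lemma subrD: assumes "subr A"
  shows "sgrp A" "0 \<in> A" "1 \<in> A" "\<And>x y. x \<in> A \<Longrightarrow> y \<in> A \<Longrightarrow> x * y \<in> A"
    "\<And>x y. x \<in> A \<Longrightarrow> y \<in> A \<Longrightarrow> x + y \<in> A" "\<And>x y. x \<in> A \<Longrightarrow> y \<in> A \<Longrightarrow> x - y \<in> A" "\<And>x. x \<in> A \<Longrightarrow> - x \<in> A"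
  using assms by (auto simp: subr_def sgrp_zero sgrp_add sgrp_diff sgrp_minus)

lemma subr_power: "subr A \<Longrightarrow> x \<in> A \<Longrightarrow> x ^ n \<in> A"
  by (induction n) (auto simp: subrD)

definition ideal_of :: "'f::comm_ring_1 set \<Rightarrow> 'f set \<Rightarrow> bool" where
  "ideal_of A N \<longleftrightarrow> sgrp N \<and> N \<subseteq> A \<and> (\<forall>a\<in>A. \<forall>x\<in>N. a * x \<in> N)"

lemma ideal_ofD: assumes "ideal_of A N"
  shows "sgrp N" "N \<subseteq> A" "\<And>a x. a \<in> A \<Longrightarrow> x \<in> N \<Longrightarrow> a * x \<in> N" "\<And>a x. a \<in> A \<Longrightarrow> x \<in> N \<Longrightarrow> x * a \<in> N"
  using assms by (auto simp: ideal_of_def mult.commute)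

text \<open>Values at \<open>x\<close> of the polynomials of degree below \<open>n\<close> with coefficients in \<open>N\<close>.\<close>

primrec lowp :: "'f::comm_ring_1 set \<Rightarrow> 'f \<Rightarrow> nat \<Rightarrow> 'f set" where
  "lowp N x 0 = {0}"
| "lowp N x (Suc n) = {c + x * l | c l. c \<in> N \<and> l \<in> lowp N x n}"

text \<open>The coefficient set is a parameter because it varies: a ring, an ideal without 1, or the
  set \<open>lowp N x k\<close> of polynomial values.\<close>

primrec lin :: "'f::comm_ring_1 set \<Rightarrow> 'f list \<Rightarrow> 'f set" where
  "lin L [] = {0}"
| "lin L (p # ps) = {l * p + v | l v. l \<in> L \<and> v \<in> lin L ps}"

lemma lowp_SucI: "\<lbrakk>y = c + x * l; c \<in> N; l \<in> lowp N x n\<rbrakk> \<Longrightarrow> y \<in> lowp N x (Suc n)"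
  and lin_ConsI: "\<lbrakk>y = l' * p + v; l' \<in> L; v \<in> lin L ps\<rbrakk> \<Longrightarrow> y \<in> lin L (p # ps)"
  by auto

section \<open>Arithmetic of polynomial values and linear combinations\<close>

lemma lowp_sgrp: "sgrp N \<Longrightarrow> sgrp (lowp N x n)"
proof (induction n)
  case (Suc n)
  show ?case
  proof (rule sgrpI)
    show "0 \<in> lowp N x (Suc n)" using Suc by (intro lowp_SucI[of _ 0 _ 0]) (auto simp: sgrp_zero)
    fix a b assume "a \<in> lowp N x (Suc n)" "b \<in> lowp N x (Suc n)"
    then obtain c l c' l' where *: "a = c + x * l" "b = c' + x * l'" "c \<in> N" "c' \<in> N" "l \<in> lowp N x n" "l' \<in> lowp N x n"
      by auto
    have "a - b = (c - c') + x * (l - l')" using * by (simp add: algebra_simps)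
    then show "a - b \<in> lowp N x (Suc n)" by (rule lowp_SucI) (use * Suc in \<open>auto simp: sgrp_diff\<close>)
  qed
qed (simp add: sgrp_def)

lemma lowp_shift: "sgrp N \<Longrightarrow> l \<in> lowp N x n \<Longrightarrow> x * l \<in> lowp N x (Suc n)"
  by (intro lowp_SucI[of _ 0 _ l]) (auto simp: sgrp_zero)

lemma lowp_const: "sgrp N \<Longrightarrow> c \<in> N \<Longrightarrow> c \<in> lowp N x (Suc n)"
  by (intro lowp_SucI[of _ c _ 0]) (auto simp: sgrp_zero lowp_sgrp)

lemma lowp_mono: assumes "sgrp N" shows "l \<in> lowp N x n \<Longrightarrow> n \<le> k \<Longrightarrow> l \<in> lowp N x k"
proof (induction n arbitrary: l k)
  case 0 then show ?case using assms by (simp add: sgrp_zero lowp_sgrp)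
next
  case (Suc n) then show ?case by (cases k) auto
qed

lemma lowp_power: "sgrp N \<Longrightarrow> l \<in> lowp N x n \<Longrightarrow> x ^ k * l \<in> lowp N x (k + n)"
proof (induction k)
  case (Suc k)
  then show ?case using lowp_shift[of N "x ^ k * l" x "k + n"] by (simp add: mult.assoc)
qed simp

lemma lowp_smult: "(\<And>d. d \<in> N \<Longrightarrow> c * d \<in> N') \<Longrightarrow> l \<in> lowp N x n \<Longrightarrow> c * l \<in> lowp N' x n"
proof (induction n arbitrary: l)
  case (Suc n)
  then obtain d l' where *: "l = d + x * l'" "d \<in> N" "l' \<in> lowp N x n" by auto
  have "c * l = c * d + x * (c * l')" using * by (simp add: algebra_simps)
  then show ?case using * Suc by auto
qed simp

lemma lowp_times:
  assumes N: "sgrp N" "\<And>c d. c \<in> N \<Longrightarrow> d \<in> N \<Longrightarrow> c * d \<in> N"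
  shows "a \<in> lowp N x k \<Longrightarrow> b \<in> lowp N x j \<Longrightarrow> a * b \<in> lowp N x (k + j)"
proof (induction k arbitrary: a)
  case 0 then show ?case using N by (simp add: sgrp_zero lowp_sgrp)
next
  case (Suc k)
  then obtain c l where *: "a = c + x * l" "c \<in> N" "l \<in> lowp N x k" by auto
  have "c * b \<in> lowp N x (Suc k + j)" using lowp_smult[of N c N b x j] lowp_mono[OF N(1), of "c * b" x j "Suc k + j"] Suc.prems * N by auto
  moreover have "x * (l * b) \<in> lowp N x (Suc k + j)" using lowp_shift[OF N(1), of "l * b" x "k + j"] Suc * by simp
  moreover have "a * b = c * b + x * (l * b)" using * by (simp add: algebra_simps)
  ultimately show ?case using lowp_sgrp[OF N(1)] sgrp_add by metis
qed

lemma lowp_subset: assumes "subr A" "x \<in> A" "N \<subseteq> A" shows "l \<in> lowp N x n \<Longrightarrow> l \<in> A"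
  by (induction n arbitrary: l) (use assms in \<open>auto simp: subrD subset_iff\<close>)

lemma lin_sgrp: "sgrp L \<Longrightarrow> sgrp (lin L ps)"
proof (induction ps)
  case (Cons p ps)
  show ?case
  proof (rule sgrpI)
    show "0 \<in> lin L (p # ps)" using Cons by (intro lin_ConsI[of _ 0 _ 0]) (auto simp: sgrp_zero)
    fix a b assume "a \<in> lin L (p # ps)" "b \<in> lin L (p # ps)"
    then obtain c l c' l' where *: "a = c * p + l" "b = c' * p + l'" "c \<in> L" "c' \<in> L" "l \<in> lin L ps" "l' \<in> lin L ps"
      by auto
    have "a - b = (c - c') * p + (l - l')" using * by (simp add: algebra_simps)
    then show "a - b \<in> lin L (p # ps)" by (rule lin_ConsI) (use * Cons in \<open>auto simp: sgrp_diff\<close>)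
  qed
qed (simp add: sgrp_def)

lemma lin_mem: "sgrp L \<Longrightarrow> p \<in> set ps \<Longrightarrow> l \<in> L \<Longrightarrow> l * p \<in> lin L ps"
proof (induction ps)
  case (Cons q ps)
  show ?case
  proof (cases "p = q")
    case True then show ?thesis using Cons.prems by (intro lin_ConsI[of _ l _ 0]) (auto simp: sgrp_zero lin_sgrp)
  next
    case False
    then have "l * p \<in> lin L ps" using Cons by auto
    then show ?thesis using Cons.prems by (intro lin_ConsI[of _ 0 _ "l * p"]) (auto simp: sgrp_zero)
  qed
qed simp

lemma lin_subset:
  assumes "sgrp Y" "\<And>l p. l \<in> L \<Longrightarrow> p \<in> set ps \<Longrightarrow> l * p \<in> Y"
  shows "lin L ps \<subseteq> Y"
  using assms(2) by (induction ps) (use assms(1) in \<open>auto simp: sgrp_zero sgrp_add\<close>)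

lemma lin_smult: "(\<And>l. l \<in> L \<Longrightarrow> c * l \<in> L') \<Longrightarrow> v \<in> lin L ps \<Longrightarrow> c * v \<in> lin L' ps"
proof (induction ps arbitrary: v)
  case (Cons p ps)
  then obtain l w where *: "v = l * p + w" "l \<in> L" "w \<in> lin L ps" by auto
  have "c * v = (c * l) * p + c * w" using * by (simp add: algebra_simps)
  then show ?case using * Cons by auto
qed simp

lemma lin_times:
  assumes "sgrp L'" "\<And>l p. l \<in> L \<Longrightarrow> p \<in> set ps \<Longrightarrow> x * (l * p) \<in> lin L' qs"
  shows "v \<in> lin L ps \<Longrightarrow> x * v \<in> lin L' qs"
  using lin_subset[of "{v. x * v \<in> lin L' qs}" L ps] assms lin_sgrp[OF assms(1), of qs]
  by (auto simp: sgrp_def right_diff_distrib)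

lemma lin_mono: "L \<subseteq> L' \<Longrightarrow> v \<in> lin L ps \<Longrightarrow> v \<in> lin L' ps"
  using lin_smult[of L 1 L' v ps] by auto

lemma lin_mono_set: "sgrp L \<Longrightarrow> set ps \<subseteq> set qs \<Longrightarrow> v \<in> lin L ps \<Longrightarrow> v \<in> lin L qs"
  using lin_subset[of "lin L qs" L ps] lin_sgrp[of L qs] lin_mem[of L _ qs] by blast

text \<open>A determinant-free form of the Cayley-Hamilton trick: the generators are eliminated one by one.\<close>

lemma annihilating_monic:
  assumes N: "sgrp N" "\<And>c d. c \<in> N \<Longrightarrow> d \<in> N \<Longrightarrow> c * d \<in> N"
  shows "g \<in> lowp N x k \<Longrightarrow> \<forall>p\<in>set ps. (x ^ k + g) * p \<in> lin (lowp N x k) ps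
    \<Longrightarrow> \<exists>j. \<exists>h\<in>lowp N x j. \<forall>p\<in>set ps. (x ^ j + h) * p = 0"
proof (induction ps arbitrary: g k)
  case Nil then show ?case by (intro exI[of _ 0] bexI[of _ 0]) auto
next
  case (Cons p ps)
  define d where "d = x ^ k + g"
  obtain l v where lv: "d * p = l * p + v" "l \<in> lowp N x k" "v \<in> lin (lowp N x k) ps"
    using Cons.prems by (auto simp: d_def)
  \<comment> \<open>\<open>d' = d - l\<close> is again monic of degree \<open>k\<close>, and it
    sends \<open>p\<close> to \<open>v\<close>, a combination of \<open>ps\<close> alone.
    Multiplying the relations for the other generators by \<open>d'\<close> therefore eliminates
    \<open>p\<close> from them, at the price of doubling the degree.\<close>
  define d' where "d' = x ^ k + (g - l)"
  have gl: "g - l \<in> lowp N x k" using Cons.prems lv lowp_sgrp[OF N(1)] by (auto simp: sgrp_diff)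
  have d'p: "d' * p = v" using lv by (simp add: d_def d'_def algebra_simps)
  have sg: "sgrp (lowp N x (k + k))" by (simp add: lowp_sgrp N)
  have d'l: "d' * a \<in> lowp N x (k + k)" if "a \<in> lowp N x k" for a
    unfolding d'_def distrib_right using that gl N sg by (auto intro!: sgrp_add lowp_power lowp_times)
  define G where "G = x ^ k * g + (g - l) * x ^ k + (g - l) * g"
  have dd: "d' * d = x ^ (k + k) + G" by (simp add: d_def d'_def G_def power_add algebra_simps)
  have "x ^ k * g \<in> lowp N x (k + k)" "(g - l) * x ^ k \<in> lowp N x (k + k)" "(g - l) * g \<in> lowp N x (k + k)"
    using lowp_power[OF N(1) gl] lowp_power[OF N(1) Cons.prems(1)] lowp_times[OF N gl Cons.prems(1)] by (auto simp: mult.commute)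
  then have G: "G \<in> lowp N x (k + k)" unfolding G_def using sg by (auto simp: sgrp_add)
  have "(x ^ (k + k) + G) * q \<in> lin (lowp N x (k + k)) ps" if q: "q \<in> set ps" for q
  proof -
    have "d * q \<in> lin (lowp N x k) (p # ps)" using Cons.prems q by (auto simp: d_def)
    then obtain l' w where *: "d * q = l' * p + w" "l' \<in> lowp N x k" "w \<in> lin (lowp N x k) ps" by auto
    have "d' * (d * q) = l' * (d' * p) + d' * w" unfolding *(1) by (simp add: algebra_simps)
    then have "(x ^ (k + k) + G) * q = l' * v + d' * w" unfolding dd[symmetric] d'p by (simp add: mult.assoc)
    moreover have "l' * v \<in> lin (lowp N x (k + k)) ps" using lin_smult[OF _ lv(3)] lowp_times[OF N *(2)] by blast
    moreover have "d' * w \<in> lin (lowp N x (k + k)) ps" using lin_smult[OF _ *(3)] d'l by blast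
    ultimately show ?thesis using lin_sgrp[OF sg] by (simp add: sgrp_add)
  qed
  then obtain j h where jh: "h \<in> lowp N x j" "\<forall>q\<in>set ps. (x ^ j + h) * q = 0" using Cons.IH[OF G] by blast
  \<comment> \<open>The monic that kills \<open>ps\<close> also kills \<open>v = d' * p\<close>, so
    its product with \<open>d'\<close> kills \<open>p\<close> as well.\<close>
  define H where "H = x ^ j * (g - l) + h * x ^ k + h * (g - l)"
  have eq: "(x ^ j + h) * d' = x ^ (j + k) + H" by (simp add: d'_def H_def power_add algebra_simps)
  have "x ^ j * (g - l) \<in> lowp N x (j + k)" "h * x ^ k \<in> lowp N x (j + k)" "h * (g - l) \<in> lowp N x (j + k)"
    using lowp_power[OF N(1) gl] lowp_power[OF N(1) jh(1), of k] lowp_times[OF N jh(1) gl] by (auto simp: mult.commute add.commute)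
  then have H: "H \<in> lowp N x (j + k)" unfolding H_def by (simp add: sgrp_add lowp_sgrp N)
  have "lin (lowp N x k) ps \<subseteq> {v. (x ^ j + h) * v = 0}"
    using jh(2) by (intro lin_subset) (auto simp: sgrp_def right_diff_distrib mult.left_commute[of "x ^ j + h"])
  then have v0: "(x ^ j + h) * v = 0" using lv(3) by auto
  have "(x ^ (j + k) + H) * q = 0" if "q \<in> set (p # ps)" for q
  proof (cases "q = p")
    case True
    then show ?thesis using v0 d'p unfolding eq[symmetric] by (simp add: mult.assoc)
  next
    case False
    then have "(x ^ j + h) * q = 0" using that jh by auto
    then show ?thesis unfolding eq[symmetric] by (metis mult.assoc mult.commute mult_zero_right)
  qed
  then show ?case using H by blast
qed

section \<open>Integral elements and lying over\<close>

definition integral_over :: "'f::comm_ring_1 set \<Rightarrow> 'f \<Rightarrow> bool" where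
  "integral_over R q \<longleftrightarrow> (\<exists>n. \<exists>l\<in>lowp R q (Suc n). q ^ Suc n + l = 0)"

text \<open>Multiplication by \<open>x\<close> preserves the span of \<open>ps\<close>, so a monic
  in \<open>x\<close> kills every generator, in particular 1, and hence vanishes. One more factor
  \<open>x\<close> makes its degree positive.\<close>

lemma integral_overI:
  assumes "subr R" "1 \<in> set ps" "\<And>p. p \<in> set ps \<Longrightarrow> x * p \<in> lin R ps"
  shows "integral_over R x"
proof -
  note R = subrD[OF assms(1)]
  have "\<forall>p\<in>set ps. (x ^ 1 + 0) * p \<in> lin (lowp R x 1) ps"
    using assms(3) lin_mono[of R "lowp R x 1"] lowp_const[OF R(1), of _ x 0] by auto
  then obtain j h where "h \<in> lowp R x j" "(x ^ j + h) * 1 = 0"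
    using annihilating_monic[of R 0 x 1 ps] R lowp_sgrp[of R x 1] assms(2) by (metis sgrp_zero)
  then have "x * h \<in> lowp R x (Suc j)" "x ^ Suc j + x * h = 0"
    using R lowp_shift[of R h x j] by (auto simp: distrib_left[symmetric])
  then show ?thesis unfolding integral_over_def by blast
qed

text \<open>By induction on \<open>ss\<close>: a family that is good for \<open>ss\<close> is
  multiplied by the powers \<open>s^i\<close> with \<open>i \<le> n\<close>, where
  \<open>n + 1\<close> is the degree of an integral equation for \<open>s\<close>.\<close>

lemma finite_generation_of_integrals:
  assumes R: "subr R"
  shows "\<forall>s\<in>set ss. integral_over R s \<Longrightarrow> \<exists>ps. 1 \<in> set ps \<and> (\<forall>s\<in>set ss. \<forall>p\<in>set ps. s * p \<in> lin R ps)"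
proof (induction ss)
  case Nil show ?case by (intro exI[of _ "[1]"]) auto
next
  case (Cons s ss)
  note RD = subrD[OF R]
  obtain ps where ps: "1 \<in> set ps" "\<And>t p. t \<in> set ss \<Longrightarrow> p \<in> set ps \<Longrightarrow> t * p \<in> lin R ps" using Cons by auto
  obtain n l where l: "l \<in> lowp R s (Suc n)" "s ^ Suc n + l = 0" using Cons.prems unfolding integral_over_def by auto
  define qs where "qs = concat (map (\<lambda>i. map (\<lambda>p. s ^ i * p) ps) [0..<Suc n])"
  have mem: "s ^ i * p \<in> set qs" if "i \<le> n" "p \<in> set ps" for i p
    using that unfolding qs_def by (auto simp: image_iff intro!: bexI[of _ i] bexI[of _ p] simp del: upt_Suc)
  have qsE: "\<exists>i p. q = s ^ i * p \<and> i \<le> n \<and> p \<in> set ps" if "q \<in> set qs" for q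
    using that unfolding qs_def by (auto simp: less_Suc_eq_le simp del: upt_Suc) blast
  have sg: "sgrp (lin R qs)" by (rule lin_sgrp[OF RD(1)])
  \<comment> \<open>The exponents of \<open>s\<close> that occur are at most
    \<open>j + k - 1 \<le> n\<close>, so all of them are present in \<open>qs\<close>.\<close>
  have low: "s ^ j * (l' * p) \<in> lin R qs" if "l' \<in> lowp R s k" "j + k \<le> Suc n" "p \<in> set ps" for l' j k p
    using that
  proof (induction k arbitrary: l' j)
    case 0 then show ?case using sg by (simp add: sgrp_zero)
  next
    case (Suc k)
    then obtain c l'' where *: "l' = c + s * l''" "c \<in> R" "l'' \<in> lowp R s k" by auto
    have "s ^ j * (l' * p) = c * (s ^ j * p) + s ^ Suc j * (l'' * p)" using * by (simp add: algebra_simps)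
    moreover have "c * (s ^ j * p) \<in> lin R qs" using * Suc.prems by (auto intro!: lin_mem RD mem)
    ultimately show ?case using Suc.IH[OF *(3), of "Suc j"] Suc.prems sg by (auto simp: sgrp_add)
  qed
  have "t * q \<in> lin R qs" if t: "t \<in> set (s # ss)" and q: "q \<in> set qs" for t q
  proof -
    obtain i p where ip: "q = s ^ i * p" "i \<le> n" "p \<in> set ps" using qsE q by blast
    show ?thesis
    proof (cases "t \<in> set ss")
      case True
      have eq: "t * q = s ^ i * (t * p)" using ip by (simp add: algebra_simps)
      show ?thesis unfolding eq
      proof (rule lin_times[OF RD(1) _ ps(2)[OF True ip(3)]])
        fix l p assume "l \<in> R" "p \<in> set ps"
        then show "s ^ i * (l * p) \<in> lin R qs"
          using lin_mem[OF RD(1) mem[OF ip(2), of p], of l] by (simp add: algebra_simps)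
      qed
    next
      case False
      then have ts: "t = s" using t by auto
      show ?thesis
      proof (cases "i = n")
        case True
        have "s ^ Suc n = - l" using l(2) by (simp add: eq_neg_iff_add_eq_0)
        then have "t * q = - (l * p)" using ip ts True by (simp add: mult.assoc[symmetric])
        then show ?thesis using low[OF l(1), of 0 p] ip sg by (auto simp: sgrp_minus)
      next
        case False
        then have "1 * (s ^ Suc i * p) \<in> lin R qs" using ip by (intro lin_mem RD mem) auto
        then show ?thesis using ip ts by (simp add: mult.assoc)
      qed
    qed
  qed
  moreover have "1 \<in> set qs" using mem[of 0 1] ps by simp
  ultimately show ?case by blast
qed

lemma integral_over_mem: assumes "subr R" "r \<in> R" shows "integral_over R r"
proof -
  have "- r \<in> lowp R r (Suc 0)" using assms by (auto intro!: lowp_const subrD)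
  then show ?thesis unfolding integral_over_def by (force intro!: exI[of _ 0])
qed

lemma subr_integral_closure: assumes R: "subr R" shows "subr {q. integral_over R q}"
proof -
  note RD = subrD[OF R]
  have key: "integral_over R (x - y) \<and> integral_over R (x * y)" if xy: "integral_over R x" "integral_over R y" for x y
  proof -
    obtain ps where ps: "1 \<in> set ps" "\<And>p. p \<in> set ps \<Longrightarrow> x * p \<in> lin R ps" "\<And>p. p \<in> set ps \<Longrightarrow> y * p \<in> lin R ps"
      using finite_generation_of_integrals[OF R, of "[x, y]"] xy by auto
    have "(x - y) * p \<in> lin R ps" if "p \<in> set ps" for p
      using ps(2,3)[OF that] lin_sgrp[OF RD(1)] by (simp add: left_diff_distrib sgrp_diff)
    moreover have "(x * y) * p \<in> lin R ps" if "p \<in> set ps" for p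
      unfolding mult.assoc
    proof (rule lin_times[OF RD(1) _ ps(3)[OF that]])
      fix l p assume "l \<in> R" "p \<in> set ps"
      then show "x * (l * p) \<in> lin R ps"
        using lin_smult[of R l R "x * p" ps] ps(2) RD by (simp add: mult.left_commute)
    qed
    ultimately show ?thesis using integral_overI[OF R ps(1)] by blast
  qed
  show ?thesis unfolding subr_def
    using key integral_over_mem[OF R] RD by (auto intro!: sgrpI)
qed

text \<open>The Cayley-Hamilton trick for multiplication by 1. The span of \<open>ps\<close> is
  preserved by \<open>ss\<close>, so \<open>1 \<in> lin H ss\<close> writes each generator as a
  combination of the generators with coefficients in \<open>H\<close>. Hence \<open>1 + h\<close>
  kills them all for some \<open>h \<in> H\<close>, and 1 is one of them. \<open>H\<close> is not a
  subset of \<open>R\<close> in the application, but an ideal of a larger ring.\<close>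

lemma lying_over:
  assumes R: "subr R" and H: "sgrp H" "\<And>r h. r \<in> R \<Longrightarrow> h \<in> H \<Longrightarrow> r * h \<in> H" "\<And>h k. h \<in> H \<Longrightarrow> k \<in> H \<Longrightarrow> h * k \<in> H"
    and ss: "\<And>s. s \<in> set ss \<Longrightarrow> integral_over R s" and one: "1 \<in> lin H ss"
  shows "1 \<in> H"
proof -
  obtain ps where ps: "1 \<in> set ps" "\<And>s p. s \<in> set ss \<Longrightarrow> p \<in> set ps \<Longrightarrow> s * p \<in> lin R ps"
    using finite_generation_of_integrals[OF R, of ss] ss by blast
  have "p \<in> lin H ps" if p: "p \<in> set ps" for p
  proof -
    have "p * 1 \<in> lin H ps"
    proof (rule lin_times[OF H(1) _ one])
      fix h s assume hs: "h \<in> H" "s \<in> set ss"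
      have "h * (s * p) \<in> lin H ps"
        by (rule lin_smult[OF _ ps(2)[OF hs(2) p]]) (use H(2) hs in \<open>metis mult.commute\<close>)
      then show "p * (h * s) \<in> lin H ps" by (simp add: mult.commute mult.left_commute)
    qed
    then show ?thesis by simp
  qed
  then have "\<forall>p\<in>set ps. (1 ^ 1 + 0) * p \<in> lin (lowp H 1 1) ps"
    using lin_mono[of H "lowp H 1 1"] lowp_const[OF H(1), of _ 1 0] by auto
  then obtain j h where h: "h \<in> lowp H 1 j" "(1 ^ j + h) * 1 = 0"
    using annihilating_monic[OF H(1,3), of 0 1 1 ps] lowp_sgrp[OF H(1), of 1 1] ps(1) by (metis sgrp_zero)
  have "h \<in> H" using h(1)
  proof (induction j arbitrary: h)
    case 0 then show ?case using H by (simp add: sgrp_zero)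
  next
    case (Suc j) then show ?case using H by (auto simp: sgrp_add)
  qed
  moreover have "1 = - h" using h(2) by (simp add: eq_neg_iff_add_eq_0)
  ultimately show ?thesis using H(1) sgrp_minus by metis
qed

text \<open>The binomial theorem without coefficients: one factor \<open>x + y\<close> is split off
  and its two terms are moved into \<open>t\<close>, which lowers \<open>p\<close> or
  \<open>q\<close> by one. The multiplier \<open>t\<close> is there to make this induction
  possible.\<close>

lemma power_add_mem:
  assumes G: "ideal_of T G" "subr T" and xy: "x \<in> T" "y \<in> T"
  shows "t \<in> T \<Longrightarrow> x ^ p * t \<in> G \<Longrightarrow> y ^ q * t \<in> G \<Longrightarrow> (x + y) ^ (p + q) * t \<in> G"
proof (induction "p + q" arbitrary: p q t)
  case 0 then show ?case by simp
next
  case (Suc n)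
  note T = subrD[OF G(2)] and GD = ideal_ofD[OF G(1)]
  show ?case
  proof (cases "p = 0 \<or> q = 0")
    case True
    then have "t \<in> G" using Suc.prems by auto
    then show ?thesis using GD(3)[OF subr_power[OF G(2) T(5)[OF xy]]] by simp
  next
    case False
    then obtain p' q' where pq: "p = Suc p'" "q = Suc q'" by (meson not0_implies_Suc)
    have "(x + y) ^ (p' + q) * (x * t) \<in> G"
    proof (rule Suc.hyps(1))
      have "y ^ q * (x * t) = x * (y ^ q * t)" by (simp add: algebra_simps)
      then show "y ^ q * (x * t) \<in> G" using GD(3)[OF xy(1) Suc.prems(3)] by (simp only:)
      show "x ^ p' * (x * t) \<in> G" using Suc.prems(2) pq by (simp add: mult.left_commute mult.assoc)
    qed (use Suc.hyps(2) pq in \<open>simp_all add: xy T Suc.prems(1)\<close>)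
    moreover have "(x + y) ^ (p + q') * (y * t) \<in> G"
    proof (rule Suc.hyps(1))
      have "x ^ p * (y * t) = y * (x ^ p * t)" by (simp add: algebra_simps)
      then show "x ^ p * (y * t) \<in> G" using GD(3)[OF xy(2) Suc.prems(2)] by (simp only:)
      show "y ^ q' * (y * t) \<in> G" using Suc.prems(3) pq by (simp add: mult.left_commute mult.assoc)
    qed (use Suc.hyps(2) pq in \<open>simp_all add: xy T Suc.prems(1)\<close>)
    moreover have "(x + y) ^ (p + q) * t = (x + y) ^ (p' + q) * (x * t) + (x + y) ^ (p + q') * (y * t)"
      using pq by (simp add: algebra_simps)
    ultimately show ?thesis using sgrp_add[OF GD(1)] by simp
  qed
qed

text \<open>A group is not the union of two proper subgroups, whereas it can be the union of three.
  The bound of two on the number of maximal ideals is used in this form.\<close>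

lemma avoid_two:
  assumes "sgrp K" "sgrp P" "sgrp P'" "\<not> K \<subseteq> P" "\<not> K \<subseteq> P'"
  obtains u where "u \<in> K" "u \<notin> P" "u \<notin> P'"
proof -
  obtain x y where "x \<in> K" "x \<notin> P" "y \<in> K" "y \<notin> P'" using assms by blast
  moreover have "x + y \<in> K" using calculation assms sgrp_add by blast
  ultimately show ?thesis
    using that sgrp_add_cancel[OF assms(2), of y x] sgrp_add_cancel[OF assms(3), of x y]
    by (metis add.commute)
qed

text \<open>The product is biadditive: the \<open>k\<close> whose products with all of
  \<open>H\<close> fall into \<open>P\<close> form a subgroup, so a suitable \<open>u\<close> is
  found first, and then for this fixed \<open>u\<close> a suitable \<open>v\<close>.\<close>

lemma avoid_two_product:
  assumes K: "sgrp K" "sgrp H" and P: "sgrp P" "sgrp P'"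
    and "k \<in> K" "h \<in> H" "k * h \<notin> P" "k' \<in> K" "h' \<in> H" "k' * h' \<notin> P'"
  obtains u v where "u \<in> K" "v \<in> H" "u * v \<notin> P" "u * v \<notin> P'"
proof -
  have "sgrp {k. \<forall>h\<in>H. k * h \<in> P}" "sgrp {k. \<forall>h\<in>H. k * h \<in> P'}"
    using P by (auto simp: sgrp_def left_diff_distrib)
  moreover have "\<not> K \<subseteq> {k. \<forall>h\<in>H. k * h \<in> P}" "\<not> K \<subseteq> {k. \<forall>h\<in>H. k * h \<in> P'}"
    using assms(5-) by auto
  ultimately obtain u where u: "u \<in> K" "u \<notin> {k. \<forall>h\<in>H. k * h \<in> P}" "u \<notin> {k. \<forall>h\<in>H. k * h \<in> P'}"
    using avoid_two[OF K(1)] by blast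
  have "sgrp {v. u * v \<in> P}" "sgrp {v. u * v \<in> P'}"
    using P by (auto simp: sgrp_def right_diff_distrib)
  moreover have "\<not> H \<subseteq> {v. u * v \<in> P}" "\<not> H \<subseteq> {v. u * v \<in> P'}" using u by auto
  ultimately obtain v where "v \<in> H" "v \<notin> {v. u * v \<in> P}" "v \<notin> {v. u * v \<in> P'}"
    using avoid_two[OF K(2)] by blast
  then show ?thesis using that u by blast
qed

lemma sgrp_image: assumes "sgrp G" shows "sgrp ((\<lambda>g. c * g) ` G)"
proof (rule sgrpI)
  show "0 \<in> (\<lambda>g. c * g) ` G" using sgrp_zero[OF assms] by (intro image_eqI[of _ _ 0]) simp_all
  fix x y assume "x \<in> (\<lambda>g. c * g) ` G" "y \<in> (\<lambda>g. c * g) ` G"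
  then obtain g h where "x = c * g" "y = c * h" "g \<in> G" "h \<in> G" by blast
  then show "x - y \<in> (\<lambda>g. c * g) ` G"
    using sgrp_diff[OF assms] by (intro image_eqI[of _ _ "g - h"]) (simp_all add: right_diff_distrib)
qed

text \<open>For a full preimage \<open>K\<close> this is the ring E(K). With \<open>colon\<close>
  below, \<open>colon (mults K) K\<close> is the inverse of \<open>K\<close> over E(K).\<close>

definition mults :: "'f::comm_ring_1 set \<Rightarrow> 'f set" where
  "mults K = {q. \<forall>k\<in>K. q * k \<in> K}"

definition colon :: "'f::comm_ring_1 set \<Rightarrow> 'f set \<Rightarrow> 'f set" where
  "colon A K = {h. \<forall>k\<in>K. h * k \<in> A}"

lemma subr_mults: "sgrp K \<Longrightarrow> subr (mults K)"
  by (auto simp: subr_def mults_def sgrp_def left_diff_distrib mult.assoc)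

lemma sgrp_colon: "sgrp A \<Longrightarrow> sgrp (colon A K)"
  by (auto simp: colon_def sgrp_def left_diff_distrib)

section \<open>Subrings of a total ring of fractions\<close>

text \<open>The ring under study is \<open>R / I\<close>, a local ring with maximal ideal \<open>M / I\<close>, inside its total ring of
  fractions \<open>F / I\<close>, where \<open>F\<close> is all of the type \<open>'f\<close>. Subsets of the total ring of fractions are represented
  by their preimages in \<open>F\<close>, so that no carrier conditions arise.\<close>

locale ctx =
  fixes I R M :: "'f::comm_ring_1 set" and m im :: 'f
  assumes ideal_I: "ideal_of UNIV I"
    and subr_R: "subr R" and I_R: "I \<subseteq> R"
    and ideal_M: "ideal_of R M" and I_M: "I \<subseteq> M" and one_M: "1 \<notin> M"
    and inverse_R: "r \<in> R \<Longrightarrow> r \<notin> M \<Longrightarrow> \<exists>s\<in>R. r * s - 1 \<in> I"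
    and m_M: "m \<in> M" and m_im: "m * im - 1 \<in> I"
    \<comment> \<open>The two traces of dimension one: the total ring of fractions is
      \<open>R[1/m]\<close>, and modulo \<open>I\<close> the element \<open>m\<close> divides a
      power of each element of \<open>M\<close>.\<close>
    and denom: "\<exists>k. m ^ k * q \<in> R"
    and rad: "x \<in> M \<Longrightarrow> \<exists>k. im * x ^ k \<in> R"
begin

definition cong :: "'f \<Rightarrow> 'f \<Rightarrow> bool" (infix "\<doteq>" 50) where "x \<doteq> y \<longleftrightarrow> x - y \<in> I"

lemma I_mult: "x \<in> I \<Longrightarrow> y * x \<in> I" "x \<in> I \<Longrightarrow> x * y \<in> I"
  using ideal_ofD[OF ideal_I] by auto

lemma sgrp_I: "sgrp I" using ideal_ofD[OF ideal_I] by auto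

lemma cong_refl [simp]: "x \<doteq> x" using sgrp_I by (simp add: cong_def sgrp_zero)

lemma cong_sym: "x \<doteq> y \<Longrightarrow> y \<doteq> x" using sgrp_minus[OF sgrp_I, of "x - y"] by (simp add: cong_def)

lemma cong_trans [trans]: "x \<doteq> y \<Longrightarrow> y \<doteq> z \<Longrightarrow> x \<doteq> z"
  using sgrp_add[OF sgrp_I, of "x - y" "y - z"] by (simp add: cong_def)

lemma cong_mult: assumes "x \<doteq> y" "z \<doteq> w" shows "x * z \<doteq> y * w"
proof -
  have "x * z - y * w = (x - y) * z + y * (z - w)" by (simp add: algebra_simps)
  then show ?thesis using assms by (auto simp: cong_def intro: sgrp_add[OF sgrp_I] I_mult)
qed

lemma cong_add: assumes "x \<doteq> y" "z \<doteq> w" shows "x + z \<doteq> y + w"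
  using sgrp_add[OF sgrp_I, of "x - y" "z - w"] assms by (simp add: cong_def algebra_simps)

lemma cong_diff: assumes "x \<doteq> y" "z \<doteq> w" shows "x - z \<doteq> y - w"
  using sgrp_diff[OF sgrp_I, of "x - y" "z - w"] assms by (simp add: cong_def algebra_simps)

lemma cong_power: "x \<doteq> y \<Longrightarrow> x ^ n \<doteq> y ^ n"
  by (induction n) (auto intro: cong_mult)

lemma cong_mult1: "u \<doteq> 1 \<Longrightarrow> u * x \<doteq> x"
  using cong_mult[of u 1 x x] by simp

lemma cong_mem: "sgrp Y \<Longrightarrow> I \<subseteq> Y \<Longrightarrow> x \<doteq> y \<Longrightarrow> x \<in> Y \<longleftrightarrow> y \<in> Y"
  unfolding cong_def using sgrp_diff_cancel by blast



lemma inv_power: "u * v \<doteq> 1 \<Longrightarrow> u ^ n * v ^ n \<doteq> 1"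
  using cong_power[of "u * v" 1 n] by (simp add: power_mult_distrib)

lemma m_im': "m * im \<doteq> 1" using m_im by (simp add: cong_def)

lemma inverse_R': "r \<in> R \<Longrightarrow> r \<notin> M \<Longrightarrow> \<exists>s\<in>R. r * s \<doteq> 1"
  using inverse_R by (simp add: cong_def)

lemmas RD = subrD[OF subr_R] and MD = ideal_ofD[OF ideal_M]

section \<open>The integral closure and the ideals of intermediate rings\<close>

definition S :: "'f set" where "S = {q. integral_over R q}"

lemma subr_S: "subr S" unfolding S_def by (rule subr_integral_closure[OF subr_R])

lemmas SD = subrD[OF subr_S]

lemma R_S: "R \<subseteq> S" unfolding S_def using integral_over_mem[OF subr_R] by auto

lemma I_S: "I \<subseteq> S" using I_R R_S by auto

text \<open>Maximality in elementwise form: what lies outside \<open>N\<close> is invertible modulo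
  \<open>N\<close>. This can be checked on preimages and on contractions to subrings without
  quantifying over ideals.\<close>

definition max_ideal :: "'f set \<Rightarrow> 'f set \<Rightarrow> bool" where
  "max_ideal B N \<longleftrightarrow> ideal_of B N \<and> I \<subseteq> N \<and> 1 \<notin> N \<and> (\<forall>x\<in>B. x \<notin> N \<longrightarrow> (\<exists>b\<in>B. x * b - 1 \<in> N))"

definition prime_ideal :: "'f set \<Rightarrow> 'f set \<Rightarrow> bool" where
  "prime_ideal B P \<longleftrightarrow> ideal_of B P \<and> I \<subseteq> P \<and> 1 \<notin> P \<and> (\<forall>x\<in>B. \<forall>y\<in>B. x * y \<in> P \<longrightarrow> x \<in> P \<or> y \<in> P)"

text \<open>For a ring with at most two maximal ideals \<open>P\<close> and \<open>P'\<close> (equal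
  if there is only one) this says that every non-unit lies in one of them. The bound on their number
  is used in this form.\<close>

definition covers :: "'f set \<Rightarrow> 'f set \<Rightarrow> 'f set \<Rightarrow> bool" where
  "covers B P P' \<longleftrightarrow> (\<forall>x\<in>B. x \<notin> P \<and> x \<notin> P' \<longrightarrow> (\<exists>b\<in>B. x * b \<doteq> 1))"

lemma max_prime: assumes "subr B" "max_ideal B N" shows "prime_ideal B N"
proof -
  have "y \<in> N" if xy: "x \<in> B" "y \<in> B" "x * y \<in> N" "x \<notin> N" for x y
  proof -
    obtain b where b: "b \<in> B" "x * b - 1 \<in> N" using assms(2) xy(1,4) unfolding max_ideal_def by blast
    have "y = b * (x * y) - y * (x * b - 1)" by (simp add: algebra_simps)
    moreover have N: "ideal_of B N" using assms by (simp add: max_ideal_def)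
    ultimately show ?thesis
      using sgrp_diff[OF ideal_ofD(1)[OF N] ideal_ofD(3)[OF N b(1) that(3)] ideal_ofD(3)[OF N that(2) b(2)]] by simp
  qed
  then show ?thesis using assms by (auto simp: max_ideal_def prime_ideal_def)
qed

lemma prime_power: assumes "subr B" "prime_ideal B P" "x \<in> B" "x ^ n \<in> P" shows "x \<in> P"
  using assms(4)
proof (induction n)
  case (Suc n)
  then show ?case using assms(2,3) subr_power[OF assms(1,3), of n] unfolding prime_ideal_def by auto
qed (use assms in \<open>auto simp: prime_ideal_def\<close>)

lemma contraction_M:
  assumes "R \<subseteq> B" "ideal_of B N" "I \<subseteq> N" "1 \<notin> N" "x \<in> R" "x \<in> N" shows "x \<in> M"
proof (rule ccontr)
  assume "x \<notin> M"
  then obtain s where "s \<in> R" "x * s \<doteq> 1" using inverse_R' assms by blast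
  moreover have "x * s \<in> N" using calculation assms ideal_ofD[OF assms(2)] by auto
  ultimately show False using cong_mem[of N "x * s" 1] assms ideal_ofD[OF assms(2)] by auto
qed

text \<open>If \<open>b\<close> inverted some \<open>x \<in> M\<close> modulo \<open>N\<close>, an
  integral equation of degree \<open>n + 1\<close> for \<open>b\<close>, multiplied by
  \<open>x^(n+1)\<close>, would become \<open>1 + x * r \<in> N\<close> with
  \<open>r \<in> R\<close>. But \<open>1 + x * r\<close> is an element of \<open>R\<close> outside
  \<open>M\<close>, hence a unit.\<close>

lemma max_contains_M:
  assumes B: "subr B" "R \<subseteq> B" "B \<subseteq> S" and N: "max_ideal B N"
  shows "M \<subseteq> N"
proof (rule subsetI, rule ccontr)
  fix x assume x: "x \<in> M" "x \<notin> N"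
  note BD = subrD[OF B(1)]
  have ND: "ideal_of B N" "I \<subseteq> N" "1 \<notin> N" using N by (auto simp: max_ideal_def)
  note ND' = ideal_ofD[OF ND(1)]
  have xB: "x \<in> B" "x \<in> R" using x MD B by auto
  obtain b where b: "b \<in> B" "x * b - 1 \<in> N" using N xB x by (auto simp: max_ideal_def)
  obtain n l where l: "l \<in> lowp R b (Suc n)" "b ^ Suc n + l = 0"
    using b B unfolding S_def integral_over_def by blast
  have pow: "(x * b) ^ k - 1 \<in> N" for k
  proof (induction k)
    case (Suc k)
    have "(x * b) ^ Suc k - 1 = (x * b) ^ k * (x * b - 1) + ((x * b) ^ k - 1)" by (simp add: algebra_simps)
    moreover have "(x * b) ^ k \<in> B" using subr_power B xB b BD by blast
    ultimately show ?case using sgrp_add[OF ND'(1) ND'(3)[OF _ b(2)] Suc] by (simp only:)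
  qed (use ND' in \<open>simp add: sgrp_zero\<close>)
  \<comment> \<open>A power \<open>b^i\<close> with \<open>i < k\<close> turns into
    \<open>x^(k-i)\<close> modulo \<open>N\<close>, so at least one factor \<open>x\<close> survives
    in every term.\<close>
  have low: "\<exists>r\<in>R. x ^ k * l - x * r \<in> N" if "l \<in> lowp R b k" for k l
    using that
  proof (induction k arbitrary: l)
    case 0 then show ?case using RD ND' by (intro bexI[of _ 0]) (auto simp: sgrp_zero)
  next
    case (Suc k)
    then obtain c l' where *: "l = c + b * l'" "c \<in> R" "l' \<in> lowp R b k" by auto
    obtain r where r: "r \<in> R" "x ^ k * l' - x * r \<in> N" using Suc * by blast
    have "x ^ Suc k * l - x * (x ^ k * c + r) = (x ^ k * l') * (x * b - 1) + (x ^ k * l' - x * r)"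
      using * by (simp add: algebra_simps)
    moreover have "x ^ k * l' \<in> B" using lowp_subset[OF B(1) b(1) B(2) *(3)] subr_power[OF B(1)] xB BD by blast
    ultimately have "x ^ Suc k * l - x * (x ^ k * c + r) \<in> N"
      using sgrp_add[OF ND'(1) ND'(3)[OF _ b(2)] r(2)] by (simp only:)
    moreover have "x ^ k * c + r \<in> R" using r * subr_power[OF subr_R xB(2)] by (simp add: RD)
    ultimately show ?case by blast
  qed
  obtain r where r: "r \<in> R" "x ^ Suc n * l - x * r \<in> N" using low[OF l(1)] by blast
  have "x ^ Suc n * (b ^ Suc n + l) = 0" using l by simp
  then have "(x * b) ^ Suc n + x ^ Suc n * l = 0" by (simp only: distrib_left power_mult_distrib)
  moreover have "1 + x * r + (((x * b) ^ Suc n - 1) + (x ^ Suc n * l - x * r)) = (x * b) ^ Suc n + x ^ Suc n * l"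
    by (simp only: algebra_simps)
  ultimately have "((x * b) ^ Suc n - 1) + (x ^ Suc n * l - x * r) + (1 + x * r) \<in> N"
    using ND' by (simp only: add.commute sgrp_zero)
  then have *: "1 + x * r \<in> N" using sgrp_add_cancel[OF ND'(1) sgrp_add[OF ND'(1) pow r(2)]] by blast
  have "1 + x * r \<in> M" using contraction_M[OF B(2) ND _ *] RD xB r by auto
  moreover have "x * r \<in> M" using x r MD by auto
  ultimately have "1 \<in> M" using sgrp_add_cancel[of M "x * r" 1] MD by (auto simp: add.commute)
  then show False using one_M by simp
qed

text \<open>An integral equation of degree \<open>n + 1\<close> for \<open>v = 1/t\<close>,
  multiplied by \<open>t^n\<close>, expresses \<open>v\<close> as a polynomial in \<open>t\<close>
  with coefficients in \<open>R\<close>.\<close>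

lemma inverse_in_subring:
  assumes B: "subr B" "R \<subseteq> B" and t: "t \<in> B" and v: "v \<in> S" "t * v \<doteq> 1"
  shows "v \<in> B"
proof -
  note BD = subrD[OF B(1)]
  have IB: "I \<subseteq> B" using I_R B by auto
  obtain n l where l: "l \<in> lowp R v (Suc n)" "v ^ Suc n + l = 0"
    using v unfolding S_def integral_over_def by blast
  have low: "t ^ k * l \<in> B" if "l \<in> lowp R v (Suc k)" for k l
    using that
  proof (induction k arbitrary: l)
    case 0 then show ?case using B by auto
  next
    case (Suc k)
    then obtain c l' where *: "l = c + v * l'" "c \<in> R" "l' \<in> lowp R v (Suc k)" by auto
    have "t ^ Suc k * l = t ^ Suc k * c + (t * v) * (t ^ k * l')" using * by (simp add: algebra_simps)
    also have "\<dots> \<doteq> t ^ Suc k * c + t ^ k * l'" by (intro cong_add cong_mult1 v) simp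
    finally have eq: "t ^ Suc k * l \<doteq> t ^ Suc k * c + t ^ k * l'" .
    have "t ^ Suc k * c + t ^ k * l' \<in> B"
      using subr_power[OF B(1) t, of "Suc k"] *(2) B(2) Suc.IH[OF *(3)] BD(4,5) by blast
    then show ?case using cong_mem[OF BD(1) IB eq] by simp
  qed
  have "v ^ Suc n = - l" using l(2) by (simp add: eq_neg_iff_add_eq_0)
  moreover have "(t ^ n * v ^ n) * v = t ^ n * v ^ Suc n" by (simp add: algebra_simps)
  ultimately have "(t ^ n * v ^ n) * v = - (t ^ n * l)" by simp
  moreover have "(t ^ n * v ^ n) * v \<doteq> v" by (intro cong_mult1 inv_power v)
  ultimately show ?thesis using low[OF l(1)] BD(7) cong_mem[OF BD(1) IB] by metis
qed

section \<open>Quadratic extensions and powers of elements of a prime\<close>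

definition quadr :: "'f set \<Rightarrow> bool" where
  "quadr T \<longleftrightarrow> (\<forall>x\<in>T. \<forall>y\<in>T. \<exists>a\<in>R. \<exists>b\<in>R. \<exists>c\<in>R. x * y = a * x + b * y + c)"

lemma quadr_square:
  assumes "quadr T" "x \<in> T" obtains a c where "a \<in> R" "c \<in> R" "x * x = a * x + c"
proof -
  obtain a b c where "a \<in> R" "b \<in> R" "c \<in> R" "x * x = a * x + b * x + c" using assms unfolding quadr_def by blast
  then show ?thesis using that[of "a + b" c] RD by (simp add: algebra_simps)
qed

text \<open>Locally at \<open>P\<close> the element \<open>s\<close> is nilpotent modulo
  \<open>m\<close>. In \<open>s^2 = as + c\<close> the constant \<open>c = s(s - a)\<close> lies in
  \<open>M\<close>, so \<open>m\<close> divides a power of it. If \<open>a\<close> is outside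
  \<open>M\<close>, then \<open>s - a\<close> is outside \<open>P\<close> and a power of it serves
  as \<open>u\<close>. Otherwise \<open>m\<close> divides a power of \<open>a\<close> as well, hence
  a power of \<open>s^2 = as + c\<close>, and \<open>u = 1\<close>.\<close>

lemma power_in_mT:
  assumes T: "subr T" "R \<subseteq> T" "quadr T" and P: "prime_ideal T P" and MP: "M \<subseteq> P" and s: "s \<in> P"
  obtains k u where "u \<in> T" "u \<notin> P" "im * (u * s ^ k) \<in> T"
proof -
  note TD = subrD[OF T(1)]
  have PD: "ideal_of T P" "I \<subseteq> P" "1 \<notin> P" using P by (auto simp: prime_ideal_def)
  note PD' = ideal_ofD[OF PD(1)]
  have IT: "I \<subseteq> T" using T I_R by auto
  have sT: "s \<in> T" using s PD' by auto
  obtain a c where ac: "a \<in> R" "c \<in> R" "s * s = a * s + c" using quadr_square[OF T(3) sT] .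
  have aT: "a \<in> T" "c \<in> T" using ac T by auto
  have ceq: "c = s * (s - a)" using ac by (simp add: algebra_simps)
  have "c \<in> P" unfolding ceq by (rule PD'(4)) (simp_all add: s sT aT TD)
  then have cM: "c \<in> M" using contraction_M[OF T(2) PD ac(2)] by simp
  obtain k where k: "im * c ^ k \<in> R" using rad[OF cM] by blast
  show ?thesis
  proof (cases "a \<in> M")
    case False
    have "s - a \<notin> P" using contraction_M[OF T(2) PD ac(1)] False s PD' sgrp_diff_cancel[of P s a] by auto
    moreover have saT: "s - a \<in> T" using sT aT TD by simp
    ultimately have "(s - a) ^ k \<notin> P" using prime_power[OF T(1) P] by blast
    moreover have "im * ((s - a) ^ k * s ^ k) \<in> T"
      using k T(2) unfolding ceq by (auto simp: power_mult_distrib mult.commute)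
    ultimately show ?thesis using that subr_power[OF T(1) saT] by blast
  next
    case True
    obtain j where j: "im * a ^ j \<in> R" using rad[OF True] by blast
    \<comment> \<open>Up to \<open>I\<close> this is the ideal \<open>mT\<close>; it contains a
      power of \<open>as\<close> and a power of \<open>c\<close>, hence one of their sum.\<close>
    define G where "G = {z \<in> T. im * z \<in> T}"
    have G: "ideal_of T G" unfolding ideal_of_def G_def
      by (auto intro!: sgrpI simp: TD right_diff_distrib mult.left_commute[of im])
    have "(a * s) ^ j * 1 \<in> G"
    proof -
      have "im * (a * s) ^ j = (im * a ^ j) * s ^ j" by (simp only: power_mult_distrib mult.assoc)
      moreover have "(a * s) ^ j \<in> T" using subr_power[OF T(1)] sT aT TD by simp
      moreover have "im * a ^ j * s ^ j \<in> T" using j T(2) subr_power[OF T(1) sT] TD by auto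
      ultimately show ?thesis unfolding G_def by simp
    qed
    moreover have "c ^ k * 1 \<in> G" using k T(2) subr_power[OF T(1)] aT unfolding G_def by auto
    ultimately have "(a * s + c) ^ (j + k) * 1 \<in> G"
      using power_add_mem[OF G T(1), of "a * s" c 1] aT sT TD by simp
    then have "im * (s * s) ^ (j + k) \<in> T" unfolding ac(3) G_def by auto
    then have "im * (1 * s ^ (2 * (j + k))) \<in> T" by (simp only: power_mult power2_eq_square mult_1)
    then show ?thesis using that[of 1] TD(3) PD(3) by blast
  qed
qed

section \<open>Finitely stable rings\<close>

text \<open>\<open>colon (mults K) K\<close> times \<open>K\<close> contains 1; the additive group \<open>N\<close> replaces the finite sums of products.\<close>

definition invertible :: "'f set \<Rightarrow> bool" where
  "invertible K \<longleftrightarrow> (\<forall>N. sgrp N \<and> I \<subseteq> N \<and> (\<forall>h\<in>colon (mults K) K. \<forall>k\<in>K. h * k \<in> N) \<longrightarrow> 1 \<in> N)"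

text \<open>The summand from \<open>I\<close> turns the linear combinations into a full preimage of
  the module they generate.\<close>

definition gen :: "'f list \<Rightarrow> 'f set" where
  "gen ps = {v + i | v i. v \<in> lin R ps \<and> i \<in> I}"

text \<open>The generators may be any fractions, since a power of \<open>m\<close> clears their
  denominators. The unit \<open>u\<close> expresses regularity, and of projectivity over the
  multiplier ring only invertibility is kept.\<close>

definition fin_stable :: bool where
  "fin_stable \<longleftrightarrow> (\<forall>ps. (\<exists>u\<in>lin R ps. \<exists>v. u * v \<doteq> 1) \<longrightarrow> invertible (gen ps))"

lemma sgrp_lin_R: "sgrp (lin R ps)" by (rule lin_sgrp[OF RD(1)])

lemma lin_gen: "lin R ps \<subseteq> gen ps"
  unfolding gen_def using sgrp_zero[OF sgrp_I] by force

lemma gen_mem: "p \<in> set ps \<Longrightarrow> p \<in> gen ps"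
  using lin_gen lin_mem[OF RD(1) _ RD(3), of p ps] by auto

lemma sgrp_gen: "sgrp (gen ps)"
proof (rule sgrpI)
  show "0 \<in> gen ps" using lin_gen sgrp_zero[OF sgrp_lin_R] by blast
  fix x y assume "x \<in> gen ps" "y \<in> gen ps"
  then obtain v i w j where *: "x = v + i" "y = w + j" "v \<in> lin R ps" "w \<in> lin R ps" "i \<in> I" "j \<in> I"
    unfolding gen_def by auto
  have "x - y = (v - w) + (i - j)" using * by simp
  then show "x - y \<in> gen ps" unfolding gen_def using * sgrp_diff[OF sgrp_lin_R] sgrp_diff[OF sgrp_I] by blast
qed

lemma I_gen: "I \<subseteq> gen ps"
  unfolding gen_def using sgrp_zero[OF sgrp_lin_R] by force

lemma gen_subset:
  assumes "sgrp Y" "I \<subseteq> Y" "\<And>r p. r \<in> R \<Longrightarrow> p \<in> set ps \<Longrightarrow> r * p \<in> Y"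
  shows "gen ps \<subseteq> Y"
  using lin_subset[OF assms(1), of R ps] assms sgrp_add[OF assms(1)] unfolding gen_def by blast

lemma gen_lin: assumes "1 \<in> set ps" shows "gen ps = lin R ps"
proof
  have "I \<subseteq> lin R ps" using lin_mem[OF RD(1) assms] I_R by force
  then show "gen ps \<subseteq> lin R ps" using gen_subset[OF sgrp_lin_R, of ps ps] lin_mem[OF RD(1)] by blast
qed (rule lin_gen)

text \<open>A prime of \<open>S\<close> containing all products \<open>h * k\<close> would contain 1
  by invertibility. So \<open>P\<close> and \<open>P'\<close> each miss some product, and by
  biadditivity one product is missed by both. When the two primes cover \<open>S\<close>, it is a
  unit of \<open>S\<close>, which makes \<open>x\<close> the candidate for a generator of
  \<open>K\<close>.\<close>

lemma invertible_unit:
  assumes K: "sgrp K" "invertible K" and A: "mults K \<subseteq> S"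
    and P: "prime_ideal S P" "prime_ideal S P'"
  obtains x h where "x \<in> K" "h \<in> colon (mults K) K" "x * h \<in> S" "x * h \<notin> P" "x * h \<notin> P'"
proof -
  let ?H = "colon (mults K) K"
  have PD: "sgrp P" "sgrp P'" using P ideal_ofD(1) unfolding prime_ideal_def by blast+
  have *: "\<exists>k\<in>K. \<exists>h\<in>?H. k * h \<notin> Q" if Q: "prime_ideal S Q" for Q
  proof (rule ccontr)
    assume "\<not> ?thesis"
    then have "\<forall>h\<in>?H. \<forall>k\<in>K. h * k \<in> Q" by (metis mult.commute)
    then show False using K(2) Q ideal_ofD(1) unfolding invertible_def prime_ideal_def by blast
  qed
  have "sgrp ?H" by (intro sgrp_colon subrD(1) subr_mults K)
  then obtain x h where xh: "x \<in> K" "h \<in> ?H" "x * h \<notin> P" "x * h \<notin> P'"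
    using avoid_two_product[OF K(1) _ PD] *[OF P(1)] *[OF P(2)] by metis
  moreover have "x * h \<in> S" using xh(1,2) A unfolding colon_def by (auto simp: mult.commute)
  ultimately show ?thesis using that by blast
qed

text \<open>A finitely generated \<open>R\<close>-module \<open>K\<close> between \<open>R\<close> and \<open>S\<close> is a ring: its inverse over \<open>A = mults K\<close> is an
  ideal of \<open>A\<close> that generates the unit ideal of \<open>S\<close>, hence contains 1.\<close>

lemma fin_stable_quadr: assumes fs: fin_stable shows "quadr S"
  unfolding quadr_def
proof (intro ballI)
  fix x y assume xy: "x \<in> S" "y \<in> S"
  define K where "K = gen [1, x, y]"
  define A where "A = mults K"
  define H where "H = colon A K"
  have oneK: "1 \<in> K" unfolding K_def by (rule gen_mem) simp
  have "1 \<in> lin R [1, x, y]" using oneK unfolding K_def by (simp only: gen_lin list.set_intros)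
  moreover have "1 * 1 \<doteq> 1" by simp
  ultimately have inv: "invertible K" using fs unfolding fin_stable_def K_def by blast
  have sK: "sgrp K" unfolding K_def by (rule sgrp_gen)
  have KS: "K \<subseteq> S" unfolding K_def
  proof (rule gen_subset[OF SD(1) I_S])
    fix r p assume "r \<in> R" "p \<in> set [1, x, y]"
    then show "r * p \<in> S" using R_S xy by (auto simp: SD)
  qed
  have A: "subr A" unfolding A_def by (rule subr_mults[OF sK])
  have AK: "A \<subseteq> K" using oneK unfolding A_def mults_def by force
  have HA: "H \<subseteq> A" using oneK unfolding H_def colon_def by force
  have RA: "R \<subseteq> A"
  proof
    fix r assume r: "r \<in> R"
    have "\<forall>k\<in>lin R [1, x, y]. r * k \<in> lin R [1, x, y]"
      using lin_smult[of R r R] r RD(4) by blast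
    then show "r \<in> A" unfolding A_def mults_def K_def by (simp only: gen_lin list.set_intros mem_Collect_eq)
  qed
  have sH: "sgrp H" unfolding H_def by (rule sgrp_colon[OF subrD(1)[OF A]])
  have AH: "a * h \<in> H" if "a \<in> A" "h \<in> H" for a h
    using that subrD(4)[OF A] unfolding H_def colon_def by (simp add: mult.assoc)
  have IA: "I \<subseteq> A" using RA I_R by auto
  have IH: "I \<subseteq> H" using IA I_mult(2) unfolding H_def colon_def by blast
  \<comment> \<open>This is the product \<open>HS\<close>. It contains all \<open>h * k\<close>, so
    that invertibility of \<open>K\<close> yields \<open>1 \<in> HS\<close>.\<close>
  define N where "N = {z. \<exists>ss. set ss \<subseteq> S \<and> z \<in> lin H ss}"
  have "sgrp N"
  proof (rule sgrpI)
    have "0 \<in> lin H []" by simp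
    then show "0 \<in> N" unfolding N_def by (intro CollectI exI[of _ "[]"]) simp
    fix z w assume "z \<in> N" "w \<in> N"
    then obtain ss ts where *: "set ss \<subseteq> S" "set ts \<subseteq> S" "z \<in> lin H ss" "w \<in> lin H ts" unfolding N_def by auto
    have "z \<in> lin H (ss @ ts)" "w \<in> lin H (ss @ ts)" using lin_mono_set[OF sH _ *(3)] lin_mono_set[OF sH _ *(4)] by auto
    then have "z - w \<in> lin H (ss @ ts)" using sgrp_diff[OF lin_sgrp[OF sH]] by blast
    moreover have "set (ss @ ts) \<subseteq> S" using * by simp
    ultimately show "z - w \<in> N" unfolding N_def by blast
  qed
  moreover have hk: "h * k \<in> N" if "h \<in> H" "k \<in> S" for h k
  proof -
    have "h * k \<in> lin H [k]" using lin_mem[OF sH, of k "[k]" h] that by simp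
    then show ?thesis unfolding N_def using that by (intro CollectI exI[of _ "[k]"]) simp
  qed
  moreover have "I \<subseteq> N" using hk[OF _ SD(3)] IH by auto
  ultimately have "1 \<in> N" using inv KS unfolding invertible_def A_def[symmetric] H_def[symmetric] by blast
  then obtain ss where ss: "set ss \<subseteq> S" "1 \<in> lin H ss" unfolding N_def by blast
  have "1 \<in> H"
  proof (rule lying_over[OF subr_R sH _ _ _ ss(2)])
    show "\<And>r h. r \<in> R \<Longrightarrow> h \<in> H \<Longrightarrow> r * h \<in> H" using AH RA by blast
    show "\<And>h k. h \<in> H \<Longrightarrow> k \<in> H \<Longrightarrow> h * k \<in> H" using AH HA by blast
    show "\<And>s. s \<in> set ss \<Longrightarrow> integral_over R s" using ss(1) unfolding S_def by blast
  qed
  then have "K \<subseteq> A" unfolding H_def colon_def by auto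
  moreover have "x \<in> K" "y \<in> K" unfolding K_def by (auto intro!: gen_mem)
  ultimately have "x * y \<in> lin R [1, x, y]"
    unfolding A_def mults_def by (simp only: K_def gen_lin list.set_intros) blast
  then obtain a b c where "a \<in> R" "b \<in> R" "c \<in> R" "x * y = a * 1 + (b * x + (c * y + 0))" by auto
  then show "\<exists>a\<in>R. \<exists>b\<in>R. \<exists>c\<in>R. x * y = a * x + b * y + c"
    by (intro bexI[of _ b] bexI[of _ c] bexI[of _ a]) (simp_all add: algebra_simps)
qed

lemma max_ideals_comaximal:
  assumes "subr B" "max_ideal B N" "max_ideal B N'" "N \<noteq> N'"
  obtains a where "a \<in> N" "1 - a \<in> N'"
proof -
  have ND: "ideal_of B N" "ideal_of B N'" "1 \<notin> N'" using assms unfolding max_ideal_def by auto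
  have "\<exists>x\<in>N. x \<notin> N'"
  proof (rule ccontr)
    assume "\<not> ?thesis"
    then obtain x where x: "x \<in> N'" "x \<notin> N" "N \<subseteq> N'" using assms by blast
    then obtain b where b: "b \<in> B" "x * b - 1 \<in> N" using assms(2) ideal_ofD(2)[OF ND(2)] unfolding max_ideal_def by blast
    then have "x * b - 1 \<in> N'" "x * b \<in> N'" using x ideal_ofD(4)[OF ND(2)] by auto
    then show False using ND(3) sgrp_diff_cancel[OF ideal_ofD(1)[OF ND(2)]] by blast
  qed
  then obtain x where x: "x \<in> N" "x \<notin> N'" by blast
  then obtain b where b: "b \<in> B" "x * b - 1 \<in> N'" using assms(3) ideal_ofD(2)[OF ND(1)] unfolding max_ideal_def by blast
  then have "1 - x * b \<in> N'" using sgrp_minus[OF ideal_ofD(1)[OF ND(2)], of "x * b - 1"] by simp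
  then show ?thesis using that ideal_ofD(4)[OF ND(1) b(1) x(1)] by blast
qed

text \<open>With three maximal ideals the residues of \<open>x\<close>, \<open>y\<close> are \<open>(1,1,0)\<close>, \<open>(0,1,1)\<close>, and \<open>xR + yR + mR\<close> is not
  invertible over its ring of multipliers.\<close>

lemma fin_stable_not_three:
  assumes fs: fin_stable and N: "max_ideal S N" "max_ideal S N'" "max_ideal S N''"
    and ne: "N \<noteq> N'" "N \<noteq> N''" "N' \<noteq> N''"
  shows False
proof -
  have ID: "ideal_of S N" "ideal_of S N'" "ideal_of S N''" "I \<subseteq> N" "I \<subseteq> N'" "I \<subseteq> N''" "1 \<notin> N" "1 \<notin> N'" "1 \<notin> N''"
    using N unfolding max_ideal_def by auto
  note n1 = ideal_ofD[OF ID(1)] and n2 = ideal_ofD[OF ID(2)] and n3 = ideal_ofD[OF ID(3)]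
  have MN: "M \<subseteq> N" "M \<subseteq> N'" "M \<subseteq> N''" using max_contains_M[OF subr_S R_S] N by auto
  have ctr: "r \<in> M" if "r \<in> R" "r \<in> N \<or> r \<in> N' \<or> r \<in> N''" for r
    using that contraction_M[OF R_S ID(1,4,7)] contraction_M[OF R_S ID(2,5,8)] contraction_M[OF R_S ID(3,6,9)] by blast
  obtain a where a: "a \<in> N''" "1 - a \<in> N" using max_ideals_comaximal[OF subr_S N(3,1)] ne by blast
  obtain c where c: "c \<in> N''" "1 - c \<in> N'" using max_ideals_comaximal[OF subr_S N(3,2)] ne by blast
  obtain e where e: "e \<in> N" "1 - e \<in> N'" using max_ideals_comaximal[OF subr_S N(1,2)] ne by blast
  have inS: "a \<in> S" "c \<in> S" "e \<in> S" using a c e n1 n2 n3 by auto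
  \<comment> \<open>The two definitions are arranged so that \<open>1 - x = (1 - a)(1 - c)\<close>
    and \<open>1 - y = x(1 - e)\<close>, from which the residues at \<open>N\<close>,
    \<open>N'\<close>, \<open>N''\<close> can be read off.\<close>
  define x where "x = a + (1 - a) * c"
  define y where "y = (1 - x) + x * e"
  have x1: "1 - x = (1 - a) * (1 - c)" by (simp add: x_def algebra_simps)
  have xS: "x \<in> S" "1 - x \<in> S" unfolding x1 by (simp_all add: x_def inS SD)
  have yS: "y \<in> S" by (simp add: y_def inS SD xS)
  have x3: "x \<in> N''" unfolding x_def using a c inS by (simp add: n3 SD sgrp_add)
  have x1n: "1 - x \<in> N" "1 - x \<in> N'" unfolding x1 using a c inS by (simp_all add: n1 n2 SD)
  have y1: "y \<in> N" unfolding y_def using x1n e xS by (simp add: n1 sgrp_add)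
  have y1n: "1 - y \<in> N'" "1 - y \<in> N''"
  proof -
    have eq: "1 - y = x * (1 - e)" by (simp add: y_def algebra_simps)
    show "1 - y \<in> N'" "1 - y \<in> N''" unfolding eq using x3 e xS inS by (simp_all add: n2 n3 SD)
  qed
  \<comment> \<open>So \<open>x\<close> and \<open>y\<close> generate the unit ideal of
    \<open>S\<close>; this forces \<open>A\<close> and \<open>H\<close> into
    \<open>S\<close>.\<close>
  have yx: "1 = y + (1 - e) * x" by (simp add: y_def algebra_simps)
  \<comment> \<open>The generator \<open>m\<close> is a unit of the total ring of fractions and
    makes \<open>K\<close> regular. It lies in all three maximal ideals, so it does not affect
    residues.\<close>
  define K where "K = gen [x, y, m]"
  define A where "A = mults K"
  define H where "H = colon A K"
  have mK: "m \<in> lin R [x, y, m]" using lin_mem[OF RD(1) _ RD(3), of m "[x, y, m]"] by simp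
  then have inv: "invertible K" using fs m_im' unfolding fin_stable_def K_def by blast
  have sK: "sgrp K" unfolding K_def by (rule sgrp_gen)
  have xyK: "x \<in> K" "y \<in> K" unfolding K_def by (auto intro!: gen_mem)
  have KS: "K \<subseteq> S" unfolding K_def
  proof (rule gen_subset[OF SD(1) I_S])
    fix r p assume "r \<in> R" "p \<in> set [x, y, m]"
    moreover have "m \<in> S" using R_S m_M MD(2) by blast
    ultimately show "r * p \<in> S" using R_S xS yS by (auto simp: SD)
  qed
  have KE: "\<exists>r\<in>R. \<exists>s\<in>R. \<exists>t\<in>M. z = r * x + s * y + t" if zK: "z \<in> K" for z
  proof -
    obtain r s t i where *: "r \<in> R" "s \<in> R" "t \<in> R" "i \<in> I" "z = r * x + (s * y + (t * m + 0)) + i"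
      using zK unfolding K_def gen_def by auto
    moreover have "t * m + i \<in> M" using * I_M m_M by (simp add: sgrp_add MD subset_iff)
    moreover have "z = r * x + s * y + (t * m + i)" using * by (simp add: algebra_simps)
    ultimately show ?thesis by blast
  qed
  have AS: "A \<subseteq> S"
  proof
    fix a assume a: "a \<in> A"
    then have "a * x \<in> S" "a * y \<in> S" using xyK KS unfolding A_def mults_def by auto
    then have "a * y + (1 - e) * (a * x) \<in> S" using inS by (simp add: SD)
    also have "a * y + (1 - e) * (a * x) = a * (y + (1 - e) * x)" by (simp only: algebra_simps)
    also have "\<dots> = a" unfolding yx[symmetric] by simp
    finally show "a \<in> S" .
  qed
  have HS: "H \<subseteq> S"
  proof
    fix h assume h: "h \<in> H"
    then have "h * x \<in> S" "h * y \<in> S" using xyK AS unfolding H_def colon_def by auto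
    then have "h * y + (1 - e) * (h * x) \<in> S" using inS by (simp add: SD)
    also have "h * y + (1 - e) * (h * x) = h * (y + (1 - e) * x)" by (simp only: algebra_simps)
    also have "\<dots> = h" unfolding yx[symmetric] by simp
    finally show "h \<in> S" .
  qed
  \<comment> \<open>A multiplier \<open>a\<close> has the same residue at all three ideals. On
    residues, \<open>a(1,1,0) = r(1,1,0) + s(0,1,1)\<close> and
    \<open>a(0,1,1) = r'(1,1,0) + u(0,1,1)\<close>; the last coordinate of the first equation gives
    \<open>s = 0\<close>, the first coordinate of the second gives \<open>r' = 0\<close>, and then
    the first two residues of \<open>a\<close> are \<open>r\<close> and the last two are
    \<open>u\<close>.\<close>
  have key: "a \<in> N" if aA: "a \<in> A" and a3: "a \<in> N''" for a
  proof -
    have aS: "a \<in> S" using aA AS by blast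
    obtain r s t where r: "r \<in> R" "s \<in> R" "t \<in> M" "a * x = r * x + s * y + t"
      using KE[of "a * x"] aA xyK unfolding A_def mults_def by blast
    obtain r' u t' where u: "r' \<in> R" "u \<in> R" "t' \<in> M" "a * y = r' * x + u * y + t'"
      using KE[of "a * y"] aA xyK unfolding A_def mults_def by blast
    have S: "r \<in> S" "s \<in> S" "r' \<in> S" "u \<in> S" using r u R_S by auto
    have t: "t \<in> N" "t \<in> N'" "t \<in> N''" "t' \<in> N" "t' \<in> N'" "t' \<in> N''" using r u MN by auto
    have e1: "a - r = (a - r) * (1 - x) + s * y + t" using r(4) by (simp add: algebra_simps)
    have ar: "a - r \<in> N" by (subst e1) (simp add: n1 SD sgrp_add x1n y1 t S aS)
    have e2: "r' = r' * (1 - x) + (a - u) * y - t'" using u(4) by (simp add: algebra_simps)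
    have "r' \<in> N" by (subst e2) (simp add: n1 SD sgrp_add sgrp_diff x1n y1 t S aS)
    then have r'M: "r' \<in> M" using ctr u by blast
    have e3: "a - u = (a - u) * (1 - y) + r' * x + t'" using u(4) by (simp add: algebra_simps)
    have "a - u \<in> N''" by (subst e3) (simp add: n3 SD sgrp_add y1n x3 t S aS)
    then have "u \<in> N''" using a3 sgrp_diff_cancel[OF n3(1)] by blast
    then have uM: "u \<in> M" using ctr u by blast
    have "a - u \<in> N'" using r'M MN xS by (subst e3) (simp add: n2 SD sgrp_add y1n t S aS subset_iff)
    then have a2: "a \<in> N'" using uM MN sgrp_diff_cancel[OF n2(1)] by blast
    have e4: "s = (a - r) * x + s * (1 - y) - t" using r(4) by (simp add: algebra_simps)
    have "s \<in> N''" by (subst e4) (simp add: n3 SD sgrp_add sgrp_diff x3 y1n t S aS)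
    then have "s \<in> N'" using ctr r MN by blast
    then have "a - r \<in> N'" by (subst e1) (simp add: n2 SD sgrp_add x1n yS t S aS)
    then have "r \<in> N'" using a2 sgrp_diff_cancel[OF n2(1)] by blast
    then have "r \<in> N" using ctr r MN by blast
    then show ?thesis using ar sgrp_diff_cancel[OF n1(1)] by blast
  qed
  \<comment> \<open>The multiplier \<open>h * x\<close> has residue 0 at \<open>N''\<close>, hence
    at \<open>N\<close>, where \<open>x\<close> has residue 1. Thus \<open>H\<close> is contained in
    \<open>N\<close>, contrary to invertibility.\<close>
  have "h * k \<in> N" if "h \<in> H" "k \<in> K" for h k
  proof -
    have hS: "h \<in> S" using that HS by auto
    have "h * x \<in> A" using that xyK unfolding H_def colon_def by auto
    moreover have "h * x \<in> N''" using x3 hS by (simp add: n3)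
    ultimately have "h * x \<in> N" by (rule key)
    then have "h * x + h * (1 - x) \<in> N" using x1n hS by (simp add: n1 sgrp_add)
    moreover have "h * x + h * (1 - x) = h" by (simp add: algebra_simps)
    ultimately show ?thesis using n1(4) that KS by auto
  qed
  then have "1 \<in> N" using inv n1(1) ID(4) unfolding invertible_def A_def[symmetric] H_def[symmetric] by blast
  then show False using ID by blast
qed

text \<open>The module \<open>R + qR\<close> is invertible over a subring of \<open>S\<close>. It
  contains an \<open>x\<close> with an inverse \<open>s\<close> such that \<open>s\<close> and
  \<open>t = qs\<close> lie in \<open>S\<close> and generate its unit ideal. As
  \<open>q = t/s\<close>, it remains to show that \<open>s\<close> is a unit of
  \<open>S\<close>.\<close>

lemma fin_stable_completely_integrally_closed:
  assumes fs: fin_stable and N: "max_ideal S N" "max_ideal S N'" "covers S N N'"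
    and q: "\<And>n. q ^ n * m \<in> S"
  shows "q \<in> S"
proof -
  note qu = fin_stable_quadr[OF fs]
  note P = max_prime[OF subr_S N(1)] max_prime[OF subr_S N(2)]
  define K where "K = gen [1, q]"
  define A where "A = mults K"
  have oneK: "1 \<in> K" "q \<in> K" unfolding K_def by (auto intro!: gen_mem)
  have sK: "sgrp K" unfolding K_def by (rule sgrp_gen)
  have Kl: "K = lin R [1, q]" unfolding K_def by (simp only: gen_lin list.set_intros)
  have "1 * 1 \<doteq> 1" by simp
  then have inv: "invertible K" using fs oneK unfolding fin_stable_def K_def[symmetric] Kl[symmetric] by (metis K_def Kl)
  have AS: "A \<subseteq> S"
  proof
    fix a assume "a \<in> A"
    then have "a * 1 \<in> lin R [1, q]" "a * q \<in> lin R [1, q]" using oneK unfolding A_def mults_def Kl[symmetric] by auto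
    then have "a * p \<in> lin R [1, q]" if "p \<in> set [1, q]" for p using that by (auto simp del: lin.simps)
    then have "integral_over R a" by (intro integral_overI[OF subr_R, of "[1, q]"]) simp_all
    then show "a \<in> S" unfolding S_def by simp
  qed
  obtain x h where xh: "x \<in> K" "h \<in> colon A K" "x * h \<in> S" "x * h \<notin> N" "x * h \<notin> N'"
    using invertible_unit[OF sK inv _ P] AS unfolding A_def by blast
  obtain v where v: "v \<in> S" "x * h * v \<doteq> 1" using N(3) xh unfolding covers_def by blast
  obtain \<alpha> \<beta> where ab: "\<alpha> \<in> R" "\<beta> \<in> R" "x = \<alpha> * 1 + (\<beta> * q + 0)" using xh(1) unfolding Kl by auto
  define s where "s = h * v"
  define t where "t = h * q * v"
  have st: "s \<in> S" "t \<in> S"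
  proof -
    have "h * 1 \<in> S" "h * q \<in> S" using xh(2) oneK AS unfolding colon_def by blast+
    then show "s \<in> S" "t \<in> S" using v unfolding s_def t_def by (simp_all add: SD)
  qed
  have xs: "x * s \<doteq> 1" using v by (simp add: s_def mult.assoc)
  have qs: "q * s = t" by (simp add: s_def t_def algebra_simps)
  have one: "\<alpha> * s + \<beta> * t \<doteq> 1" using xs unfolding ab(3) qs[symmetric] by (simp add: algebra_simps)
  \<comment> \<open>If \<open>s\<close> is in \<open>Q\<close>, then \<open>t\<close> is not. But
    with \<open>u * s^k = m * a\<close> and \<open>u\<close> outside \<open>Q\<close>, the product
    \<open>t^(k+1) * u\<close> equals \<open>s * (q^(k+1) * m) * a\<close> up to \<open>I\<close>.
    Since \<open>q^(k+1) * m\<close> is in \<open>S\<close>, this lies in \<open>Q\<close>, and so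
    would \<open>t\<close>.\<close>
  have bad: False if N: "max_ideal S Q" and sQ: "s \<in> Q" for Q
  proof -
    note P = max_prime[OF subr_S N]
    have QD: "ideal_of S Q" "I \<subseteq> Q" "1 \<notin> Q" using N unfolding max_ideal_def by auto
    note QD' = ideal_ofD[OF QD(1)]
    have tQ: "t \<notin> Q"
    proof
      assume "t \<in> Q"
      then have "\<alpha> * s + \<beta> * t \<in> Q" using sQ subsetD[OF R_S ab(1)] subsetD[OF R_S ab(2)] by (simp add: sgrp_add QD')
      then show False using QD QD' cong_mem[OF _ _ one] by blast
    qed
    obtain k u where u: "u \<in> S" "u \<notin> Q" "im * (u * s ^ k) \<in> S"
      using power_in_mT[OF subr_S R_S qu P max_contains_M[OF subr_S R_S _ N] sQ] by blast
    define w where "w = q ^ Suc k * m"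
    define a where "a = im * (u * s ^ k)"
    have w: "w \<in> S" unfolding w_def by (rule q)
    have a: "a \<in> S" using u unfolding a_def by simp
    have ma: "u * s ^ k \<doteq> m * a"
      using cong_sym[OF cong_mult1[OF m_im', of "u * s ^ k"]] by (simp add: a_def mult.assoc)
    have "t ^ Suc k * u \<doteq> (x ^ k * s ^ k) * (t ^ Suc k * u)"
      by (intro cong_sym[OF cong_mult1] inv_power xs)
    also have "\<dots> = (x ^ k * t ^ Suc k) * (u * s ^ k)" by (simp only: ac_simps)
    also have "\<dots> \<doteq> (x ^ k * t ^ Suc k) * (m * a)" by (intro cong_mult ma cong_refl)
    also have "\<dots> = (x ^ k * s ^ k) * (s * w * a)"
    proof -
      have "t ^ Suc k = q ^ Suc k * (s ^ k * s)" unfolding qs[symmetric] by (simp add: power_mult_distrib ac_simps)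
      then show ?thesis unfolding w_def by (simp only: ac_simps)
    qed
    also have "\<dots> \<doteq> s * w * a" by (intro cong_mult1 inv_power xs)
    finally have "t ^ Suc k * u \<doteq> s * w * a" .
    moreover have "s * w * a \<in> Q" using sQ w a by (simp add: QD')
    ultimately have *: "t ^ Suc k * u \<in> Q" using cong_mem[OF QD'(1) QD(2)] by blast
    have "t ^ Suc k \<in> S" by (rule subr_power[OF subr_S st(2)])
    then have "t ^ Suc k \<in> Q" using * P u unfolding prime_ideal_def by blast
    then show False using prime_power[OF subr_S P st(2)] tQ by blast
  qed
  then obtain w where w: "w \<in> S" "s * w \<doteq> 1" using N st unfolding covers_def by blast
  have "q \<doteq> (s * w) * q" by (rule cong_sym[OF cong_mult1[OF w(2)]])
  also have "\<dots> = t * w" unfolding qs[symmetric] by (simp add: ac_simps)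
  finally have "q \<doteq> t * w" .
  moreover have "t * w \<in> S" using st w by (simp add: SD)
  ultimately show ?thesis using cong_mem[OF SD(1) I_S] by blast
qed

section \<open>The rings \<open>R_i\<close> and their union\<close>

definition jac :: "'f set \<Rightarrow> 'f set" where
  "jac B = {a \<in> B. \<forall>N. max_ideal B N \<longrightarrow> a \<in> N}"

primrec Rs :: "nat \<Rightarrow> 'f set" where
  "Rs 0 = R"
| "Rs (Suc i) = mults (jac (Rs i))"

definition Rinf :: "'f set" where "Rinf = (\<Union>i. Rs (Suc i))"

lemma ideal_jac: assumes "subr B" shows "ideal_of B (jac B)"
  unfolding ideal_of_def
proof (intro conjI ballI sgrpI)
  note BD = subrD[OF assms]
  have N: "ideal_of B N" if "max_ideal B N" for N using that unfolding max_ideal_def by blast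
  show "0 \<in> jac B" unfolding jac_def using BD(2) sgrp_zero[OF ideal_ofD(1)[OF N]] by blast
  show "x - y \<in> jac B" if "x \<in> jac B" "y \<in> jac B" for x y
    using that BD(6) sgrp_diff[OF ideal_ofD(1)[OF N]] unfolding jac_def by blast
  show "jac B \<subseteq> B" unfolding jac_def by blast
  show "a * x \<in> jac B" if "a \<in> B" "x \<in> jac B" for a x
    using that BD(4) ideal_ofD(3)[OF N] unfolding jac_def by blast
qed

lemma subr_Rs: "subr (Rs i) \<and> R \<subseteq> Rs i \<and> Rs i \<subseteq> Rs (Suc i)"
proof (induction i)
  case 0
  show ?case using subr_R ideal_ofD(3)[OF ideal_jac[OF subr_R]] by (auto simp: mults_def)
next
  case (Suc i)
  have B: "subr (Rs (Suc i))" using Suc by (auto intro!: subr_mults ideal_ofD(1)[OF ideal_jac])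
  have "Rs (Suc i) \<subseteq> Rs (Suc (Suc i))" using ideal_ofD(3)[OF ideal_jac[OF B]] by (auto simp: mults_def)
  then show ?case using B Suc by blast
qed

text \<open>Inductively \<open>m\<close> lies in the radical of \<open>Rs i\<close>, as
  \<open>M\<close> lies in every maximal ideal of a ring between \<open>R\<close> and
  \<open>S\<close>. A multiplier \<open>q\<close> of the radical then has all \<open>q^n * m\<close>
  in \<open>S\<close>.\<close>

lemma Rs_subset:
  assumes cic: "\<And>q. (\<And>n. q ^ n * m \<in> S) \<Longrightarrow> q \<in> S" shows "Rs i \<subseteq> S"
proof (induction i)
  case 0 show ?case using R_S by simp
next
  case (Suc i)
  have B: "subr (Rs i)" "R \<subseteq> Rs i" using subr_Rs by auto
  have "m \<in> jac (Rs i)" using max_contains_M[OF B Suc] m_M MD(2) B unfolding jac_def by blast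
  then have "q ^ n * m \<in> jac (Rs i)" if "q \<in> mults (jac (Rs i))" for q n
    by (induction n) (use that in \<open>auto simp: mults_def mult.assoc\<close>)
  moreover have "jac (Rs i) \<subseteq> S" using Suc unfolding jac_def by blast
  ultimately show ?case using cic by (auto simp: subset_iff)
qed

lemma quadr_subset: "quadr T \<Longrightarrow> T' \<subseteq> T \<Longrightarrow> quadr T'"
  unfolding quadr_def by blast

theorem fin_stable_imp_quadratic:
  assumes fs: fin_stable and N: "max_ideal S N" "max_ideal S N'" "covers S N N'"
  shows "quadr Rinf"
proof (rule quadr_subset[OF fin_stable_quadr[OF fs]])
  show "Rinf \<subseteq> S" unfolding Rinf_def using Rs_subset[OF fin_stable_completely_integrally_closed[OF fs N]] by blast
qed

end

section \<open>Quadratic extensions are Dedekind\<close>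

text \<open>\<open>T\<close> is going to be \<open>Rinf\<close>. \<open>N\<close> and
  \<open>N'\<close> may coincide, and even distinct ones may have the same contraction to
  \<open>T\<close>; equal and different contractions call for different arguments.\<close>

locale quad = ctx +
  fixes N N' T :: "'a set"
  assumes max_N: "max_ideal S N" and max_N': "max_ideal S N'" and cov: "covers S N N'"
    and subr_T: "subr T" and R_T: "R \<subseteq> T" and T_S: "T \<subseteq> S" and quadr_T: "quadr T"
begin

text \<open>The data are symmetric in \<open>N\<close> and \<open>N'\<close>, so statements are
  proved for \<open>N\<close> and interpreted a second time for \<open>N'\<close>.\<close>

lemma swapped: "quad I R M m im N' N T"
  using max_N max_N' cov subr_T R_T T_S quadr_T ctx_axioms
  by (auto simp: quad_def quad_axioms_def covers_def)

lemmas TD = subrD[OF subr_T]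

lemma I_T: "I \<subseteq> T" using I_R R_T by blast

lemma ideal_N: "ideal_of S N" "I \<subseteq> N" "1 \<notin> N" using max_N unfolding max_ideal_def by auto

lemma ideal_N': "ideal_of S N'" "I \<subseteq> N'" "1 \<notin> N'" using max_N' unfolding max_ideal_def by auto

lemmas ND = ideal_ofD[OF ideal_N(1)] and ND' = ideal_ofD[OF ideal_N'(1)]

lemma prime_N: "prime_ideal S N" and prime_N': "prime_ideal S N'"
  using max_prime[OF subr_S] max_N max_N' by auto

lemma M_N: "M \<subseteq> N" "M \<subseteq> N'" using max_contains_M[OF subr_S R_S] max_N max_N' by auto

lemma N_M: "r \<in> R \<Longrightarrow> r \<in> N \<Longrightarrow> r \<in> M" "r \<in> R \<Longrightarrow> r \<in> N' \<Longrightarrow> r \<in> M"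
  using contraction_M[OF R_S ideal_N] contraction_M[OF R_S ideal_N'] by auto

text \<open>Outside both ideals \<open>t\<close> is a unit of \<open>S\<close>, and its inverse,
  being integral over \<open>R\<close>, already lies in \<open>B\<close>.\<close>

lemma unit_in:
  assumes "subr B" "R \<subseteq> B" "B \<subseteq> S" "t \<in> B" "t \<notin> N" "t \<notin> N'"
  obtains w where "w \<in> B" "t * w \<doteq> 1"
proof -
  obtain w where "w \<in> S" "t * w \<doteq> 1" using cov assms unfolding covers_def by blast
  then show ?thesis using that inverse_in_subring[OF assms(1,2,4)] by blast
qed

lemma prime_contraction: "prime_ideal T (N \<inter> T)"
  using prime_N T_S TD unfolding prime_ideal_def ideal_of_def sgrp_def
  by (auto simp: subset_iff I_T[THEN subsetD])

text \<open>Let \<open>x(x - a) = c\<close> with \<open>a\<close> and \<open>c\<close> in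
  \<open>R\<close>. If \<open>c\<close> is a unit of \<open>R\<close>, so is \<open>x\<close> in
  \<open>B\<close>. Otherwise \<open>x - a \<in> N\<close>, and \<open>x\<close> is congruent to the
  unit \<open>a\<close> of \<open>R\<close>.\<close>

lemma max_contraction:
  assumes B: "subr B" "R \<subseteq> B" "B \<subseteq> T" shows "max_ideal B (N \<inter> B)"
proof -
  note BD = subrD[OF B(1)]
  have "\<exists>b\<in>B. x * b - 1 \<in> N \<inter> B" if x: "x \<in> B" "x \<notin> N" for x
  proof -
    obtain a c where ac: "a \<in> R" "c \<in> R" "x * x = a * x + c" using quadr_square[OF quadr_T, of x] x B by blast
    have aB: "a \<in> B" "c \<in> B" "x \<in> S" "x - a \<in> S" using ac B x T_S by (auto simp: SD subset_iff)
    have ceq: "x * (x - a) = c" using ac by (simp add: algebra_simps)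
    show ?thesis
    proof (cases "c \<in> M")
      case False
      then obtain s where s: "s \<in> R" "c * s \<doteq> 1" using inverse_R' ac by blast
      have "(x - a) * s \<in> B" using x aB s B by (auto simp: BD subset_iff)
      moreover have "x * ((x - a) * s) - 1 \<in> I" using s unfolding ceq[symmetric] cong_def by (simp add: mult.assoc)
      ultimately show ?thesis using I_R B ideal_N by blast
    next
      case True
      then have xa: "x - a \<in> N" using prime_N aB x ceq M_N unfolding prime_ideal_def by blast
      have "a \<notin> M" using sgrp_diff_cancel[OF ND(1) xa] x M_N by blast
      then obtain s where s: "s \<in> R" "a * s \<doteq> 1" using inverse_R' ac by blast
      have sB: "s \<in> B" "s \<in> S" using s B R_S by auto
      have "x * s - 1 = (x - a) * s + (a * s - 1)" by (simp add: algebra_simps)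
      moreover have "(x - a) * s \<in> N" using xa sB by (simp add: ND)
      moreover have "a * s - 1 \<in> N" using s ideal_N unfolding cong_def by blast
      ultimately have "x * s - 1 \<in> N" using sgrp_add[OF ND(1)] by (simp only:)
      then show ?thesis using sB x by (auto simp: BD)
    qed
  qed
  moreover have "ideal_of B (N \<inter> B)"
    using ND BD B T_S unfolding ideal_of_def sgrp_def by (auto simp: subset_iff)
  ultimately show ?thesis using ideal_N I_R B unfolding max_ideal_def by blast
qed

text \<open>If \<open>a\<close> lies in \<open>N\<close> and \<open>N'\<close> but not in some
  maximal ideal \<open>L\<close> of \<open>B\<close>, then \<open>L\<close> contains some
  \<open>ab - 1\<close>. This avoids \<open>N\<close> and \<open>N'\<close> and is therefore a unit
  of \<open>B\<close>, which is absurd.\<close>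

lemma jac_eq:
  assumes B: "subr B" "R \<subseteq> B" "B \<subseteq> T" shows "jac B = B \<inter> N \<inter> N'"
proof
  interpret sw: quad I R M m im N' N T by (rule swapped)
  show "jac B \<subseteq> B \<inter> N \<inter> N'" using max_contraction[OF B] sw.max_contraction[OF B] unfolding jac_def by blast
  show "B \<inter> N \<inter> N' \<subseteq> jac B"
  proof
    fix a assume a: "a \<in> B \<inter> N \<inter> N'"
    have "a \<in> L" if L: "max_ideal B L" for L
    proof (rule ccontr)
      note BD = subrD[OF B(1)]
      have LD: "ideal_of B L" "I \<subseteq> L" "1 \<notin> L" using L unfolding max_ideal_def by auto
      assume "a \<notin> L"
      then obtain b where b: "b \<in> B" "a * b - 1 \<in> L" using L a unfolding max_ideal_def by blast
      have bS: "b \<in> S" using b B T_S by blast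
      have "a * b - 1 \<notin> N" "a * b - 1 \<notin> N'"
        using a bS sgrp_diff_cancel[OF ND(1), of "a * b" 1] sgrp_diff_cancel[OF ND'(1), of "a * b" 1] ideal_N ideal_N'
        by (auto simp: ND ND')
      moreover have "a * b - 1 \<in> B" using a b by (simp add: BD)
      ultimately obtain w where "w \<in> B" "(a * b - 1) * w \<doteq> 1" using unit_in[OF B(1,2)] B(3) T_S by blast
      moreover have "(a * b - 1) * w \<in> L" using calculation b by (simp add: ideal_ofD[OF LD(1)])
      ultimately show False using cong_mem[OF ideal_ofD(1)[OF LD(1)] LD(2)] LD(3) by blast
    qed
    then show "a \<in> jac B" using a unfolding jac_def by blast
  qed
qed

text \<open>For an ideal \<open>P\<close> of \<open>T\<close> this means \<open>P = yT\<close> with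
  \<open>y\<close> regular; \<open>y'\<close> is the inverse of \<open>y\<close> in the total ring
  of fractions.\<close>

definition generated :: "'a set \<Rightarrow> bool" where
  "generated P \<longleftrightarrow> (\<exists>y\<in>P. \<exists>y'. y * y' \<doteq> 1 \<and> (\<forall>p\<in>P. y' * p \<in> T))"

lemma jac_R: "jac R = M"
  using jac_eq[OF subr_R _ R_T] M_N N_M MD(2) by blast

end

text \<open>\<open>x\<close> is going to generate \<open>M\<close> over \<open>E(M)\<close>, with
  inverse \<open>x'\<close>. For a ring \<open>B\<close> the condition \<open>x' * k \<in> B\<close>
  for all \<open>k \<in> M\<close> says that \<open>MB = xB\<close>.\<close>

locale quad_x = quad +
  fixes x x' :: 'a
  assumes x_M: "x \<in> M" and xx: "x * x' \<doteq> 1"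
begin

text \<open>In \<open>s^2 = as + c\<close> the constant \<open>c = s(s - a)\<close> lies in
  \<open>M\<close>. If \<open>a\<close> is in \<open>M\<close>, then \<open>s^2\<close> is in
  \<open>MB = xB\<close>. If not, \<open>s - a\<close> is a unit of \<open>B\<close>, and already
  \<open>s = c/(s - a)\<close> lies in \<open>xB\<close>.\<close>

lemma x'_square:
  assumes B: "subr B" "R \<subseteq> B" "B \<subseteq> T" and xB: "\<And>k. k \<in> M \<Longrightarrow> x' * k \<in> B"
    and s: "s \<in> B" "s \<in> N" "s \<in> N'"
  shows "x' * (s * s) \<in> B"
proof -
  note BD = subrD[OF B(1)]
  have IB: "I \<subseteq> B" using I_R B by blast
  obtain a c where ac: "a \<in> R" "c \<in> R" "s * s = a * s + c" using quadr_square[OF quadr_T, of s] s B by blast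
  have aB: "a \<in> B" "c \<in> B" "s \<in> S" "s - a \<in> S" using ac B s T_S by (auto simp: SD subset_iff)
  have ceq: "s * (s - a) = c" using ac by (simp add: algebra_simps)
  have cM: "c \<in> M" using N_M(1)[OF ac(2)] s aB unfolding ceq[symmetric] by (simp add: ND)
  show ?thesis
  proof (cases "a \<in> M")
    case True
    have "x' * (s * s) = (x' * a) * s + x' * c" unfolding ac(3) by (simp add: algebra_simps)
    then show ?thesis using xB[OF True] xB[OF cM] s by (simp add: BD)
  next
    case False
    then have "s - a \<notin> N" "s - a \<notin> N'"
      using s ac N_M sgrp_diff_cancel[OF ND(1), of s a] sgrp_diff_cancel[OF ND'(1), of s a] by blast+
    moreover have "s - a \<in> B" using s aB by (simp add: BD)
    ultimately obtain w where w: "w \<in> B" "(s - a) * w \<doteq> 1" using unit_in[OF B(1,2)] B(3) T_S by blast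
    have "x' * (s * s) \<doteq> ((s - a) * w) * (x' * (s * s))" by (intro cong_sym[OF cong_mult1] w)
    also have "\<dots> = (x' * (s * (s - a))) * (w * s)" by (simp only: ac_simps)
    finally have "x' * (s * s) \<doteq> (x' * c) * (w * s)" unfolding ceq .
    moreover have "(x' * c) * (w * s) \<in> B" using xB[OF cM] w s by (simp add: BD)
    ultimately show ?thesis using cong_mem[OF BD(1) IB] by blast
  qed
qed

text \<open>The square of the radical of \<open>B\<close> lies in \<open>xB\<close>. In
  \<open>st = as + bt + c\<close> the constant is in \<open>M\<close>, and only the case that
  \<open>a\<close> or \<open>b\<close> is a unit needs care. If \<open>a\<close> is, multiplication
  by \<open>t\<close> gives \<open>ast = st^2 - bt^2 - ct\<close>, which reduces to the case of a
  square.\<close>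

lemma x'_product:
  assumes B: "subr B" "R \<subseteq> B" "B \<subseteq> T" and xB: "\<And>k. k \<in> M \<Longrightarrow> x' * k \<in> B"
    and s: "s \<in> B" "s \<in> N" "s \<in> N'" and t: "t \<in> B" "t \<in> N" "t \<in> N'"
  shows "x' * (s * t) \<in> B"
proof -
  note BD = subrD[OF B(1)]
  have IB: "I \<subseteq> B" using I_R B by blast
  have main: "x' * (s * t) \<in> B"
    if s: "s \<in> B" "s \<in> N" "s \<in> N'" and t: "t \<in> B" "t \<in> N" "t \<in> N'"
      and abc: "a \<in> R" "b \<in> R" "c \<in> M" "s * t = a * s + b * t + c" and a: "a \<notin> M" for a b c s t
  proof -
    obtain e where e: "e \<in> R" "a * e \<doteq> 1" using inverse_R' a abc by blast
    have tt: "x' * (t * t) \<in> B" by (rule x'_square[OF B xB t])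
    have R: "b \<in> B" "e \<in> B" using abc e B by auto
    have "x' * (s * t) \<doteq> (a * e) * (x' * (s * t))" by (intro cong_sym[OF cong_mult1] e)
    also have "(a * e) * (x' * (s * t)) = e * (s * (x' * (t * t)) - b * (x' * (t * t)) - (x' * c) * t)"
    proof -
      have "a * s * t = (s * t) * t - b * (t * t) - c * t" unfolding abc(4) by (simp add: algebra_simps)
      then have "e * x' * (a * s * t) = e * x' * ((s * t) * t - b * (t * t) - c * t)" by simp
      then show ?thesis by (simp add: algebra_simps)
    qed
    finally have "x' * (s * t) \<doteq> e * (s * (x' * (t * t)) - b * (x' * (t * t)) - (x' * c) * t)" .
    moreover have "e * (s * (x' * (t * t)) - b * (x' * (t * t)) - (x' * c) * t) \<in> B"
      using tt R xB[OF abc(3)] s t by (simp add: BD)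
    ultimately show ?thesis using cong_mem[OF BD(1) IB] by blast
  qed
  have "s \<in> T" "t \<in> T" using s t B by auto
  then obtain a b c where abc: "a \<in> R" "b \<in> R" "c \<in> R" "s * t = a * s + b * t + c"
    using quadr_T unfolding quadr_def by blast
  have S: "a \<in> S" "b \<in> S" "t \<in> S" using abc R_S t B T_S by auto
  have "c = s * t - a * s - b * t" using abc by (simp add: algebra_simps)
  then have "c \<in> N" using s t S by (simp add: ND sgrp_diff)
  then have cM: "c \<in> M" using N_M abc by blast
  consider "a \<notin> M" | "b \<notin> M" | "a \<in> M" "b \<in> M" by blast
  then show ?thesis
  proof cases
    case 1 then show ?thesis using main[OF s t abc(1,2) cM abc(4)] by blast
  next
    case 2
    have "t * s = b * t + a * s + c" using abc(4) by (simp add: ac_simps)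
    then show ?thesis using main[OF t s abc(2,1) cM _ 2] by (simp add: mult.commute)
  next
    case 3
    have "x' * (s * t) = (x' * a) * s + (x' * b) * t + x' * c" unfolding abc(4) by (simp add: algebra_simps)
    then show ?thesis using xB[OF 3(1)] xB[OF 3(2)] xB[OF cM] s t by (simp add: BD)
  qed
qed

end

locale quad_xT = quad_x +
  assumes x'T: "\<And>k. k \<in> M \<Longrightarrow> x' * k \<in> T"
begin

lemma swapped_xT: "quad_xT I R M m im N' N T x x'"
  using swapped quad_x_axioms x'T by (auto simp: quad_xT_def quad_x_def quad_xT_axioms_def)

text \<open>The idea is to use the quadratic equation of \<open>s + f\<close> in place of that of
  \<open>s\<close>. Write \<open>(s + f)^2 = l(s + f) + g\<close>. Reduction modulo
  \<open>N'\<close> puts \<open>g\<close> into \<open>M\<close>; reduction modulo \<open>N\<close>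
  gives that \<open>l\<close> is congruent to \<open>f\<close>, hence to \<open>-a\<close>, so that
  \<open>l + a\<close> is in \<open>M\<close>. It follows that \<open>s(s - a)\<close> lies in
  \<open>xT\<close>, and \<open>s - a\<close> is a unit of \<open>T\<close>.\<close>

lemma x'_annihilated:
  assumes e: "e \<in> T" "e \<in> N" "f \<in> T" "f \<in> N'" "f \<notin> N" and a: "a \<in> R" "a \<notin> M" "f = e - a"
    and c: "c \<in> M" "e * f = c" and s: "s \<in> T" "s \<in> N" "s \<in> N'" and es: "x' * (e * s) \<in> T"
  shows "x' * s \<in> T"
proof -
  have S: "e \<in> S" "f \<in> S" "s \<in> S" "a \<in> S" using T_S e s R_S a by auto
  have aT: "a \<in> T" using a R_T by blast
  obtain l g where lg: "l \<in> R" "g \<in> R" "(s + f) * (s + f) = l * (s + f) + g"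
    using quadr_square[OF quadr_T, of "s + f"] s e by (auto simp: TD)
  have lS: "l \<in> S" "g \<in> S" using lg R_S by auto
  have lT: "l \<in> T" using lg R_T by auto
  have ff: "f * f = c - a * f" using c(2) unfolding a(3) by (simp add: algebra_simps)
  have g: "g = (s + f) * (s + f) - l * (s + f)" using lg by simp
  have "g \<in> N'" unfolding g using s e S lS by (simp add: ND' SD sgrp_add sgrp_diff)
  then have gM: "g \<in> M" using N_M lg by blast
  have "f * (f - l) = g - s * (s + f + (f - l))" unfolding g by (simp add: algebra_simps)
  also have "\<dots> \<in> N"
  proof (rule sgrp_diff[OF ND(1)])
    have "s + f + (f - l) \<in> S" using S lS by (simp only: SD)
    then show "s * (s + f + (f - l)) \<in> N" by (rule ND(4)[OF _ s(2)])
  qed (use gM M_N in blast)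
  finally have "f - l \<in> N" using prime_N S lS e(5) unfolding prime_ideal_def by (auto simp: SD)
  then have "e - (f - l) \<in> N" using sgrp_diff[OF ND(1) e(2)] by blast
  moreover have "e - (f - l) = l + a" using a(3) by (simp add: algebra_simps)
  ultimately have la: "l + a \<in> M" using N_M(1)[OF RD(5)[OF lg(1) a(1)]] by (simp only:)
  \<comment> \<open>Each term on the right has a factor in \<open>M\<close> or is a multiple of
    \<open>e * s\<close>, so \<open>x'\<close> carries it into \<open>T\<close>.\<close>
  have eq: "s * s - a * s = (l + a) * s + (l + a) * f + g - c - (e * s + e * s)"
  proof -
    have "s * s - a * s = (s + f) * (s + f) - f * f - (f * s + f * s) - a * s" by (simp add: algebra_simps)
    also have "\<dots> = l * (s + f) + g - (c - a * f) - (f * s + f * s) - a * s" unfolding lg(3) ff by simp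
    also have "\<dots> = (l + a) * s + (l + a) * f + g - c - (e * s + e * s)" unfolding a(3) by (simp add: algebra_simps)
    finally show ?thesis .
  qed
  have "x' * (s * s - a * s) = (x' * (l + a)) * s + (x' * (l + a)) * f + x' * g - x' * c - (x' * (e * s) + x' * (e * s))"
    unfolding eq by (simp add: algebra_simps)
  also have "\<dots> \<in> T" using x'T[OF la] x'T[OF gM] x'T[OF c(1)] es s e by (simp only: TD)
  finally have *: "x' * (s * s - a * s) \<in> T" .
  have "s - a \<notin> N" "s - a \<notin> N'"
    using s a N_M sgrp_diff_cancel[OF ND(1), of s a] sgrp_diff_cancel[OF ND'(1), of s a] by blast+
  moreover have "s - a \<in> T" using s aT by (simp add: TD)
  ultimately obtain w where w: "w \<in> T" "(s - a) * w \<doteq> 1" using unit_in[OF subr_T R_T T_S] by blast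
  have "x' * s \<doteq> ((s - a) * w) * (x' * s)" by (intro cong_sym[OF cong_mult1] w)
  also have "\<dots> = (x' * (s * s - a * s)) * w" by (simp add: algebra_simps)
  finally have "x' * s \<doteq> (x' * (s * s - a * s)) * w" .
  moreover have "(x' * (s * s - a * s)) * w \<in> T" using * w by (simp add: TD)
  ultimately show ?thesis using cong_mem[OF TD(1) I_T] by blast
qed

text \<open>If \<open>T\<close> has two maximal ideals, its Jacobson radical is \<open>xT\<close>, so that each of them is invertible.\<close>

lemma generated_of_separating:
  assumes e: "e \<in> T" "e \<in> N" "e \<notin> N'"
  shows "generated (N \<inter> T) \<and> (\<exists>f\<in>T. f \<in> N' \<and> f \<notin> N)"
proof -
  interpret sw: quad_xT I R M m im N' N T x x' by (rule swapped_xT)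
  obtain a c where ac: "a \<in> R" "c \<in> R" "e * e = a * e + c" using quadr_square[OF quadr_T e(1)] .
  define f where "f = e - a"
  have aT: "a \<in> T" using ac R_T by blast
  have ef: "e * f = c" using ac by (simp add: f_def algebra_simps)
  have fT: "f \<in> T" unfolding f_def using e aT by (simp add: TD)
  have S: "e \<in> S" "f \<in> S" "a \<in> S" using e fT aT T_S by auto
  have "c \<in> N" unfolding ef[symmetric] using e S by (simp add: ND)
  then have cM: "c \<in> M" using N_M ac by blast
  then have fN': "f \<in> N'" using prime_N' ef e S M_N unfolding prime_ideal_def by blast
  have aM: "a \<notin> M" using sgrp_diff_cancel[OF ND'(1), of e a] fN' e M_N unfolding f_def by blast
  have fN: "f \<notin> N"
  proof
    assume "f \<in> N"
    then have "e - f \<in> N" using sgrp_diff[OF ND(1) e(2)] by blast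
    then show False using aM N_M ac by (simp add: f_def)
  qed
  obtain g where g: "g \<in> R" "a * g \<doteq> 1" using inverse_R' ac aM by blast
  have gT: "g \<in> T" using g R_T by blast
  \<comment> \<open>Both \<open>es\<close> and \<open>fs\<close> lie in \<open>xT\<close>, by the
    preceding lemma for \<open>(e, f)\<close> and for \<open>(f, e)\<close>. Their difference is
    \<open>as\<close>, with \<open>a\<close> a unit of \<open>R\<close>.\<close>
  have J: "x' * s \<in> T" if s: "s \<in> T" "s \<in> N" "s \<in> N'" for s
  proof -
    have sS: "s \<in> S" using s T_S by blast
    have cs: "x' * (c * s) \<in> T" using x'T[OF cM] s by (simp add: TD mult.assoc[symmetric])
    have "x' * (f * s) \<in> T"
    proof (rule x'_annihilated[OF e(1,2) fT fN' fN ac(1) aM f_def cM ef])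
      show "x' * (e * (f * s)) \<in> T" using cs unfolding ef[symmetric] by (simp only: mult.assoc)
    qed (use s S fT in \<open>simp_all add: TD ND ND'\<close>)
    moreover have "x' * (e * s) \<in> T"
    proof (rule sw.x'_annihilated[of f e "- a" c])
      have "- a \<in> M \<Longrightarrow> a \<in> M" using sgrp_minus[OF MD(1), of "- a"] by simp
      then show "- a \<notin> M" using aM by blast
      show "x' * (f * (e * s)) \<in> T" using cs unfolding ef[symmetric] by (simp only: ac_simps)
    qed (use s S e fT fN' ac cM ef in \<open>simp_all add: TD ND ND' RD f_def mult.commute\<close>)
    ultimately have "g * (x' * (e * s) - x' * (f * s)) \<in> T" using gT by (simp add: TD)
    also have "g * (x' * (e * s) - x' * (f * s)) = (a * g) * (x' * s)" by (simp add: f_def algebra_simps)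
    finally show ?thesis using cong_mem[OF TD(1) I_T cong_mult1[OF g(2)]] by blast
  qed
  \<comment> \<open>Both 1 and \<open>x' * f\<close> multiply \<open>N \<inter> T\<close> into
    \<open>T\<close>, the latter because \<open>f * p\<close> is in the radical. The product
    \<open>e * 1\<close> avoids \<open>N'\<close>, the product \<open>x * (x' * f)\<close> avoids
    \<open>N\<close>; hence some product \<open>u * v\<close> avoids both and is a unit of
    \<open>T\<close>, which makes \<open>u\<close> a generator.\<close>
  let ?P = "N \<inter> T"
  have P: "sgrp ?P" "x \<in> ?P" using ND(1) TD(1) x_M M_N MD(2) R_T by (auto simp: sgrp_def)
  have "sgrp (colon T ?P)" by (rule sgrp_colon[OF TD(1)])
  moreover have "1 \<in> colon T ?P" unfolding colon_def by auto
  moreover have "x' * f \<in> colon T ?P"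
  proof -
    have "x' * (f * p) \<in> T" if "p \<in> ?P" for p
    proof -
      have "p \<in> S" using that T_S by blast
      then show ?thesis using that fT fN' S by (intro J) (simp_all add: TD ND ND')
    qed
    then show ?thesis unfolding colon_def by (simp add: mult.assoc)
  qed
  moreover have "x * (x' * f) \<doteq> f" using cong_mult1[OF xx, of f] by (simp add: mult.assoc)
  then have "x * (x' * f) \<notin> N" using cong_mem[OF ND(1) ideal_N(2)] fN by blast
  moreover have "e * 1 \<notin> N'" "e \<in> ?P" using e by auto
  ultimately obtain u v where uv: "u \<in> ?P" "v \<in> colon T ?P" "u * v \<notin> N" "u * v \<notin> N'"
    using avoid_two_product[OF P(1) _ ND(1) ND'(1) P(2)] by metis
  have "u * v \<in> T" using uv unfolding colon_def by (simp add: mult.commute)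
  then obtain w where w: "w \<in> T" "u * v * w \<doteq> 1" using unit_in[OF subr_T R_T T_S _ uv(3,4)] by blast
  have "\<forall>p\<in>?P. (v * w) * p \<in> T"
  proof
    fix p assume "p \<in> ?P"
    then have "w * (v * p) \<in> T" using uv w unfolding colon_def by (simp add: TD)
    then show "(v * w) * p \<in> T" by (simp only: ac_simps)
  qed
  then have "generated ?P"
    unfolding generated_def using uv w by (intro bexI[of _ u] exI[of _ "v * w"]) (simp_all add: mult.assoc)
  then show ?thesis using fT fN fN' by blast
qed

text \<open>Let \<open>P\<close> be the common contraction, so \<open>P^2\<close> lies in
  \<open>xT\<close>. If \<open>x^-1 st\<close> is outside \<open>P\<close> for some
  \<open>s\<close>, \<open>t\<close> in \<open>P\<close>, it is a unit of \<open>T\<close> and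
  \<open>s\<close> generates \<open>P\<close>. Otherwise \<open>x^-1 P^2\<close> lies in
  \<open>P\<close>; for \<open>p \<in> P\<close> the element \<open>x^-1 p\<close> then maps the
  radical of a ring \<open>B\<close> of the chain into itself, hence lies in \<open>T\<close>, and
  \<open>P = xT\<close>. The second case is the one that needs \<open>T\<close> to absorb the
  multipliers of radicals.\<close>

lemma generated_if_local:
  assumes eq: "N \<inter> T = N' \<inter> T" and stab: "\<And>p. p \<in> N \<inter> T \<Longrightarrow> \<exists>B. subr B \<and> R \<subseteq> B \<and> B \<subseteq> T \<and> p \<in> B \<and> (\<forall>k\<in>M. x' * k \<in> B) \<and> mults (jac B) \<subseteq> T"
  shows "generated (N \<inter> T)"
proof (cases "\<exists>s\<in>N \<inter> T. \<exists>t\<in>N \<inter> T. x' * (s * t) \<notin> N")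
  case True
  then obtain s t where st: "s \<in> N \<inter> T" "t \<in> N \<inter> T" "x' * (s * t) \<notin> N" by blast
  have prod: "x' * (p * q) \<in> T" if "p \<in> N \<inter> T" "q \<in> N \<inter> T" for p q
    using that eq by (intro x'_product[OF subr_T R_T subset_refl x'T]) auto
  have "x' * (s * t) \<notin> N'" using st prod eq by blast
  then obtain w where w: "w \<in> T" "x' * (s * t) * w \<doteq> 1" using unit_in[OF subr_T R_T T_S prod[OF st(1,2)] st(3)] by blast
  have "\<forall>p\<in>N \<inter> T. (x' * t * w) * p \<in> T"
  proof
    fix p assume "p \<in> N \<inter> T"
    then have "w * (x' * (t * p)) \<in> T" using prod st w by (simp add: TD)
    then show "(x' * t * w) * p \<in> T" by (simp only: ac_simps)
  qed
  moreover have "s * (x' * t * w) \<doteq> 1" using w by (simp add: ac_simps)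
  ultimately show ?thesis using st unfolding generated_def by blast
next
  case False
  have "x' * p \<in> T" if p: "p \<in> N \<inter> T" for p
  proof -
    obtain B where B: "subr B" "R \<subseteq> B" "B \<subseteq> T" "p \<in> B" "\<And>k. k \<in> M \<Longrightarrow> x' * k \<in> B" "mults (jac B) \<subseteq> T" using stab[OF p] by blast
    have "x' * p * t \<in> jac B" if t: "t \<in> jac B" for t
    proof -
      have t: "t \<in> B" "t \<in> N" "t \<in> N'" using t unfolding jac_eq[OF B(1-3)] by auto
      have "p \<in> N'" using p eq by blast
      then have "x' * (p * t) \<in> B" using p by (intro x'_product[OF B(1-3,5) B(4) _ _ t]) auto
      moreover have "x' * (p * t) \<in> N" using False p t B by blast
      ultimately show ?thesis using eq B(3) unfolding jac_eq[OF B(1-3)] by (auto simp: mult.assoc)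
    qed
    then show ?thesis using B(6) unfolding mults_def by blast
  qed
  then show ?thesis using xx x_M M_N MD(2) R_T unfolding generated_def by blast
qed

lemma generated_both:
  assumes "\<And>p. p \<in> N \<inter> T \<Longrightarrow> \<exists>B. subr B \<and> R \<subseteq> B \<and> B \<subseteq> T \<and> p \<in> B \<and> (\<forall>k\<in>M. x' * k \<in> B) \<and> mults (jac B) \<subseteq> T"
  shows "generated (N \<inter> T)" "generated (N' \<inter> T)"
proof -
  interpret sw: quad_xT I R M m im N' N T x x' by (rule swapped_xT)
  have "generated (N \<inter> T) \<and> generated (N' \<inter> T)"
  proof (cases "N \<inter> T = N' \<inter> T")
    case True then show ?thesis using generated_if_local[OF True assms] by simp
  next
    case False
    then consider e where "e \<in> T" "e \<in> N" "e \<notin> N'" | e where "e \<in> T" "e \<in> N'" "e \<notin> N" by blast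
    then show ?thesis
      by cases (use generated_of_separating sw.generated_of_separating in blast)+
  qed
  then show "generated (N \<inter> T)" "generated (N' \<inter> T)" by auto
qed

end

section \<open>Principality of regular ideals of \<open>T\<close> and integral closedness\<close>

context quad begin

text \<open>Some \<open>u\<close> outside \<open>N\<close> has \<open>u * n^j\<close> in
  \<open>mT\<close>, whence \<open>u^k * n^(jk)\<close> is in \<open>m^k T\<close>. If
  \<open>n^(jk+1)\<close> divided \<open>m^k\<close>, then \<open>n\<close> would divide
  \<open>u^k\<close>, forcing \<open>u\<close> into \<open>N\<close>. So \<open>jk + 1\<close> is a
  bound.\<close>

lemma bounded_divisibility:
  assumes n: "n \<in> N \<inter> T" "n * n' \<doteq> 1"
  obtains b where "\<And>i. n' ^ i * m ^ k \<in> T \<Longrightarrow> i < b"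
proof -
  have nT: "n \<in> T" using n by blast
  have P: "prime_ideal T (N \<inter> T)" by (rule prime_contraction)
  have MP: "M \<subseteq> N \<inter> T" using M_N MD(2) R_T by blast
  obtain j u where u: "u \<in> T" "u \<notin> N \<inter> T" "im * (u * n ^ j) \<in> T"
    using power_in_mT[OF subr_T R_T quadr_T P MP n(1)] .
  define d where "d = Suc (j * k)"
  have nd: "n' ^ d * m ^ k \<notin> T"
  proof
    assume "n' ^ d * m ^ k \<in> T"
    moreover have "(im * (u * n ^ j)) ^ k \<in> T" using u subr_power[OF subr_T] by blast
    ultimately have "n * ((n' ^ d * m ^ k) * (im * (u * n ^ j)) ^ k) \<in> N"
      using n T_S by (intro ND(4)) (auto simp: TD)
    moreover have "n * ((n' ^ d * m ^ k) * (im * (u * n ^ j)) ^ k) = (n ^ d * n' ^ d) * ((m ^ k * im ^ k) * u ^ k)"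
      by (simp only: d_def power_mult_distrib power_mult[symmetric] power_Suc ac_simps)
    moreover have "\<dots> \<doteq> (m ^ k * im ^ k) * u ^ k" by (intro cong_mult1 inv_power n)
    moreover have "\<dots> \<doteq> u ^ k" by (intro cong_mult1 inv_power m_im')
    ultimately have "u ^ k \<in> N" using cong_mem[OF ND(1) ideal_N(2)] by metis
    then have "u ^ k \<in> N \<inter> T" using u subr_power[OF subr_T] by blast
    then show False using prime_power[OF subr_T P u(1)] u by blast
  qed
  have "i < d" if i: "n' ^ i * m ^ k \<in> T" for i
  proof (rule ccontr)
    assume "\<not> i < d"
    then have id: "i = (i - d) + d" by simp
    have "n ^ (i - d) * (n' ^ i * m ^ k) = (n ^ (i - d) * n' ^ (i - d)) * (n' ^ d * m ^ k)"
      by (subst (2) id) (simp only: power_add ac_simps)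
    also have "\<dots> \<doteq> n' ^ d * m ^ k" by (intro cong_mult1 inv_power n)
    finally have "n ^ (i - d) * (n' ^ i * m ^ k) \<doteq> n' ^ d * m ^ k" .
    moreover have "n ^ (i - d) * (n' ^ i * m ^ k) \<in> T" using i subr_power[OF subr_T nT] by (simp add: TD)
    ultimately show False using nd cong_mem[OF TD(1) I_T] by blast
  qed
  then show ?thesis using that by blast
qed

text \<open>With \<open>n\<close> and \<open>k\<close> generating the two maximal ideals of
  \<open>T\<close>, one divides \<open>G\<close> by \<open>n^i k^j\<close> with \<open>i + j\<close>
  as large as possible. The exponents are bounded because \<open>G\<close> contains a power of
  \<open>m\<close>. By maximality the result lies in neither ideal, so it contains a unit of
  \<open>T\<close>.\<close>

lemma regular_ideal_generated:
  assumes gN: "generated (N \<inter> T)" "generated (N' \<inter> T)"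
    and G: "ideal_of T G" "I \<subseteq> G" and g: "g \<in> G" "g * g' \<doteq> 1"
  shows "generated G"
proof -
  interpret sw: quad I R M m im N' N T by (rule swapped)
  note GD = ideal_ofD[OF G(1)]
  obtain n n' where n: "n \<in> N \<inter> T" "n * n' \<doteq> 1" "\<And>p. p \<in> N \<inter> T \<Longrightarrow> n' * p \<in> T" using gN(1) unfolding generated_def by blast
  obtain k k' where k: "k \<in> N' \<inter> T" "k * k' \<doteq> 1" "\<And>p. p \<in> N' \<inter> T \<Longrightarrow> k' * p \<in> T" using gN(2) unfolding generated_def by blast
  obtain l where l: "m ^ l * g' \<in> R" using denom by blast
  have "(m ^ l * g') * g \<in> G" using l R_T g by (auto simp: GD)
  moreover have "(m ^ l * g') * g = (g * g') * m ^ l" by (simp only: ac_simps)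
  moreover have "\<dots> \<doteq> m ^ l" by (intro cong_mult1 g)
  ultimately have ml: "m ^ l \<in> G" using cong_mem[OF GD(1) G(2)] by simp
  obtain b where b: "\<And>i. n' ^ i * m ^ l \<in> T \<Longrightarrow> i < b" using bounded_divisibility[OF n(1,2)] by blast
  obtain b' where b': "\<And>i. k' ^ i * m ^ l \<in> T \<Longrightarrow> i < b'" using sw.bounded_divisibility[OF k(1,2)] by blast
  define D where "D = (\<lambda>(i, j). \<forall>g\<in>G. n' ^ i * k' ^ j * g \<in> T)"
  have bd: "i + j \<le> b + b'" if "D (i, j)" for i j
  proof -
    have *: "n' ^ i * k' ^ j * m ^ l \<in> T" using that ml unfolding D_def by auto
    have "k ^ j * (n' ^ i * k' ^ j * m ^ l) \<in> T" "n ^ i * (n' ^ i * k' ^ j * m ^ l) \<in> T"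
      using * subr_power[OF subr_T] n k by (auto simp: TD)
    moreover have "k ^ j * (n' ^ i * k' ^ j * m ^ l) = (k ^ j * k' ^ j) * (n' ^ i * m ^ l)"
      "n ^ i * (n' ^ i * k' ^ j * m ^ l) = (n ^ i * n' ^ i) * (k' ^ j * m ^ l)" by (simp_all only: ac_simps)
    moreover have "(k ^ j * k' ^ j) * (n' ^ i * m ^ l) \<doteq> n' ^ i * m ^ l" "(n ^ i * n' ^ i) * (k' ^ j * m ^ l) \<doteq> k' ^ j * m ^ l"
      by (intro cong_mult1 inv_power n k)+
    ultimately have "n' ^ i * m ^ l \<in> T" "k' ^ j * m ^ l \<in> T" using cong_mem[OF TD(1) I_T] by metis+
    then show ?thesis using b b' by (simp add: add_mono less_imp_le)
  qed
  have "D (0, 0)" unfolding D_def using GD(2) by auto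
  moreover have "\<forall>ij. D ij \<longrightarrow> fst ij + snd ij < Suc (b + b')" using bd by (auto simp: less_Suc_eq_le)
  ultimately obtain ij where ij': "D ij" "\<forall>kl. D kl \<longrightarrow> fst kl + snd kl \<le> fst ij + snd ij"
    using ex_has_greatest_nat[of D "(0, 0)" "\<lambda>ij. fst ij + snd ij" "Suc (b + b')"] by metis
  obtain i j where "ij = (i, j)" by (cases ij)
  then have ij: "D (i, j)" "\<And>i' j'. D (i', j') \<Longrightarrow> i' + j' \<le> i + j" using ij' by auto
  define c where "c = n' ^ i * k' ^ j"
  define Y where "Y = (\<lambda>g. c * g) ` G"
  have sY: "sgrp Y" unfolding Y_def by (rule sgrp_image[OF GD(1)])
  have YT: "Y \<subseteq> T" using ij unfolding Y_def c_def D_def by auto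
  have "\<not> Y \<subseteq> N"
  proof
    assume "Y \<subseteq> N"
    then have "n' * (c * g) \<in> T" if "g \<in> G" for g using that n(3) YT unfolding Y_def by blast
    then have "D (Suc i, j)" unfolding D_def c_def by (simp add: mult.assoc)
    then show False using ij(2)[of "Suc i" j] by simp
  qed
  moreover have "\<not> Y \<subseteq> N'"
  proof
    assume "Y \<subseteq> N'"
    then have "k' * (c * g) \<in> T" if "g \<in> G" for g using that k(3) YT unfolding Y_def by blast
    then have "D (i, Suc j)" unfolding D_def c_def by (simp add: mult.assoc mult.left_commute)
    then show False using ij(2)[of i "Suc j"] by simp
  qed
  ultimately obtain u where u: "u \<in> Y" "u \<notin> N" "u \<notin> N'" using avoid_two[OF sY ND(1) ND'(1)] by blast
  then obtain h where h: "h \<in> G" "u = c * h" unfolding Y_def by blast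
  obtain w where w: "w \<in> T" "u * w \<doteq> 1" using unit_in[OF subr_T R_T T_S _ u(2,3)] u YT by blast
  have "h * w \<in> G" using h w by (simp add: GD)
  moreover have "(h * w) * c \<doteq> 1" using w h by (simp add: ac_simps)
  moreover have "\<forall>g\<in>G. c * g \<in> T" using YT unfolding Y_def by blast
  ultimately show ?thesis unfolding generated_def by blast
qed

text \<open>The ideal \<open>m^k T + m^k q T\<close> has a generator \<open>y\<close>. For
  \<open>s = m^k / y\<close> both \<open>s\<close> and \<open>qs\<close> are in \<open>T\<close>,
  and \<open>(a + bq)s = 1\<close> for some \<open>a\<close>, \<open>b\<close> in \<open>T\<close>.
  As \<open>a + bq\<close> is in \<open>S\<close>, the element \<open>s\<close> avoids
  \<open>N\<close> and \<open>N'\<close>, so it is a unit of \<open>T\<close> and \<open>q\<close>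
  lies in \<open>T\<close>.\<close>

lemma integrally_closed:
  assumes gN: "generated (N \<inter> T)" "generated (N' \<inter> T)" shows "S = T"
proof
  show "S \<subseteq> T"
  proof
    fix q assume q: "q \<in> S"
    obtain k where k: "m ^ k * q \<in> R" using denom by blast
    define G where "G = {g \<in> T. \<exists>a\<in>T. \<exists>b\<in>T. g \<doteq> a * m ^ k + b * (m ^ k * q)}"
    have mT: "m ^ k \<in> T" using subr_power[OF subr_T] m_M MD(2) R_T by blast
    have mqT: "m ^ k * q \<in> T" using k R_T by blast
    have GI: "g \<in> G" if "g \<in> T" "a \<in> T" "b \<in> T" "g \<doteq> a * m ^ k + b * (m ^ k * q)" for g a b
      using that unfolding G_def by blast
    have G: "ideal_of T G" unfolding ideal_of_def
    proof (intro conjI sgrpI ballI)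
      show "0 \<in> G" by (rule GI[of _ 0 0]) (simp_all add: TD)
      show "G \<subseteq> T" unfolding G_def by blast
      fix x y assume xy: "x \<in> G" "y \<in> G"
      then obtain a b a' b' where *: "a \<in> T" "b \<in> T" "a' \<in> T" "b' \<in> T" "x \<doteq> a * m ^ k + b * (m ^ k * q)" "y \<doteq> a' * m ^ k + b' * (m ^ k * q)"
        unfolding G_def by blast
      have "x - y \<doteq> a * m ^ k + b * (m ^ k * q) - (a' * m ^ k + b' * (m ^ k * q))"
        by (intro cong_diff *)
      then have "x - y \<doteq> (a - a') * m ^ k + (b - b') * (m ^ k * q)" by (simp add: algebra_simps)
      moreover have "x \<in> T" "y \<in> T" using xy unfolding G_def by auto
      ultimately show "x - y \<in> G" using * by (intro GI[of _ "a - a'" "b - b'"]) (simp_all only: TD)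
    next
      fix t x assume t: "t \<in> T" and x: "x \<in> G"
      then obtain a b where *: "a \<in> T" "b \<in> T" "x \<doteq> a * m ^ k + b * (m ^ k * q)" unfolding G_def by blast
      have "t * x \<doteq> t * (a * m ^ k + b * (m ^ k * q))" by (intro cong_mult * cong_refl)
      then have "t * x \<doteq> (t * a) * m ^ k + (t * b) * (m ^ k * q)" by (simp add: algebra_simps)
      moreover have "x \<in> T" using x unfolding G_def by auto
      ultimately show "t * x \<in> G" using * t by (intro GI[of _ "t * a" "t * b"]) (simp_all only: TD)
    qed
    have IG: "I \<subseteq> G" using I_T by (intro subsetI GI[of _ 0 0]) (auto simp: cong_def TD)
    have mG: "m ^ k \<in> G" by (rule GI[of _ 1 0]) (simp_all add: TD mT)
    have mqG: "m ^ k * q \<in> G" by (rule GI[of _ 0 1]) (simp_all add: TD mqT)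
    have "generated G" using regular_ideal_generated[OF gN G IG mG] inv_power[OF m_im'] by blast
    then obtain y y' where y: "y \<in> G" "y * y' \<doteq> 1" "\<And>g. g \<in> G \<Longrightarrow> y' * g \<in> T" unfolding generated_def by blast
    obtain a b where ab: "a \<in> T" "b \<in> T" "y \<doteq> a * m ^ k + b * (m ^ k * q)" using y(1) unfolding G_def by blast
    define s where "s = y' * m ^ k"
    have sT: "s \<in> T" and tT: "q * s \<in> T" using y(3)[OF mG] y(3)[OF mqG] unfolding s_def by (simp_all add: ac_simps)
    have "1 \<doteq> y * y'" by (rule cong_sym[OF y(2)])
    also have "\<dots> \<doteq> (a * m ^ k + b * (m ^ k * q)) * y'" by (intro cong_mult ab cong_refl)
    also have "\<dots> = (a + b * q) * s" by (simp add: s_def algebra_simps)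
    finally have one: "(a + b * q) * s \<doteq> 1" by (rule cong_sym)
    have "a + b * q \<in> S" using ab(1,2) q subsetD[OF T_S] by (simp add: SD)
    then have "s \<notin> N" "s \<notin> N'"
      using cong_mem[OF ND(1) ideal_N(2) one] cong_mem[OF ND'(1) ideal_N'(2) one] ideal_N(3) ideal_N'(3)
        ND(3)[of "a + b * q" s] ND'(3)[of "a + b * q" s] by auto
    then obtain w where w: "w \<in> T" "s * w \<doteq> 1" using unit_in[OF subr_T R_T T_S sT] by blast
    have "q \<doteq> (s * w) * q" by (rule cong_sym[OF cong_mult1[OF w(2)]])
    also have "\<dots> = (q * s) * w" by (simp only: ac_simps)
    finally have "q \<doteq> (q * s) * w" .
    moreover have "(q * s) * w \<in> T" using tT w by (simp add: TD)
    ultimately show "q \<in> T" using cong_mem[OF TD(1) I_T] by blast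
  qed
qed (rule T_S)

end

section \<open>From quadratic to Dedekind and back to stable ideals\<close>

context ctx begin

lemma Rs_mono: "i \<le> j \<Longrightarrow> Rs i \<subseteq> Rs j"
  by (rule lift_Suc_mono_le[of Rs]) (use subr_Rs in auto)

lemma Rinf_props: "subr Rinf" "R \<subseteq> Rinf" "Rs i \<subseteq> Rinf"
proof -
  have sub: "Rs i \<subseteq> Rinf" for i using subr_Rs[of i] unfolding Rinf_def by blast
  then show "R \<subseteq> Rinf" "Rs i \<subseteq> Rinf" using Rs.simps(1) by blast+
  have "x - y \<in> Rinf \<and> x * y \<in> Rinf" if xy: "x \<in> Rinf" "y \<in> Rinf" for x y
  proof -
    obtain i j where "x \<in> Rs (Suc i)" "y \<in> Rs (Suc j)" using xy unfolding Rinf_def by blast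
    then have "x \<in> Rs (Suc i + Suc j)" "y \<in> Rs (Suc i + Suc j)"
      using Rs_mono[of "Suc i" "Suc i + Suc j"] Rs_mono[of "Suc j" "Suc i + Suc j"] by auto
    then show ?thesis using subr_Rs[of "Suc i + Suc j"] subrD(4,6) sub by blast
  qed
  then show "subr Rinf" using sub[of 0] RD unfolding subr_def sgrp_def by (auto simp: subset_iff)
qed

theorem quadratic_imp_dedekind:
  assumes inv: "invertible M" and qu: "quadr Rinf" and N: "max_ideal S N" "max_ideal S N'" "covers S N N'"
  shows "quadr S" "\<And>G g g'. \<lbrakk>ideal_of S G; I \<subseteq> G; g \<in> G; g * g' \<doteq> 1\<rbrakk> \<Longrightarrow> \<exists>y\<in>G. \<exists>y'. y * y' \<doteq> 1 \<and> (\<forall>p\<in>G. y' * p \<in> S)"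
proof -
  have TS: "Rinf \<subseteq> S"
  proof
    fix t assume "t \<in> Rinf"
    then obtain a c where ac: "a \<in> R" "c \<in> R" "t * t = a * t + c" by (rule quadr_square[OF qu])
    have "- c + t * (- a) \<in> lowp R t (Suc (Suc 0))"
      by (rule lowp_SucI[OF refl]) (use ac in \<open>simp_all only: RD lowp_const\<close>)
    moreover have "t ^ Suc (Suc 0) + (- c + t * (- a)) = 0" using ac by (simp add: algebra_simps)
    ultimately show "t \<in> S" unfolding S_def integral_over_def by blast
  qed
  interpret q: quad I R M m im N N' Rinf
    by (unfold_locales) (use N Rinf_props TS qu in auto)
  have R1: "mults M = Rs (Suc 0)" using q.jac_R by simp
  have R1S: "mults M \<subseteq> S" unfolding R1 using Rinf_props(3)[of "Suc 0"] TS by blast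
  \<comment> \<open>Invertibility of \<open>M\<close> over \<open>E(M)\<close>, which is
    \<open>Rs (Suc 0)\<close>, gives a product \<open>x * h\<close> that is a unit of this ring.
    Dividing by it yields \<open>M = xE(M)\<close>, with \<open>x' = h * v\<close> the inverse of
    \<open>x\<close>.\<close>
  obtain x h where xh: "x \<in> M" "h \<in> colon (mults M) M" "x * h \<in> S" "x * h \<notin> N" "x * h \<notin> N'"
    using invertible_unit[OF MD(1) inv R1S q.prime_N q.prime_N'] .
  have B1: "subr (Rs (Suc 0))" "R \<subseteq> Rs (Suc 0)" "Rs (Suc 0) \<subseteq> S" using subr_Rs[of "Suc 0"] R1S R1 by auto
  have "x * h \<in> Rs (Suc 0)" using xh(1,2) R1 unfolding colon_def by (auto simp: mult.commute)
  then obtain v where v: "v \<in> Rs (Suc 0)" "x * h * v \<doteq> 1" using q.unit_in[OF B1 _ xh(4,5)] by blast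
  define x' where "x' = h * v"
  have xx: "x * x' \<doteq> 1" using v by (simp add: x'_def mult.assoc)
  have x'k: "x' * k \<in> Rs (Suc 0)" if "k \<in> M" for k
  proof -
    have "h * k \<in> Rs (Suc 0)" using that xh(2) R1 unfolding colon_def by auto
    then have "v * (h * k) \<in> Rs (Suc 0)" using v subrD(4)[OF B1(1)] by blast
    then show ?thesis by (simp only: x'_def ac_simps)
  qed
  interpret q: quad_xT I R M m im N N' Rinf x x'
    by (unfold_locales) (use xh xx x'k Rinf_props(3) in blast)+
  \<comment> \<open>An element of the union lies in some \<open>Rs (Suc i)\<close>, and the
    multipliers of the radical of this ring form the next ring of the chain.\<close>
  have stab: "\<exists>B. subr B \<and> R \<subseteq> B \<and> B \<subseteq> Rinf \<and> p \<in> B \<and> (\<forall>k\<in>M. x' * k \<in> B) \<and> mults (jac B) \<subseteq> Rinf"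
    if p: "p \<in> Rinf" for p
  proof -
    obtain i where i: "p \<in> Rs (Suc i)" using p unfolding Rinf_def by blast
    have "\<forall>k\<in>M. x' * k \<in> Rs (Suc i)" using x'k Rs_mono[of "Suc 0" "Suc i"] by blast
    moreover have "mults (jac (Rs (Suc i))) \<subseteq> Rinf" using Rinf_props(3)[of "Suc (Suc i)"] by simp
    ultimately show ?thesis using i subr_Rs[of "Suc i"] Rinf_props(3)[of "Suc i"] by blast
  qed
  have gen: "q.generated (N \<inter> Rinf)" "q.generated (N' \<inter> Rinf)"
    using q.generated_both stab by blast+
  have eq: "S = Rinf" by (rule q.integrally_closed[OF gen])
  show "quadr S" using qu eq by simp
  show "\<exists>y\<in>G. \<exists>y'. y * y' \<doteq> 1 \<and> (\<forall>p\<in>G. y' * p \<in> S)"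
    if "ideal_of S G" "I \<subseteq> G" "g \<in> G" "g * g' \<doteq> 1" for G g g'
    using q.regular_ideal_generated[OF gen, of G g g'] that unfolding eq q.generated_def by blast
qed

text \<open>The hypothesis \<open>gen\<close> says that \<open>y' G\<close> generates the unit ideal
  of \<open>S\<close>, that is, \<open>GS = yS\<close>. Quantifying over the ideals \<open>L\<close>
  avoids forming the extension ideal.\<close>

theorem dedekind_imp_stable:
  assumes qu: "quadr S" and N: "max_ideal S N" "max_ideal S N'" "covers S N N'"
    and G: "ideal_of R G" and y: "y * y' \<doteq> 1" "\<And>k. k \<in> G \<Longrightarrow> y' * k \<in> S"
    and gen: "\<And>L. \<lbrakk>ideal_of S L; I \<subseteq> L; \<And>k. k \<in> G \<Longrightarrow> y' * k \<in> L\<rbrakk> \<Longrightarrow> 1 \<in> L"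
  shows "\<exists>x\<in>G. (\<exists>x'. x * x' \<doteq> 1) \<and> (\<forall>a\<in>G. \<forall>b\<in>G. \<exists>c\<in>G. a * b \<doteq> x * c)"
proof -
  note GD = ideal_ofD[OF G]
  have ID: "ideal_of S N" "ideal_of S N'" "I \<subseteq> N" "I \<subseteq> N'" "1 \<notin> N" "1 \<notin> N'" using N unfolding max_ideal_def by auto
  define Y where "Y = (\<lambda>k. y' * k) ` G"
  have sY: "sgrp Y" unfolding Y_def by (rule sgrp_image[OF GD(1)])
  have "\<not> Y \<subseteq> N" "\<not> Y \<subseteq> N'" using gen[OF ID(1,3)] gen[OF ID(2,4)] ID unfolding Y_def by blast+
  then obtain u where u: "u \<in> Y" "u \<notin> N" "u \<notin> N'"
    using avoid_two[OF sY ideal_ofD(1)[OF ID(1)] ideal_ofD(1)[OF ID(2)]] by blast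
  then obtain x where x: "x \<in> G" "u = y' * x" unfolding Y_def by blast
  obtain w where w: "w \<in> S" "u * w \<doteq> 1" using N(3) u x y unfolding covers_def by blast
  define x' where "x' = y' * w"
  have xx: "x * x' \<doteq> 1" using w x by (simp add: x'_def ac_simps)
  have x'S: "x' * k \<in> S" if "k \<in> G" for k
  proof -
    have "w * (y' * k) \<in> S" using that y w by (simp add: SD)
    then show ?thesis by (simp only: x'_def ac_simps)
  qed
  have "\<exists>c\<in>G. a * b \<doteq> x * c" if ab: "a \<in> G" "b \<in> G" for a b
  proof -
    obtain p q r where *: "p \<in> R" "q \<in> R" "r \<in> R" "(x' * a) * (x' * b) = p * (x' * a) + q * (x' * b) + r"
      using qu x'S[OF ab(1)] x'S[OF ab(2)] unfolding quadr_def by blast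
    \<comment> \<open>The quadratic relation between \<open>a/x\<close> and \<open>b/x\<close>,
      multiplied by \<open>x^2\<close>, reads \<open>ab = x(pa + qb + xr)\<close>, and the second
      factor is in \<open>G\<close>.\<close>
    have "a * b \<doteq> (x * x') * ((x * x') * (a * b))"
      by (rule cong_sym, rule cong_trans[OF cong_mult1[OF xx] cong_mult1[OF xx]])
    also have "\<dots> = x * x * ((x' * a) * (x' * b))" by (simp only: ac_simps)
    also have "\<dots> = x * ((x * x') * (p * a + q * b) + x * r)" unfolding * by (simp add: algebra_simps)
    also have "\<dots> \<doteq> x * ((p * a + q * b) + x * r)" by (intro cong_mult cong_add cong_mult1 xx cong_refl)
    finally have "a * b \<doteq> x * ((p * a + q * b) + x * r)" .
    moreover have "(p * a + q * b) + x * r \<in> G" using ab * x by (simp add: GD sgrp_add)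
    ultimately show ?thesis by blast
  qed
  then show ?thesis using x xx by blast
qed

end

section \<open>Primes of one-dimensional local rings\<close>

context cring begin

lemma ideal_if_closed:
  assumes "I \<subseteq> carrier R" "\<zero> \<in> I" "\<And>a b. a \<in> I \<Longrightarrow> b \<in> I \<Longrightarrow> a \<oplus> b \<in> I" "\<And>a x. a \<in> I \<Longrightarrow> x \<in> carrier R \<Longrightarrow> x \<otimes> a \<in> I"
  shows "ideal I R"
proof (rule idealI)
  show "ring R" by (rule ring_axioms)
  show "subgroup I (add_monoid R)"
  proof (rule subgroup.intro)
    fix x assume x: "x \<in> I"
    then have "\<ominus> x = (\<ominus> \<one>) \<otimes> x" using assms(1) by (simp add: l_minus subset_iff)
    then have "\<ominus> x \<in> I" using assms(4)[OF x, of "\<ominus> \<one>"] by simp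
    then show "inv\<^bsub>add_monoid R\<^esub> x \<in> I" by (simp add: a_inv_def)
  next
    show "I \<subseteq> carrier (add_monoid R)" "\<one>\<^bsub>add_monoid R\<^esub> \<in> I" using assms(1,2) by simp_all
    show "x \<otimes>\<^bsub>add_monoid R\<^esub> y \<in> I" if "x \<in> I" "y \<in> I" for x y using assms(3)[OF that] by simp
  qed
  show "a \<otimes> x \<in> I" if "a \<in> I" "x \<in> carrier R" for a x
    using assms(4)[OF that] m_comm[of x a] that subsetD[OF assms(1) that(1)] by simp
  show "x \<otimes> a \<in> I" if "a \<in> I" "x \<in> carrier R" for a x by (rule assms(4)[OF that])
qed

lemma idealD: assumes "ideal I R"
  shows "I \<subseteq> carrier R" "\<zero> \<in> I" "\<And>a b. a \<in> I \<Longrightarrow> b \<in> I \<Longrightarrow> a \<oplus> b \<in> I" "\<And>a b. a \<in> I \<Longrightarrow> b \<in> I \<Longrightarrow> a \<ominus> b \<in> I"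
    "\<And>a. a \<in> I \<Longrightarrow> \<ominus> a \<in> I"
    "\<And>a x. a \<in> I \<Longrightarrow> x \<in> carrier R \<Longrightarrow> x \<otimes> a \<in> I" "\<And>a x. a \<in> I \<Longrightarrow> x \<in> carrier R \<Longrightarrow> a \<otimes> x \<in> I"
proof -
  interpret I: ideal I R by fact
  show "I \<subseteq> carrier R" "\<zero> \<in> I" using I.a_subset by auto
  show "\<And>a b. a \<in> I \<Longrightarrow> b \<in> I \<Longrightarrow> a \<oplus> b \<in> I" "\<And>a. a \<in> I \<Longrightarrow> \<ominus> a \<in> I" by auto
  then show "\<And>a b. a \<in> I \<Longrightarrow> b \<in> I \<Longrightarrow> a \<ominus> b \<in> I" by (simp add: a_minus_def)
  show "\<And>a x. a \<in> I \<Longrightarrow> x \<in> carrier R \<Longrightarrow> x \<otimes> a \<in> I" "\<And>a x. a \<in> I \<Longrightarrow> x \<in> carrier R \<Longrightarrow> a \<otimes> x \<in> I"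
    using I.I_l_closed I.I_r_closed by auto
qed

lemma ideal_add_principal:
  assumes "ideal I R" "a \<in> carrier R"
  defines "K \<equiv> {p \<oplus> r \<otimes> a | p r. p \<in> I \<and> r \<in> carrier R}"
  shows "ideal K R" "I \<subseteq> K" "a \<in> K"
proof -
  note ID = idealD[OF assms(1)]
  have "K = I <+> PIdl a" unfolding K_def cgenideal_def set_add_def' by blast
  then show "ideal K R" using add_ideals[OF assms(1) cgenideal_ideal[OF assms(2)]] by simp
  show "I \<subseteq> K"
  proof
    fix x assume "x \<in> I"
    moreover have "x = x \<oplus> \<zero> \<otimes> a" using calculation ID assms by (auto simp: subset_iff)
    ultimately show "x \<in> K" unfolding K_def by blast
  qed
  have "a = \<zero> \<oplus> \<one> \<otimes> a" using assms by simp
  then show "a \<in> K" unfolding K_def using ID by blast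
qed

text \<open>Serves two purposes: a multiplicatively closed \<open>W\<close> leads to prime ideals,
  and \<open>W = {\<one>}\<close> to maximal ideals.\<close>

lemma exists_maximal_disjoint:
  assumes J: "ideal J R" "J \<inter> W = {}" and W: "W \<noteq> {}"
  shows "\<exists>P. ideal P R \<and> J \<subseteq> P \<and> P \<inter> W = {} \<and> (\<forall>K. ideal K R \<longrightarrow> P \<subseteq> K \<longrightarrow> K \<inter> W = {} \<longrightarrow> K = P)"
proof -
  let ?A = "{K. ideal K R \<and> J \<subseteq> K \<and> K \<inter> W = {}}"
  have "\<exists>P\<in>?A. \<forall>K\<in>?A. P \<subseteq> K \<longrightarrow> K = P"
  proof (rule subset_Zorn_nonempty)
    show "?A \<noteq> {}" using J by blast
    fix C assume C: "C \<noteq> {}" "subset.chain ?A C"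
    then have "subset.chain {I. ideal I R} C" unfolding subset.chain_def by blast
    from chain_Union_is_ideal[OF this] have "ideal (\<Union>C) R" using C by simp
    then show "\<Union>C \<in> ?A" using C unfolding subset.chain_def by blast
  qed
  then obtain P where P: "P \<in> ?A" "\<forall>K\<in>?A. P \<subseteq> K \<longrightarrow> K = P" by blast
  have "K = P" if "ideal K R" "P \<subseteq> K" "K \<inter> W = {}" for K
  proof -
    have "K \<in> ?A" using P(1) that by auto
    then show ?thesis using P(2) that(2) by auto
  qed
  then show ?thesis using P(1) by auto
qed

lemma exists_prime_disjoint:
  assumes J: "ideal J R" "J \<inter> W = {}" and W: "\<one> \<in> W" "\<And>a b. a \<in> W \<Longrightarrow> b \<in> W \<Longrightarrow> a \<otimes> b \<in> W"
  obtains P where "primeideal P R" "J \<subseteq> P" "P \<inter> W = {}"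
proof -
  have "W \<noteq> {}" using W by blast
  obtain P where P: "ideal P R" "J \<subseteq> P" "P \<inter> W = {}" "\<And>K. ideal K R \<Longrightarrow> P \<subseteq> K \<Longrightarrow> K \<inter> W = {} \<Longrightarrow> K = P"
    using exists_maximal_disjoint[OF J \<open>W \<noteq> {}\<close>] by blast
  note PD = idealD[OF P(1)]
  have meet: "\<exists>p r. p \<in> P \<and> r \<in> carrier R \<and> p \<oplus> r \<otimes> a \<in> W" if "a \<in> carrier R" "a \<notin> P" for a
    using P(4)[OF ideal_add_principal(1,2)[OF P(1) that(1)]] ideal_add_principal(3)[OF P(1) that(1)] that by blast
  have "primeideal P R"
  proof (rule primeidealI[OF P(1) cring_axioms])
    show "carrier R \<noteq> P" using P(3) W by auto
    fix a b assume ab: "a \<in> carrier R" "b \<in> carrier R" "a \<otimes> b \<in> P"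
    show "a \<in> P \<or> b \<in> P"
    proof (rule ccontr)
      assume "\<not> (a \<in> P \<or> b \<in> P)"
      then obtain p r q s where *: "p \<in> P" "r \<in> carrier R" "p \<oplus> r \<otimes> a \<in> W" "q \<in> P" "s \<in> carrier R" "q \<oplus> s \<otimes> b \<in> W"
        using meet[OF ab(1)] meet[OF ab(2)] by blast
      have c: "p \<in> carrier R" "q \<in> carrier R" using * PD by auto
      have "(p \<oplus> r \<otimes> a) \<otimes> (q \<oplus> s \<otimes> b) = p \<otimes> (q \<oplus> s \<otimes> b) \<oplus> (r \<otimes> a) \<otimes> q \<oplus> (r \<otimes> s) \<otimes> (a \<otimes> b)"
        using c * ab by (simp add: l_distr r_distr m_ac a_ac)
      also have "\<dots> \<in> P" using c * ab by (intro PD(3)) (simp_all add: PD)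
      finally show False using P(3) W(2)[OF *(3,6)] by blast
    qed
  qed
  then show ?thesis using that P by blast
qed

lemma in_maximal_ideal:
  assumes J: "ideal J R" "\<one> \<notin> J" obtains P where "maximalideal P R" "J \<subseteq> P"
proof -
  obtain P where P: "ideal P R" "J \<subseteq> P" "P \<inter> {\<one>} = {}" "\<And>K. ideal K R \<Longrightarrow> P \<subseteq> K \<Longrightarrow> K \<inter> {\<one>} = {} \<Longrightarrow> K = P"
    using exists_maximal_disjoint[of J "{\<one>}"] J by blast
  have "maximalideal P R"
  proof (rule maximalidealI[OF P(1)])
    show "carrier R \<noteq> P" using P(3) by auto
    fix K assume K: "ideal K R" "P \<subseteq> K" "K \<subseteq> carrier R"
    then show "K = P \<or> K = carrier R" using P(4)[OF K(1,2)] ideal.one_imp_carrier[OF K(1)] by auto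
  qed
  then show ?thesis using that P by blast
qed

lemma maximalideal_iff:
  "maximalideal N R \<longleftrightarrow> ideal N R \<and> \<one> \<notin> N \<and> (\<forall>x\<in>carrier R. x \<notin> N \<longrightarrow> (\<exists>b\<in>carrier R. x \<otimes> b \<ominus> \<one> \<in> N))"
proof
  assume N: "maximalideal N R"
  then have I: "ideal N R" by (rule maximalideal.axioms)
  note ND = idealD[OF I]
  have "\<one> \<notin> N" using ideal.one_imp_carrier[OF I] maximalideal.I_notcarr[OF N] by blast
  moreover have "\<exists>b\<in>carrier R. x \<otimes> b \<ominus> \<one> \<in> N" if x: "x \<in> carrier R" "x \<notin> N" for x
  proof -
    let ?K = "{p \<oplus> r \<otimes> x | p r. p \<in> N \<and> r \<in> carrier R}"
    note K = ideal_add_principal[OF I x(1)]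
    have "?K = carrier R" using maximalideal.I_maximal[OF N K(1,2) idealD(1)[OF K(1)]] K(3) x by blast
    then obtain p r where *: "\<one> = p \<oplus> r \<otimes> x" "p \<in> N" "r \<in> carrier R" by (smt (verit) one_closed mem_Collect_eq)
    have c: "p \<in> carrier R" using * ND by auto
    have "x \<otimes> r \<ominus> \<one> = \<ominus> p" unfolding *(1) a_minus_def using c * x
      by (simp add: minus_add m_comm[of r x] r_neg2 a_lcomm[of "x \<otimes> r"] r_neg)
    then show ?thesis using ND * by metis
  qed
  ultimately show "ideal N R \<and> \<one> \<notin> N \<and> (\<forall>x\<in>carrier R. x \<notin> N \<longrightarrow> (\<exists>b\<in>carrier R. x \<otimes> b \<ominus> \<one> \<in> N))" using I by blast
next
  assume N: "ideal N R \<and> \<one> \<notin> N \<and> (\<forall>x\<in>carrier R. x \<notin> N \<longrightarrow> (\<exists>b\<in>carrier R. x \<otimes> b \<ominus> \<one> \<in> N))"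
  show "maximalideal N R"
  proof (rule maximalidealI)
    show "ideal N R" "carrier R \<noteq> N" using N by auto
    fix K assume K: "ideal K R" "N \<subseteq> K" "K \<subseteq> carrier R"
    note KD = idealD[OF K(1)]
    have "K = carrier R" if "K \<noteq> N"
    proof -
      obtain x where x: "x \<in> K" "x \<notin> N" "x \<in> carrier R" using \<open>K \<noteq> N\<close> K by blast
      then obtain b where b: "b \<in> carrier R" "x \<otimes> b \<ominus> \<one> \<in> K" using N K by blast
      have "x \<otimes> b \<ominus> (x \<otimes> b \<ominus> \<one>) \<in> K" by (rule KD(4)) (use x b KD in auto)
      moreover have "x \<otimes> b \<ominus> (x \<otimes> b \<ominus> \<one>) = \<one>" using x b by (simp add: a_minus_def minus_add r_neg2 a_assoc[symmetric] r_neg)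
      ultimately show ?thesis using ideal.one_imp_carrier[OF K(1)] by simp
    qed
    then show "K = N \<or> K = carrier R" by blast
  qed
qed

text \<open>In dimension one, a prime that contains \<open>s\<close> but not \<open>x\<close> would be minimal over \<open>J\<close>, contradicting that
  \<open>s\<close> is regular modulo \<open>J\<close>.\<close>

lemma power_in_regular_ideal:
  assumes dim: "krull_dim_one R" and M: "\<And>P. primeideal P R \<Longrightarrow> P \<subseteq> M" "primeideal M R"
    and J: "ideal J R" and s: "s \<in> carrier R" "\<And>w. w \<in> carrier R \<Longrightarrow> w \<otimes> s \<in> J \<Longrightarrow> w \<in> J" and x: "x \<in> M"
  shows "\<exists>k::nat. \<exists>r\<in>carrier R. \<exists>j\<in>J. x [^] k = j \<oplus> r \<otimes> s"
proof -
  note JD = idealD[OF J]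
  have xR: "x \<in> carrier R" using x idealD(1)[OF primeideal.axioms(1)[OF M(2)]] by blast
  let ?K = "{p \<oplus> r \<otimes> s | p r. p \<in> J \<and> r \<in> carrier R}"
  note K = ideal_add_principal[OF J s(1)]
  let ?W = "{x [^] (k::nat) | k. True}"
  have "\<exists>k. x [^] (k::nat) \<in> ?K"
  proof (rule ccontr)
    assume no: "\<not> ?thesis"
    have "?K \<inter> ?W = {}" using no by auto
    moreover have "\<one> \<in> ?W" by (intro CollectI exI[of _ 0]) simp
    moreover have "a \<otimes> b \<in> ?W" if ab: "a \<in> ?W" "b \<in> ?W" for a b
    proof -
      obtain k l where "a = x [^] (k::nat)" "b = x [^] (l::nat)" using ab by blast
      then have "a \<otimes> b = x [^] (k + l)" using xR by (simp add: nat_pow_mult)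
      then show ?thesis by auto
    qed
    ultimately obtain P where P: "primeideal P R" "?K \<subseteq> P" "P \<inter> ?W = {}" using exists_prime_disjoint[OF K(1)] by blast
    interpret P: primeideal P R by (rule P(1))
    have sP: "s \<in> P" using P K by blast
    have "x [^] (1::nat) \<in> ?W" by blast
    then have xP: "x \<notin> P" using P(3) xR by auto
    \<comment> \<open>The multiplicative set generated by \<open>s\<close> and the complement of
      \<open>P\<close>. It misses \<open>J\<close>, because \<open>s\<close> can be cancelled modulo
      \<open>J\<close> and \<open>J\<close> is contained in \<open>P\<close>. A prime over
      \<open>J\<close> that misses it is contained in \<open>P\<close> and omits \<open>s\<close>,
      so it is strictly smaller and a chain of three primes arises.\<close>
    let ?V = "{w \<otimes> s [^] (k::nat) | w k. w \<in> carrier R \<and> w \<notin> P}"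
    have one: "\<one> \<notin> P" using P.I_notcarr P.one_imp_carrier by blast
    have pow: "w \<in> J" if "w \<in> carrier R" "w \<otimes> s [^] (k::nat) \<in> J" for w k
      using that
    proof (induction k arbitrary: w)
      case (Suc k)
      have "(w \<otimes> s [^] k) \<otimes> s \<in> J" "w \<otimes> s [^] k \<in> carrier R" using Suc.prems s(1) by (simp_all add: m_assoc)
      then have "w \<otimes> s [^] k \<in> J" using s(2) by simp
      then show ?case by (rule Suc.IH[OF Suc.prems(1)])
    qed simp
    have V1: "w \<in> ?V" if "w \<in> carrier R" "w \<notin> P" for w
      using that by (intro CollectI exI[of _ w] exI[of _ 0]) simp
    have V2: "s \<in> ?V" using one s(1) by (intro CollectI exI[of _ \<one>] exI[of _ "1::nat"]) simp
    have "J \<inter> ?V = {}" using pow K(2) P(2) by blast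
    moreover have "a \<otimes> b \<in> ?V" if ab: "a \<in> ?V" "b \<in> ?V" for a b
    proof -
      obtain v w k l where *: "a = v \<otimes> s [^] (k::nat)" "b = w \<otimes> s [^] (l::nat)" "v \<in> carrier R" "v \<notin> P" "w \<in> carrier R" "w \<notin> P"
        using ab by blast
      have "a \<otimes> b = (v \<otimes> w) \<otimes> s [^] (k + l)" using * s(1) by (simp add: nat_pow_mult[symmetric] m_ac)
      moreover have "v \<otimes> w \<notin> P" "v \<otimes> w \<in> carrier R" using * P.I_prime by auto
      ultimately show ?thesis by blast
    qed
    ultimately obtain P0 where P0: "primeideal P0 R" "J \<subseteq> P0" "P0 \<inter> ?V = {}"
      using exists_prime_disjoint[OF J, of ?V] V1[OF one_closed one] by blast
    have "P0 \<subseteq> carrier R" by (rule idealD(1)[OF primeideal.axioms(1)[OF P0(1)]])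
    then have "P0 \<subseteq> P" using P0(3) V1 by blast
    then have "P0 \<subset> P" "P \<subset> M" using V2 sP P0(3) M(1)[OF P(1)] x xP by blast+
    then show False using dim P0(1) P(1) M(2) unfolding krull_dim_one_def by blast
  qed
  then show ?thesis by blast
qed

end

text \<open>The properties of a one-dimensional local ring with regular maximal ideal that the proof uses; they pass
  to \<open>R / J\<close>.\<close>

locale dim1_local = cring R for R :: "('a, 'b) ring_scheme" (structure) +
  fixes M :: "'a set" and m :: 'a
  assumes ideal_M: "ideal M R" and one_M: "\<one> \<notin> M" and unit_R: "r \<in> carrier R \<Longrightarrow> r \<notin> M \<Longrightarrow> r \<in> Units R"
    and m_M: "m \<in> M" and nzd_m: "nzd R m"
    and nzd_power: "nzd R s \<Longrightarrow> x \<in> M \<Longrightarrow> \<exists>(k::nat). \<exists>r\<in>carrier R. x [^] k = r \<otimes> s"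

text \<open>The form in which stability descends to and lifts from \<open>R / J\<close>: every regular ideal \<open>I\<close> has a
  regular element \<open>x\<close> with \<open>I\<^sup>2 = xI\<close>.\<close>

definition sp_ring :: "('a, 'b) ring_scheme \<Rightarrow> bool" where
  "sp_ring R \<longleftrightarrow> (\<forall>I. ideal I R \<and> regular_set R I \<longrightarrow>
    (\<exists>x\<in>I. nzd R x \<and> (\<forall>a\<in>I. \<forall>b\<in>I. \<exists>c\<in>I. a \<otimes>\<^bsub>R\<^esub> b = x \<otimes>\<^bsub>R\<^esub> c)))"

lemma sp_ringD:
  assumes "sp_ring R" "ideal I R" "regular_set R I"
  shows "\<exists>x\<in>I. nzd R x \<and> (\<forall>a\<in>I. \<forall>b\<in>I. \<exists>c\<in>I. a \<otimes>\<^bsub>R\<^esub> b = x \<otimes>\<^bsub>R\<^esub> c)"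
  using assms unfolding sp_ring_def by simp

lemma dim1_localI:
  fixes R (structure)
  assumes "cring R" "local_ring R" and M: "maximalideal M R" and dim: "krull_dim_one R" and m: "m \<in> M" "nzd R m"
  shows "dim1_local R M m"
proof -
  interpret cring R by fact
  have MD: "ideal M R" "\<one> \<notin> M" using M maximalideal_iff by auto
  have below: "K \<subseteq> M" if K: "ideal K R" "\<one> \<notin> K" for K
  proof -
    obtain P where "maximalideal P R" "K \<subseteq> P" using in_maximal_ideal[OF K] .
    then show ?thesis using assms(2) M unfolding local_ring_def by blast
  qed
  show ?thesis
  proof (rule dim1_local.intro[OF assms(1)], rule dim1_local_axioms.intro)
    show "ideal M R" "\<one> \<notin> M" by (rule MD)+
    show "m \<in> M" "nzd R m" by (rule m)+
    show "r \<in> Units R" if r: "r \<in> carrier R" "r \<notin> M" for r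
    proof -
      have "\<one> \<in> PIdl r" using below[OF cgenideal_ideal[OF r(1)]] cgenideal_self[OF r(1)] r by blast
      then obtain s where "s \<in> carrier R" "\<one> = s \<otimes> r" unfolding cgenideal_def by blast
      then show ?thesis using r unfolding Units_def by (auto simp: m_comm intro!: bexI[of _ s])
    qed
    fix s x assume s: "nzd R s" and x: "x \<in> M"
    have pb: "P \<subseteq> M" if "primeideal P R" for P
      using below primeideal.axioms(1)[OF that] primeideal.I_notcarr[OF that] ideal.one_imp_carrier by blast
    have sR: "s \<in> carrier R" using s unfolding nzd_def by blast
    have sz: "w \<in> {\<zero>}" if "w \<in> carrier R" "w \<otimes> s \<in> {\<zero>}" for w
      using s that sR unfolding nzd_def by (simp add: m_comm)
    \<comment> \<open>Here the zero ideal takes the place of \<open>J\<close>, and regular modulo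
      \<open>J\<close> means regular.\<close>
    obtain k r j where "r \<in> carrier R" "j \<in> {\<zero>}" "x [^] (k::nat) = j \<oplus> r \<otimes> s"
      using power_in_regular_ideal[OF dim _ maximalideal_prime[OF M] zeroideal sR _ x] pb sz by meson
    then show "\<exists>(k::nat). \<exists>r\<in>carrier R. x [^] k = r \<otimes> s" using sR by auto
  qed
qed

section \<open>The total ring of quotients and its presentation\<close>

context cring begin

lemma nzdD: "nzd R s \<Longrightarrow> s \<in> carrier R" by (simp add: nzd_def)

lemma nzd_cancel:
  assumes "nzd R s" "a \<in> carrier R" "b \<in> carrier R" "s \<otimes> a = s \<otimes> b" shows "a = b"
proof -
  have s: "s \<in> carrier R" by (rule nzdD[OF assms(1)])
  have "s \<otimes> (a \<ominus> b) = s \<otimes> a \<ominus> s \<otimes> b" using assms(2,3) s by (simp add: a_minus_def r_distr r_minus)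
  then have "s \<otimes> (a \<ominus> b) = \<zero>" using assms s by (simp add: a_minus_def r_neg)
  then have "a \<ominus> b = \<zero>" using assms unfolding nzd_def by simp
  then show ?thesis using assms by simp
qed

lemma nzd_one: "nzd R \<one>" by (simp add: nzd_def)

lemma nzd_mult: assumes "nzd R s" "nzd R t" shows "nzd R (s \<otimes> t)"
  unfolding nzd_def
proof (intro conjI ballI impI)
  have c: "s \<in> carrier R" "t \<in> carrier R" using assms nzdD by blast+
  then show "s \<otimes> t \<in> carrier R" by simp
  fix y assume y: "y \<in> carrier R" "s \<otimes> t \<otimes> y = \<zero>"
  then have "s \<otimes> (t \<otimes> y) = \<zero>" "t \<otimes> y \<in> carrier R" using c by (simp_all add: m_assoc)
  then have "t \<otimes> y = \<zero>" using assms(1) unfolding nzd_def by blast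
  then show "y = \<zero>" using assms(2) y(1) unfolding nzd_def by blast
qed

lemma nzd_pow: "nzd R s \<Longrightarrow> nzd R (s [^] (n::nat))"
  by (induction n) (simp_all add: nzd_one nzd_mult)

lemma nzd_factor:
  assumes "nzd R (s \<otimes> t)" "s \<in> carrier R" "t \<in> carrier R" shows "nzd R s"
  unfolding nzd_def
proof (intro conjI ballI impI)
  fix y assume y: "y \<in> carrier R" "s \<otimes> y = \<zero>"
  have "(s \<otimes> t) \<otimes> y = t \<otimes> (s \<otimes> y)" using assms(2,3) y(1) by (simp add: m_ac)
  then have "(s \<otimes> t) \<otimes> y = \<zero>" using y assms by simp
  then show "y = \<zero>" using assms(1) y unfolding nzd_def by blast
qed (rule assms)

lemma frac_mem: "(b, t) \<in> frac R a s \<longleftrightarrow> a \<in> carrier R \<and> nzd R s \<and> b \<in> carrier R \<and> nzd R t \<and> a \<otimes> t = b \<otimes> s"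
  unfolding frac_def frac_rel_def by auto

lemma frac_eq:
  assumes "a \<in> carrier R" "b \<in> carrier R" "nzd R s" "nzd R t"
  shows "frac R a s = frac R b t \<longleftrightarrow> a \<otimes> t = b \<otimes> s"
proof
  assume "frac R a s = frac R b t"
  moreover have "(b, t) \<in> frac R b t" using assms by (simp add: frac_mem)
  ultimately show "a \<otimes> t = b \<otimes> s" by (metis frac_mem)
next
  have main: "frac R a s \<subseteq> frac R b t"
    if ab: "a \<in> carrier R" "b \<in> carrier R" "nzd R s" "nzd R t" "a \<otimes> t = b \<otimes> s" for a b s t
  proof clarify
    fix c u assume "(c, u) \<in> frac R a s"
    then have c: "c \<in> carrier R" "nzd R u" "a \<otimes> u = c \<otimes> s" by (simp_all add: frac_mem)
    have car: "s \<in> carrier R" "t \<in> carrier R" "u \<in> carrier R" using ab c nzdD by auto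
    have "s \<otimes> (b \<otimes> u) = (b \<otimes> s) \<otimes> u" using ab(1,2) c(1) car by (simp add: m_ac)
    also have "\<dots> = (a \<otimes> u) \<otimes> t" unfolding ab(5)[symmetric] using ab(1,2) c(1) car by (simp add: m_ac)
    also have "\<dots> = s \<otimes> (c \<otimes> t)" unfolding c(3) using ab(1,2) c(1) car by (simp add: m_ac)
    finally have "b \<otimes> u = c \<otimes> t" using nzd_cancel[OF ab(3)] ab c car by simp
    then show "(c, u) \<in> frac R b t" using ab c by (simp add: frac_mem)
  qed
  assume "a \<otimes> t = b \<otimes> s"
  then show "frac R a s = frac R b t" using main[of a b s t] main[of b a t s] assms by auto
qed

lemma frac_cancel:
  assumes "a \<in> carrier R" "nzd R s" "nzd R t" shows "frac R (a \<otimes> t) (s \<otimes> t) = frac R a s"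
proof -
  have "s \<in> carrier R" "t \<in> carrier R" using assms nzdD by auto
  then have "frac R (a \<otimes> t) (s \<otimes> t) = frac R a s \<longleftrightarrow> (a \<otimes> t) \<otimes> s = a \<otimes> (s \<otimes> t)"
    using assms by (intro frac_eq nzd_mult) auto
  then show ?thesis using assms nzdD[OF assms(2)] nzdD[OF assms(3)] by (simp add: m_ac)
qed

lemma TotQ_carrier: "carrier (TotQ R) = {frac R a s | a s. a \<in> carrier R \<and> nzd R s}"
  unfolding TotQ_def quotient_def frac_def by auto

lemma TotQ_E: assumes "x \<in> carrier (TotQ R)" obtains a s where "a \<in> carrier R" "nzd R s" "x = frac R a s"
  using assms unfolding TotQ_carrier by blast

lemma TotQ_zero: "\<zero>\<^bsub>TotQ R\<^esub> = frac R \<zero> \<one>" and TotQ_one: "\<one>\<^bsub>TotQ R\<^esub> = frac R \<one> \<one>"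
  by (simp_all add: TotQ_def)

text \<open>All choices of representatives give the same class, so the union in
  \<open>Q_mult\<close> is taken over a constant family.\<close>

lemma TotQ_mult:
  assumes "a \<in> carrier R" "b \<in> carrier R" "nzd R s" "nzd R t"
  shows "frac R a s \<otimes>\<^bsub>TotQ R\<^esub> frac R b t = frac R (a \<otimes> b) (s \<otimes> t)"
proof -
  have "frac R (fst p \<otimes> fst q) (snd p \<otimes> snd q) = frac R (a \<otimes> b) (s \<otimes> t)"
    if "p \<in> frac R a s" "q \<in> frac R b t" for p q
  proof -
    obtain c u d v where pq: "p = (c, u)" "q = (d, v)" by (cases p, cases q)
    have *: "c \<in> carrier R" "d \<in> carrier R" "nzd R u" "nzd R v" "a \<otimes> u = c \<otimes> s" "b \<otimes> v = d \<otimes> t"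
      using that unfolding pq by (simp_all add: frac_mem)
    have car: "s \<in> carrier R" "t \<in> carrier R" "u \<in> carrier R" "v \<in> carrier R" using assms * nzdD by auto
    have "(c \<otimes> d) \<otimes> (s \<otimes> t) = (c \<otimes> s) \<otimes> (d \<otimes> t)" using assms(1,2) *(1,2) car by (simp add: m_ac)
    also have "\<dots> = (a \<otimes> b) \<otimes> (u \<otimes> v)" unfolding *(5,6)[symmetric] using assms(1,2) *(1,2) car by (simp add: m_ac)
    finally show ?thesis unfolding pq using assms * by (simp add: frac_eq nzd_mult)
  qed
  moreover have "(a, s) \<in> frac R a s" "(b, t) \<in> frac R b t" using assms by (simp_all add: frac_mem)
  ultimately show ?thesis unfolding TotQ_def Q_mult_def by (auto simp del: fst_conv snd_conv)
qed

lemma TotQ_add: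
  assumes "a \<in> carrier R" "b \<in> carrier R" "nzd R s" "nzd R t"
  shows "frac R a s \<oplus>\<^bsub>TotQ R\<^esub> frac R b t = frac R (a \<otimes> t \<oplus> b \<otimes> s) (s \<otimes> t)"
proof -
  have "frac R (fst p \<otimes> snd q \<oplus> fst q \<otimes> snd p) (snd p \<otimes> snd q) = frac R (a \<otimes> t \<oplus> b \<otimes> s) (s \<otimes> t)"
    if "p \<in> frac R a s" "q \<in> frac R b t" for p q
  proof -
    obtain c u d v where pq: "p = (c, u)" "q = (d, v)" by (cases p, cases q)
    have *: "c \<in> carrier R" "d \<in> carrier R" "nzd R u" "nzd R v" "a \<otimes> u = c \<otimes> s" "b \<otimes> v = d \<otimes> t"
      using that unfolding pq by (simp_all add: frac_mem)
    have car: "s \<in> carrier R" "t \<in> carrier R" "u \<in> carrier R" "v \<in> carrier R" using assms * nzdD by auto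
    have "(c \<otimes> v \<oplus> d \<otimes> u) \<otimes> (s \<otimes> t) = (c \<otimes> s) \<otimes> (v \<otimes> t) \<oplus> (d \<otimes> t) \<otimes> (u \<otimes> s)"
      using assms(1,2) *(1,2) car by (simp add: l_distr r_distr m_ac)
    also have "\<dots> = (a \<otimes> t \<oplus> b \<otimes> s) \<otimes> (u \<otimes> v)" unfolding *(5,6)[symmetric]
      using assms(1,2) *(1,2) car by (simp add: l_distr r_distr m_ac)
    finally show ?thesis unfolding pq using assms * car by (simp add: frac_eq nzd_mult)
  qed
  moreover have "(a, s) \<in> frac R a s" "(b, t) \<in> frac R b t" using assms by (simp_all add: frac_mem)
  ultimately show ?thesis unfolding TotQ_def Q_add_def by (auto simp del: fst_conv snd_conv)
qed

lemma frac_in: "a \<in> carrier R \<Longrightarrow> nzd R s \<Longrightarrow> frac R a s \<in> carrier (TotQ R)"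
  unfolding TotQ_carrier by blast

lemma cring_TotQ: "cring (TotQ R)"
proof (rule cringI)
  note simps = TotQ_mult TotQ_add nzd_mult nzd_one nzdD TotQ_zero TotQ_one
  show "abelian_group (TotQ R)"
  proof (rule abelian_groupI)
    show "\<zero>\<^bsub>TotQ R\<^esub> \<in> carrier (TotQ R)" by (simp add: TotQ_zero frac_in nzd_one)
    fix x assume "x \<in> carrier (TotQ R)"
    then obtain a s where x: "a \<in> carrier R" "nzd R s" "x = frac R a s" by (rule TotQ_E)
    have s: "s \<in> carrier R" by (rule nzdD[OF x(2)])
    show "\<zero>\<^bsub>TotQ R\<^esub> \<oplus>\<^bsub>TotQ R\<^esub> x = x" using x s by (simp add: simps frac_eq)
    have "frac R (\<ominus> a) s \<oplus>\<^bsub>TotQ R\<^esub> x = \<zero>\<^bsub>TotQ R\<^esub>" using x s by (simp add: simps frac_eq l_minus l_neg)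
    then show "\<exists>y\<in>carrier (TotQ R). y \<oplus>\<^bsub>TotQ R\<^esub> x = \<zero>\<^bsub>TotQ R\<^esub>" using x frac_in by blast
    fix y assume "y \<in> carrier (TotQ R)"
    then obtain b t where y: "b \<in> carrier R" "nzd R t" "y = frac R b t" by (rule TotQ_E)
    have t: "t \<in> carrier R" by (rule nzdD[OF y(2)])
    show "x \<oplus>\<^bsub>TotQ R\<^esub> y \<in> carrier (TotQ R)" using x y s t by (simp add: simps frac_in)
    show "x \<oplus>\<^bsub>TotQ R\<^esub> y = y \<oplus>\<^bsub>TotQ R\<^esub> x" using x y s t by (simp add: simps a_comm m_comm)
    fix z assume "z \<in> carrier (TotQ R)"
    then obtain c u where z: "c \<in> carrier R" "nzd R u" "z = frac R c u" by (rule TotQ_E)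
    have u: "u \<in> carrier R" by (rule nzdD[OF z(2)])
    show "(x \<oplus>\<^bsub>TotQ R\<^esub> y) \<oplus>\<^bsub>TotQ R\<^esub> z = x \<oplus>\<^bsub>TotQ R\<^esub> (y \<oplus>\<^bsub>TotQ R\<^esub> z)"
    proof -
      have "(a \<otimes> t \<oplus> b \<otimes> s) \<otimes> u = a \<otimes> (t \<otimes> u) \<oplus> b \<otimes> u \<otimes> s" "(b \<otimes> u \<oplus> c \<otimes> t) \<otimes> s = b \<otimes> u \<otimes> s \<oplus> c \<otimes> (s \<otimes> t)"
        using x(1) y(1) z(1) s t u by (simp_all only: l_distr m_closed) (simp_all add: m_ac)
      then show ?thesis using x y z s t u by (simp add: simps a_assoc m_assoc)
    qed
  qed
  show "comm_monoid (TotQ R)"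
  proof (rule comm_monoidI)
    show "\<one>\<^bsub>TotQ R\<^esub> \<in> carrier (TotQ R)" by (simp add: TotQ_one frac_in nzd_one)
    fix x assume "x \<in> carrier (TotQ R)"
    then obtain a s where x: "a \<in> carrier R" "nzd R s" "x = frac R a s" by (rule TotQ_E)
    have s: "s \<in> carrier R" by (rule nzdD[OF x(2)])
    show "\<one>\<^bsub>TotQ R\<^esub> \<otimes>\<^bsub>TotQ R\<^esub> x = x" using x s by (simp add: simps)
    fix y assume "y \<in> carrier (TotQ R)"
    then obtain b t where y: "b \<in> carrier R" "nzd R t" "y = frac R b t" by (rule TotQ_E)
    have t: "t \<in> carrier R" by (rule nzdD[OF y(2)])
    show "x \<otimes>\<^bsub>TotQ R\<^esub> y \<in> carrier (TotQ R)" using x y s t by (simp add: simps frac_in)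
    show "x \<otimes>\<^bsub>TotQ R\<^esub> y = y \<otimes>\<^bsub>TotQ R\<^esub> x" using x y s t by (simp add: simps m_comm)
    fix z assume "z \<in> carrier (TotQ R)"
    then obtain c u where z: "c \<in> carrier R" "nzd R u" "z = frac R c u" by (rule TotQ_E)
    have u: "u \<in> carrier R" by (rule nzdD[OF z(2)])
    show "(x \<otimes>\<^bsub>TotQ R\<^esub> y) \<otimes>\<^bsub>TotQ R\<^esub> z = x \<otimes>\<^bsub>TotQ R\<^esub> (y \<otimes>\<^bsub>TotQ R\<^esub> z)"
      using x y z s t u by (simp add: simps m_assoc)
  qed
  fix x y z assume "x \<in> carrier (TotQ R)" "y \<in> carrier (TotQ R)" "z \<in> carrier (TotQ R)"
  then obtain a s b t c u where *: "a \<in> carrier R" "nzd R s" "x = frac R a s" "b \<in> carrier R" "nzd R t" "y = frac R b t"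
    "c \<in> carrier R" "nzd R u" "z = frac R c u" by (metis TotQ_E)
  then have car: "s \<in> carrier R" "t \<in> carrier R" "u \<in> carrier R" using nzdD by auto
  show "(x \<oplus>\<^bsub>TotQ R\<^esub> y) \<otimes>\<^bsub>TotQ R\<^esub> z = x \<otimes>\<^bsub>TotQ R\<^esub> z \<oplus>\<^bsub>TotQ R\<^esub> y \<otimes>\<^bsub>TotQ R\<^esub> z"
  proof -
    have "(a \<otimes> t \<oplus> b \<otimes> s) \<otimes> c \<otimes> u = (a \<otimes> c) \<otimes> (t \<otimes> u) \<oplus> (b \<otimes> c) \<otimes> (s \<otimes> u)"
      using *(1,4,7) car by (simp only: l_distr m_closed) (simp add: m_ac)
    \<comment> \<open>The two sides of the distributive law have denominators \<open>stu\<close> and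
      \<open>(su)(tu)\<close>; the first fraction is expanded by \<open>u\<close>.\<close>
    moreover have "frac R ((a \<otimes> t \<oplus> b \<otimes> s) \<otimes> c) ((s \<otimes> t) \<otimes> u) =
        frac R (((a \<otimes> t \<oplus> b \<otimes> s) \<otimes> c) \<otimes> u) (((s \<otimes> t) \<otimes> u) \<otimes> u)"
      by (rule frac_cancel[symmetric]) (use * car in \<open>simp_all add: nzd_mult\<close>)
    moreover have "((s \<otimes> t) \<otimes> u) \<otimes> u = (s \<otimes> u) \<otimes> (t \<otimes> u)" using car by (simp add: m_ac)
    ultimately show ?thesis using * car by (simp add: simps)
  qed
qed

lemma qemb_hom: "qemb R \<in> ring_hom R (TotQ R)"
  unfolding qemb_def
  by (rule ring_hom_memI) (simp_all add: TotQ_one TotQ_mult TotQ_add nzd_one frac_in)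

lemma qemb_inj: "inj_on (qemb R) (carrier R)"
  unfolding qemb_def inj_on_def by (simp add: frac_eq nzd_one)

lemma qemb_inverse: assumes "nzd R s" shows "qemb R s \<otimes>\<^bsub>TotQ R\<^esub> frac R \<one> s = \<one>\<^bsub>TotQ R\<^esub>"
  using assms nzdD[OF assms] unfolding qemb_def by (simp add: TotQ_mult TotQ_one frac_eq nzd_one)

lemma frac_qemb: assumes "nzd R s" "a \<in> carrier R"
  shows "qemb R s \<otimes>\<^bsub>TotQ R\<^esub> frac R a s = qemb R a"
proof -
  have "s \<in> carrier R" by (rule nzdD[OF assms(1)])
  then show ?thesis using assms unfolding qemb_def by (simp add: TotQ_mult frac_eq nzd_one m_comm)
qed

lemma nzd_qemb_unit:
  assumes "s \<in> carrier R" "q \<in> carrier (TotQ R)" "qemb R s \<otimes>\<^bsub>TotQ R\<^esub> q = \<one>\<^bsub>TotQ R\<^esub>" shows "nzd R s"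
proof -
  obtain a t where q: "a \<in> carrier R" "nzd R t" "q = frac R a t" by (rule TotQ_E[OF assms(2)])
  have t: "t \<in> carrier R" by (rule nzdD[OF q(2)])
  have "frac R (s \<otimes> a) t = frac R \<one> \<one>" using assms q t unfolding qemb_def by (simp add: TotQ_mult TotQ_one nzd_one)
  then have "s \<otimes> a = t" using assms q t by (simp add: frac_eq nzd_one)
  then show ?thesis using nzd_factor[of s a] assms(1) q(1,2) by simp
qed

lemma nzd_TotQ_unit:
  assumes "nzd (TotQ R) q" shows "\<exists>q'\<in>carrier (TotQ R). q \<otimes>\<^bsub>TotQ R\<^esub> q' = \<one>\<^bsub>TotQ R\<^esub>"
proof -
  have "q \<in> carrier (TotQ R)" using assms by (simp add: nzd_def)
  then obtain a t where q: "a \<in> carrier R" "nzd R t" "q = frac R a t" by (rule TotQ_E)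
  have t: "t \<in> carrier R" by (rule nzdD[OF q(2)])
  have "y = \<zero>" if y: "y \<in> carrier R" "a \<otimes> y = \<zero>" for y
  proof -
    have "q \<otimes>\<^bsub>TotQ R\<^esub> frac R y \<one> = \<zero>\<^bsub>TotQ R\<^esub>" using q t y by (simp add: TotQ_mult TotQ_zero frac_eq nzd_one)
    then have "frac R y \<one> = \<zero>\<^bsub>TotQ R\<^esub>" using assms frac_in[OF y(1) nzd_one] by (simp add: nzd_def)
    then show ?thesis using y by (simp add: TotQ_zero frac_eq nzd_one)
  qed
  then have a: "nzd R a" using q(1) by (simp add: nzd_def)
  have "q \<otimes>\<^bsub>TotQ R\<^esub> frac R t a = \<one>\<^bsub>TotQ R\<^esub>"
    using q t a by (simp add: TotQ_mult TotQ_one frac_eq nzd_one nzd_mult m_comm)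
  then show ?thesis using frac_in[OF t a] by blast
qed

end

lemma (in dim1_local) m_carrier: "m \<in> carrier R" by (rule nzdD[OF nzd_m])

text \<open>Every commutative ring is an image of a ring of integral polynomials, which is a type-class ring.\<close>

lemma (in cring) presentation:
  obtains \<phi> :: "('a multiset \<Rightarrow>\<^sub>0 int) \<Rightarrow> 'a"
  where "\<And>x y. \<phi> (x + y) = \<phi> x \<oplus> \<phi> y" "\<And>x y. \<phi> (x * y) = \<phi> x \<otimes> \<phi> y" "\<phi> 1 = \<one>"
    "\<And>x. \<phi> x \<in> carrier R" "\<And>a. a \<in> carrier R \<Longrightarrow> \<exists>x. \<phi> x = a"
proof -
  \<comment> \<open>Replacing elements outside the carrier by zero makes the fold step left
    commutative on the whole type, as folding over multisets requires.\<close>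
  define e where "e = (\<lambda>x. if x \<in> carrier R then x else \<zero>)"
  have e: "e x \<in> carrier R" for x by (simp add: e_def)
  define \<mu> where "\<mu> = fold_mset (\<lambda>x y. e x \<otimes> e y) \<one>"
  interpret comp_fun_commute "\<lambda>x y. e x \<otimes> e y"
    by standard (auto simp: fun_eq_iff e_def m_lcomm)
  have closed: "\<mu> A \<in> carrier R" for A
    by (induction A) (simp_all add: \<mu>_def e)
  have add: "\<mu> (add_mset x A) = e x \<otimes> \<mu> A" for x A
  proof -
    have "\<mu> (add_mset x A) = e x \<otimes> e (\<mu> A)" by (simp add: \<mu>_def)
    moreover have "e (\<mu> A) = \<mu> A" unfolding e_def by (rule if_P[OF closed])
    ultimately show ?thesis by simp
  qed
  have mult: "\<mu> (A + B) = \<mu> A \<otimes> \<mu> B" for A B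
    by (induction A) (simp_all add: add closed e m_assoc, simp add: \<mu>_def closed[unfolded \<mu>_def])
  \<comment> \<open>Additively the polynomial ring is free abelian on the monomials, which are
    multisets of variables. So the values \<open>\<mu> A\<close> extend to an additive map, whose
    multiplicativity has to be checked on monomials only.\<close>
  obtain \<phi> where \<phi>: "\<phi> \<in> hom (free_Abelian_group UNIV) (add_monoid R)" "\<And>A. \<phi> (frag_of A) = \<mu> A"
    using comm_group.free_Abelian_group_universal[OF a_comm_group, of \<mu> UNIV] closed
    by (metis UNIV_I image_subsetI partial_object.select_convs(1))
  have c: "\<phi> x \<in> carrier R" for x using \<phi>(1) by (auto simp: hom_def)
  have p: "\<phi> (x + y) = \<phi> x \<oplus> \<phi> y" for x y using \<phi>(1) by (simp add: hom_def)
  have z: "\<phi> 0 = \<zero>" using p[of 0 0] c[of 0] by simp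
  have d: "\<phi> (x - y) = \<phi> x \<ominus> \<phi> y" for x y
  proof -
    have "\<phi> x = \<phi> (x - y) \<oplus> \<phi> y" using p[of "x - y" y] by simp
    then show ?thesis using c by (simp add: a_minus_def a_assoc r_neg)
  qed
  have m1: "\<phi> (frag_of A * y) = \<mu> A \<otimes> \<phi> y" for A y
    by (rule frag_induction[of y UNIV])
      (simp_all add: mult_single \<phi>(2)[simplified] mult z d closed c right_diff_distrib a_minus_def r_distr r_minus)
  have m: "\<phi> (x * y) = \<phi> x \<otimes> \<phi> y" for x y
    by (rule frag_induction[of x UNIV])
      (simp_all add: m1[simplified] \<phi>(2)[simplified] z d c left_diff_distrib a_minus_def l_distr l_minus)
  have one: "\<phi> 1 = \<one>" using \<phi>(2)[of "{#}"] by (simp add: \<mu>_def single_one[symmetric] del: single_one)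
  have surj: "\<exists>x. \<phi> x = a" if "a \<in> carrier R" for a
  proof -
    have "\<mu> {#a#} = a" using that add[of a "{#}"] by (simp add: e_def) (simp add: \<mu>_def)
    then show ?thesis using \<phi>(2) by metis
  qed
  show ?thesis by (rule that[OF p m one c surj])
qed

section \<open>Maximal ideals and invertible ideals in carrier-based rings\<close>

context cring begin

text \<open>A form without subtraction. The additive inverse of a record depends on its carrier,
  whereas sum and product of \<open>Q\<lparr>carrier := B\<rparr>\<close> are literally those of
  \<open>Q\<close>.\<close>

lemma maximalideal_iff':
  "maximalideal N R \<longleftrightarrow> ideal N R \<and> \<one> \<notin> N \<and> (\<forall>x\<in>carrier R. x \<notin> N \<longrightarrow> (\<exists>b\<in>carrier R. \<exists>n\<in>N. x \<otimes> b = n \<oplus> \<one>))"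
proof -
  have "(x \<otimes> b \<ominus> \<one> \<in> N) = (\<exists>n\<in>N. x \<otimes> b = n \<oplus> \<one>)" if I: "ideal N R" and x: "x \<in> carrier R" "b \<in> carrier R" for x b
  proof
    assume "x \<otimes> b \<ominus> \<one> \<in> N"
    moreover have "x \<otimes> b = (x \<otimes> b \<ominus> \<one>) \<oplus> \<one>" using x by (simp add: a_minus_def a_assoc l_neg)
    ultimately show "\<exists>n\<in>N. x \<otimes> b = n \<oplus> \<one>" by blast
  next
    assume "\<exists>n\<in>N. x \<otimes> b = n \<oplus> \<one>"
    then obtain n where n: "n \<in> N" "x \<otimes> b = n \<oplus> \<one>" by blast
    moreover have "n \<in> carrier R" using n idealD(1)[OF I] by blast
    ultimately have "x \<otimes> b \<ominus> \<one> = n" by (simp add: a_minus_def a_assoc r_neg)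
    then show "x \<otimes> b \<ominus> \<one> \<in> N" using n by simp
  qed
  then show ?thesis unfolding maximalideal_iff by (simp cong: conj_cong)
qed

text \<open>An element outside all maximal ideals generates the unit ideal. A nonzero ring has a
  maximal ideal; if it is the only one, it is taken twice.\<close>

lemma at_most_two_cover:
  assumes "at_most_two_max R" "\<one> \<noteq> \<zero>"
  shows "\<exists>P P'. maximalideal P R \<and> maximalideal P' R \<and> (\<forall>x\<in>carrier R. x \<notin> P \<longrightarrow> x \<notin> P' \<longrightarrow> (\<exists>y\<in>carrier R. x \<otimes> y = \<one>))"
proof -
  let ?A = "{P. maximalideal P R}"
  have fin: "finite ?A" "card ?A \<le> 2" using assms unfolding at_most_two_max_def by auto
  have "\<one> \<notin> {\<zero>}" using assms by simp
  then have ne: "?A \<noteq> {}" using in_maximal_ideal[OF zeroideal] by blast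
  have "\<exists>P P'. ?A = {P, P'}"
  proof -
    have "card ?A \<noteq> 0" using fin ne by simp
    then consider "card ?A = 1" | "card ?A = 2" using fin by linarith
    then show ?thesis
    proof cases
      case 1 then obtain P where "?A = {P}" by (rule card_1_singletonE)
      then have "?A = {P, P}" by simp
      then show ?thesis by blast
    next
      case 2 then show ?thesis unfolding card_2_iff by blast
    qed
  qed
  then obtain P P' where A: "?A = {P, P'}" by blast
  have "\<exists>y\<in>carrier R. x \<otimes> y = \<one>" if x: "x \<in> carrier R" "x \<notin> P" "x \<notin> P'" for x
  proof (rule ccontr)
    assume no: "\<not> ?thesis"
    have "\<one> \<notin> PIdl x"
    proof
      assume "\<one> \<in> PIdl x"
      then obtain y where "y \<in> carrier R" "\<one> = y \<otimes> x" unfolding cgenideal_def by blast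
      then have "x \<otimes> y = \<one>" using x m_comm[of x y] by simp
      then show False using no \<open>y \<in> carrier R\<close> by blast
    qed
    then obtain L where "maximalideal L R" "PIdl x \<subseteq> L" using in_maximal_ideal[OF cgenideal_ideal[OF x(1)]] by blast
    then have "L \<in> {P, P'}" "x \<in> L" using A cgenideal_self[OF x(1)] by auto
    then show False using x by blast
  qed
  then show ?thesis using A by blast
qed

lemma at_most_two_maxI:
  assumes "\<And>P P' P''. maximalideal P R \<Longrightarrow> maximalideal P' R \<Longrightarrow> maximalideal P'' R \<Longrightarrow> P \<noteq> P' \<Longrightarrow> P \<noteq> P'' \<Longrightarrow> P' \<noteq> P'' \<Longrightarrow> False"
  shows "at_most_two_max R"
proof (rule ccontr)
  let ?A = "{P. maximalideal P R}"
  assume "\<not> at_most_two_max R"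
  then have "infinite ?A \<or> 3 \<le> card ?A" unfolding at_most_two_max_def by auto
  then obtain B where "B \<subseteq> ?A" "card B = 3" by (metis infinite_arbitrarily_large obtain_subset_with_card_n)
  then obtain P P' P'' where "{P, P', P''} \<subseteq> ?A" "P \<noteq> P'" "P \<noteq> P''" "P' \<noteq> P''" unfolding card_3_iff by blast
  then show False using assms[of P P' P''] by simp
qed

text \<open>The inverse is \<open>x^-1 R\<close>. Since \<open>prodset\<close> consists of finite
  sums, one inclusion follows from closure of \<open>R\<close> under addition, and the other needs a
  single summand.\<close>

lemma invertible_ideal_principal:
  assumes I: "ideal I R" and x: "x \<in> I" "nzd R x" and gen: "\<And>i. i \<in> I \<Longrightarrow> \<exists>a\<in>carrier R. i = x \<otimes> a"
  shows "invertible_ideal R I"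
proof -
  interpret Q: cring "TotQ R" by (rule cring_TotQ)
  interpret h: ring_hom_cring R "TotQ R" "qemb R"
    by (rule ring_hom_cringI) (use qemb_hom cring_axioms Q.cring_axioms in auto)
  define K where "K = {frac R a x | a. a \<in> carrier R}"
  have xR: "x \<in> carrier R" by (rule nzdD[OF x(2)])
  have KQ: "K \<subseteq> carrier (TotQ R)" unfolding K_def using frac_in x by blast
  have "\<forall>a\<in>Rin R. \<forall>k\<in>K. a \<otimes>\<^bsub>TotQ R\<^esub> k \<in> K"
  proof (intro ballI)
    fix r k assume "r \<in> Rin R" "k \<in> K"
    then obtain a b where ab: "a \<in> carrier R" "b \<in> carrier R" "r = frac R a \<one>" "k = frac R b x"
      unfolding K_def Rin_def qemb_def by blast
    then have "r \<otimes>\<^bsub>TotQ R\<^esub> k = frac R (a \<otimes> b) x" using x xR by (simp add: TotQ_mult nzd_one)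
    then show "r \<otimes>\<^bsub>TotQ R\<^esub> k \<in> K" unfolding K_def using ab by blast
  qed
  moreover have "\<forall>k\<in>K. \<forall>k'\<in>K. k \<oplus>\<^bsub>TotQ R\<^esub> k' \<in> K"
  proof (intro ballI)
    fix k k' assume "k \<in> K" "k' \<in> K"
    then obtain a b where ab: "a \<in> carrier R" "b \<in> carrier R" "k = frac R a x" "k' = frac R b x" unfolding K_def by blast
    have "k \<oplus>\<^bsub>TotQ R\<^esub> k' = frac R ((a \<oplus> b) \<otimes> x) (x \<otimes> x)"
      using ab x xR by (simp add: TotQ_add l_distr)
    also have "\<dots> = frac R (a \<oplus> b) x" using ab x by (intro frac_cancel) auto
    finally show "k \<oplus>\<^bsub>TotQ R\<^esub> k' \<in> K" unfolding K_def using ab by blast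
  qed
  moreover have "prodset (TotQ R) (qemb R ` I) K = Rin R"
  proof
    have prod: "y \<otimes>\<^bsub>TotQ R\<^esub> k \<in> Rin R" if yk: "y \<in> qemb R ` I" "k \<in> K" for y k
    proof -
      obtain i a where i: "i \<in> I" "y = qemb R i" "a \<in> carrier R" "k = frac R a x" using yk unfolding K_def by blast
      then obtain b where b: "b \<in> carrier R" "i = x \<otimes> b" using gen by blast
      have "y \<otimes>\<^bsub>TotQ R\<^esub> k = frac R ((b \<otimes> a) \<otimes> x) (\<one> \<otimes> x)"
        unfolding i b(2) qemb_def using i b x xR by (simp add: TotQ_mult nzd_one m_ac)
      also have "\<dots> = frac R (b \<otimes> a) \<one>" using i b x by (intro frac_cancel nzd_one) auto
      finally show ?thesis unfolding Rin_def qemb_def using b i by blast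
    qed
    have RQ: "Rin R \<subseteq> carrier (TotQ R)" unfolding Rin_def by auto
    show "prodset (TotQ R) (qemb R ` I) K \<subseteq> Rin R"
    proof
      fix z assume "z \<in> prodset (TotQ R) (qemb R ` I) K"
      then obtain n :: nat and y k where *: "\<And>i. i < n \<Longrightarrow> y i \<in> qemb R ` I \<and> k i \<in> K"
        "z = (\<Oplus>\<^bsub>TotQ R\<^esub> i\<in>{..<n}. y i \<otimes>\<^bsub>TotQ R\<^esub> k i)" unfolding prodset_def by blast
      have "(\<Oplus>\<^bsub>TotQ R\<^esub> i\<in>{..<l}. y i \<otimes>\<^bsub>TotQ R\<^esub> k i) \<in> Rin R" if "l \<le> n" for l
        using that
      proof (induction l)
        case 0
        have "\<zero>\<^bsub>TotQ R\<^esub> \<in> Rin R" unfolding Rin_def using h.hom_zero by (metis imageI zero_closed)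
        then show ?case by simp
      next
        case (Suc l)
        have c: "y i \<otimes>\<^bsub>TotQ R\<^esub> k i \<in> Rin R" if "i < n" for i using prod *(1)[OF that] by blast
        then have "(\<Oplus>\<^bsub>TotQ R\<^esub> i\<in>{..<Suc l}. y i \<otimes>\<^bsub>TotQ R\<^esub> k i) =
            y l \<otimes>\<^bsub>TotQ R\<^esub> k l \<oplus>\<^bsub>TotQ R\<^esub> (\<Oplus>\<^bsub>TotQ R\<^esub> i\<in>{..<l}. y i \<otimes>\<^bsub>TotQ R\<^esub> k i)"
          unfolding lessThan_Suc using Suc.prems RQ by (intro Q.finsum_insert funcsetI) auto
        moreover have "u \<oplus>\<^bsub>TotQ R\<^esub> v \<in> Rin R" if uv: "u \<in> Rin R" "v \<in> Rin R" for u v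
        proof -
          obtain a b where ab: "a \<in> carrier R" "b \<in> carrier R" "u = qemb R a" "v = qemb R b"
            using uv unfolding Rin_def by blast
          then have "u \<oplus>\<^bsub>TotQ R\<^esub> v = qemb R (a \<oplus> b)" by simp
          then show ?thesis unfolding Rin_def using ab by blast
        qed
        ultimately show ?case using c[of l] Suc by simp
      qed
      then show "z \<in> Rin R" using * by blast
    qed
    show "Rin R \<subseteq> prodset (TotQ R) (qemb R ` I) K"
    proof
      fix z assume "z \<in> Rin R"
      then obtain a where a: "a \<in> carrier R" "z = qemb R a" unfolding Rin_def by blast
      have "z = (\<Oplus>\<^bsub>TotQ R\<^esub> i\<in>{..<1::nat}. qemb R x \<otimes>\<^bsub>TotQ R\<^esub> frac R a x)"
        using a x frac_qemb[OF x(2) a(1)] h.hom_closed[OF a(1)] by (simp add: lessThan_Suc)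
      moreover have "qemb R x \<in> qemb R ` I" "frac R a x \<in> K" unfolding K_def using x a by auto
      ultimately show "z \<in> prodset (TotQ R) (qemb R ` I) K" unfolding prodset_def
        by (intro CollectI exI[of _ "1::nat"] exI[of _ "\<lambda>_. qemb R x"] exI[of _ "\<lambda>_. frac R a x"]) simp
    qed
  qed
  ultimately show ?thesis unfolding invertible_ideal_def using KQ by (intro exI[of _ K]) simp
qed

end

section \<open>Rings presented by a type-class ring\<close>

locale presented = cring Q for Q :: "('q, 'c) ring_scheme" (structure) +
  fixes \<phi> :: "'f::comm_ring_1 \<Rightarrow> 'q"
  assumes \<phi>_add: "\<phi> (x + y) = \<phi> x \<oplus> \<phi> y" and \<phi>_mult: "\<phi> (x * y) = \<phi> x \<otimes> \<phi> y" and \<phi>_one: "\<phi> 1 = \<one>"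
    and \<phi>_closed [simp]: "\<phi> x \<in> carrier Q" and \<phi>_surj: "a \<in> carrier Q \<Longrightarrow> \<exists>x. \<phi> x = a"
begin

lemma \<phi>_zero: "\<phi> 0 = \<zero>" using \<phi>_add[of 0 0] \<phi>_closed[of 0] by simp

lemma \<phi>_minus: "\<phi> (- x) = \<ominus> \<phi> x"
  using \<phi>_add[of "- x" x] by (simp add: \<phi>_zero sum_zero_eq_neg)

lemma \<phi>_diff: "\<phi> (x - y) = \<phi> x \<ominus> \<phi> y"
  using \<phi>_add[of x "- y"] by (simp add: \<phi>_minus a_minus_def)

lemma \<phi>_power: "\<phi> (x ^ n) = \<phi> x [^] n"
  by (induction n) (simp_all add: \<phi>_one \<phi>_mult m_comm)

lemmas \<phi>_simps = \<phi>_add \<phi>_mult \<phi>_one \<phi>_zero \<phi>_minus \<phi>_diff \<phi>_power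

lemma \<phi>_eq: "\<phi> (x - y) = \<zero> \<longleftrightarrow> \<phi> x = \<phi> y"
  by (simp add: \<phi>_diff)

definition pull :: "'q set \<Rightarrow> 'f set" where "pull Y = {x. \<phi> x \<in> Y}"

lemma pull_mem [simp]: "x \<in> pull Y \<longleftrightarrow> \<phi> x \<in> Y" by (simp add: pull_def)

lemma pull_subset: "Y \<subseteq> Z \<Longrightarrow> pull Y \<subseteq> pull Z" by (auto simp: pull_def)

lemma image_pull: "Y \<subseteq> carrier Q \<Longrightarrow> \<phi> ` pull Y = Y"
  using \<phi>_surj unfolding pull_def by (auto simp: image_iff)

lemma pull_inj: "Y \<subseteq> carrier Q \<Longrightarrow> Z \<subseteq> carrier Q \<Longrightarrow> pull Y \<subseteq> pull Z \<Longrightarrow> Y \<subseteq> Z"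
  using image_pull image_mono by metis

lemma sgrp_pull:
  assumes "Y \<subseteq> carrier Q" "\<zero> \<in> Y" "\<And>a b. a \<in> Y \<Longrightarrow> b \<in> Y \<Longrightarrow> a \<oplus> b \<in> Y" "\<And>a. a \<in> Y \<Longrightarrow> \<ominus> a \<in> Y"
  shows "sgrp (pull Y)"
  using assms by (intro sgrpI) (simp_all add: \<phi>_zero \<phi>_diff a_minus_def)

lemma mults_pull: assumes "Y \<subseteq> carrier Q" shows "mults (pull Y) = pull (Eset Q Y)"
proof -
  have "(\<forall>k. \<phi> k \<in> Y \<longrightarrow> \<phi> q \<otimes> \<phi> k \<in> Y) \<longleftrightarrow> (\<forall>y\<in>Y. \<phi> q \<otimes> y \<in> Y)" for q
    using \<phi>_surj assms by (metis subsetD)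
  then show ?thesis unfolding mults_def pull_def Eset_def by (auto simp: \<phi>_mult)
qed

lemma finsum_in:
  fixes n :: nat
  assumes "Y \<subseteq> carrier Q" "\<zero> \<in> Y" "\<And>a b. a \<in> Y \<Longrightarrow> b \<in> Y \<Longrightarrow> a \<oplus> b \<in> Y" "\<And>i. i < n \<Longrightarrow> f i \<in> Y"
  shows "(\<Oplus>i\<in>{..<n}. f i) \<in> Y"
proof -
  have "(\<Oplus>i\<in>{..<l}. f i) \<in> Y" if "l \<le> n" for l
    using that
  proof (induction l)
    case (Suc l)
    have "f i \<in> carrier Q" if "i < n" for i using assms(1) assms(4)[OF that] by blast
    then have "(\<Oplus>i\<in>{..<Suc l}. f i) = f l \<oplus> (\<Oplus>i\<in>{..<l}. f i)"
      unfolding lessThan_Suc using Suc.prems by (intro finsum_insert funcsetI) auto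
    then show ?case using assms(3)[OF assms(4)[of l] Suc.IH] Suc.prems by simp
  qed (use assms(2) in simp)
  then show ?thesis by simp
qed

end

lemma (in cring) presented_TotQ:
  obtains \<phi> :: "((('a \<times> 'a) set) multiset \<Rightarrow>\<^sub>0 int) \<Rightarrow> ('a \<times> 'a) set" where "presented (TotQ R) \<phi>"
proof -
  interpret Q: cring "TotQ R" by (rule cring_TotQ)
  obtain \<phi> :: "((('a \<times> 'a) set) multiset \<Rightarrow>\<^sub>0 int) \<Rightarrow> ('a \<times> 'a) set"
    where *: "\<And>x y. \<phi> (x + y) = \<phi> x \<oplus>\<^bsub>TotQ R\<^esub> \<phi> y" "\<And>x y. \<phi> (x * y) = \<phi> x \<otimes>\<^bsub>TotQ R\<^esub> \<phi> y" "\<phi> 1 = \<one>\<^bsub>TotQ R\<^esub>"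
    "\<And>x. \<phi> x \<in> carrier (TotQ R)" "\<And>a. a \<in> carrier (TotQ R) \<Longrightarrow> \<exists>x. \<phi> x = a"
    by (rule Q.presentation) (rule that, assumption+)
  have "presented (TotQ R) \<phi>" by (unfold_locales) (rule *; assumption)+
  then show ?thesis by (rule that)
qed

context cring begin

lemma ring_hom_qemb: "ring_hom_cring R (TotQ R) (qemb R)"
  by (rule ring_hom_cringI) (use qemb_hom cring_axioms cring_TotQ in auto)

lemma qemb_ideal:
  assumes "ideal I R"
  shows "qemb R ` I \<subseteq> carrier (TotQ R)" "\<zero>\<^bsub>TotQ R\<^esub> \<in> qemb R ` I"
    "\<And>a b. a \<in> qemb R ` I \<Longrightarrow> b \<in> qemb R ` I \<Longrightarrow> a \<oplus>\<^bsub>TotQ R\<^esub> b \<in> qemb R ` I"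
    "\<And>a. a \<in> qemb R ` I \<Longrightarrow> \<ominus>\<^bsub>TotQ R\<^esub> a \<in> qemb R ` I"
    "\<And>a r. a \<in> qemb R ` I \<Longrightarrow> r \<in> Rin R \<Longrightarrow> r \<otimes>\<^bsub>TotQ R\<^esub> a \<in> qemb R ` I"
proof -
  interpret h: ring_hom_cring R "TotQ R" "qemb R" by (rule ring_hom_qemb)
  note ID = idealD[OF assms]
  have c: "a \<in> carrier R" if "a \<in> I" for a using that ID by blast
  show "qemb R ` I \<subseteq> carrier (TotQ R)" using c by auto
  show "\<zero>\<^bsub>TotQ R\<^esub> \<in> qemb R ` I" using ID(2) h.hom_zero by (metis imageI)
  show "a \<oplus>\<^bsub>TotQ R\<^esub> b \<in> qemb R ` I" if ab: "a \<in> qemb R ` I" "b \<in> qemb R ` I" for a b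
  proof -
    obtain x y where "x \<in> I" "y \<in> I" "a = qemb R x" "b = qemb R y" using ab by blast
    then show ?thesis using ID(3)[of x y] c by (intro image_eqI[of _ _ "x \<oplus> y"]) simp_all
  qed
  show "\<ominus>\<^bsub>TotQ R\<^esub> a \<in> qemb R ` I" if a: "a \<in> qemb R ` I" for a
  proof -
    obtain x where "x \<in> I" "a = qemb R x" using a by blast
    then show ?thesis using ID(5)[of x] c by (intro image_eqI[of _ _ "\<ominus> x"]) simp_all
  qed
  show "r \<otimes>\<^bsub>TotQ R\<^esub> a \<in> qemb R ` I" if ra: "a \<in> qemb R ` I" "r \<in> Rin R" for a r
  proof -
    obtain x y where "x \<in> I" "y \<in> carrier R" "a = qemb R x" "r = qemb R y" using ra unfolding Rin_def by blast
    then show ?thesis using ID(6)[of x y] c by (intro image_eqI[of _ _ "y \<otimes> x"]) simp_all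
  qed
qed


text \<open>For each of \<open>P\<close> and \<open>P'\<close> some product of an element of
  \<open>I\<close> with one of the inverse avoids it, and then one product avoids both and is a unit
  of \<open>R\<close>. The argument runs in a presentation of Q(R), where the type-class lemma on
  products applies.\<close>

lemma invertible_imp_principal:
  assumes I: "ideal I R" "invertible_ideal R I" and P: "maximalideal P R" "maximalideal P' R"
    and cover: "\<And>x. x \<in> carrier R \<Longrightarrow> x \<notin> P \<Longrightarrow> x \<notin> P' \<Longrightarrow> \<exists>y\<in>carrier R. x \<otimes> y = \<one>"
  shows "\<exists>x\<in>I. nzd R x \<and> (\<forall>i\<in>I. \<exists>a\<in>carrier R. i = x \<otimes> a)"
proof -
  let ?Q = "TotQ R"
  obtain \<phi> :: "((('a \<times> 'a) set) multiset \<Rightarrow>\<^sub>0 int) \<Rightarrow> ('a \<times> 'a) set" where "presented ?Q \<phi>" by (rule presented_TotQ)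
  then interpret p: presented ?Q \<phi> .
  interpret h: ring_hom_cring R ?Q "qemb R" by (rule ring_hom_qemb)
  have PI: "ideal P R" "ideal P' R" "\<one> \<notin> P" "\<one> \<notin> P'" using P maximalideal_iff by auto
  note RQ = qemb_ideal[OF oneideal, folded Rin_def] and IQ = qemb_ideal[OF I(1)]
  note PQ = qemb_ideal[OF PI(1)] and PQ' = qemb_ideal[OF PI(2)]
  have one: "\<one>\<^bsub>?Q\<^esub> \<in> Rin R" unfolding Rin_def using h.hom_one by (metis imageI one_closed)
  have notin: "\<one>\<^bsub>?Q\<^esub> \<notin> qemb R ` L" if "ideal L R" "\<one> \<notin> L" for L
  proof
    assume "\<one>\<^bsub>?Q\<^esub> \<in> qemb R ` L"
    then obtain l where "l \<in> L" "qemb R \<one> = qemb R l" by auto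
    moreover have "l \<in> carrier R" using idealD(1)[OF that(1)] calculation by blast
    ultimately have "\<one> = l" using inj_onD[OF qemb_inj] by blast
    then show False using that \<open>l \<in> L\<close> by simp
  qed
  from I(2) obtain K where K': "K \<subseteq> carrier ?Q \<and> (\<forall>a\<in>Rin R. \<forall>k\<in>K. a \<otimes>\<^bsub>?Q\<^esub> k \<in> K) \<and>
      (\<forall>k\<in>K. \<forall>k'\<in>K. k \<oplus>\<^bsub>?Q\<^esub> k' \<in> K) \<and> prodset ?Q (qemb R ` I) K = Rin R"
    unfolding invertible_ideal_def by (rule exE)
  have K: "K \<subseteq> carrier ?Q" "\<And>a k. a \<in> Rin R \<Longrightarrow> k \<in> K \<Longrightarrow> a \<otimes>\<^bsub>?Q\<^esub> k \<in> K"
    "\<And>k k'. k \<in> K \<Longrightarrow> k' \<in> K \<Longrightarrow> k \<oplus>\<^bsub>?Q\<^esub> k' \<in> K" "prodset ?Q (qemb R ` I) K = Rin R"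
    using K' by simp_all
  have prod: "x \<otimes>\<^bsub>?Q\<^esub> k \<in> Rin R" if "x \<in> qemb R ` I" "k \<in> K" for x k
  proof -
    have "x \<otimes>\<^bsub>?Q\<^esub> k = (\<Oplus>\<^bsub>?Q\<^esub> i\<in>{..<1::nat}. x \<otimes>\<^bsub>?Q\<^esub> k)"
      using that K(1) IQ(1) by (simp add: lessThan_Suc subset_iff)
    then have "x \<otimes>\<^bsub>?Q\<^esub> k \<in> prodset ?Q (qemb R ` I) K" unfolding prodset_def using that
      by (intro CollectI exI[of _ "1::nat"] exI[of _ "\<lambda>_. x"] exI[of _ "\<lambda>_. k"]) simp
    then show ?thesis using K(4) by simp
  qed
  have nz: "\<exists>x\<in>qemb R ` I. \<exists>k\<in>K. x \<otimes>\<^bsub>?Q\<^esub> k \<notin> qemb R ` L" if L: "ideal L R" "\<one> \<notin> L" for L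
  proof (rule ccontr)
    assume no: "\<not> ?thesis"
    note LQ = qemb_ideal[OF L(1)]
    have "\<one>\<^bsub>?Q\<^esub> \<in> prodset ?Q (qemb R ` I) K" using K(4) one by simp
    then obtain n :: nat and x k where *: "\<And>i. i < n \<Longrightarrow> x i \<in> qemb R ` I \<and> k i \<in> K"
      "\<one>\<^bsub>?Q\<^esub> = (\<Oplus>\<^bsub>?Q\<^esub> i\<in>{..<n}. x i \<otimes>\<^bsub>?Q\<^esub> k i)" unfolding prodset_def by blast
    have "x i \<otimes>\<^bsub>?Q\<^esub> k i \<in> qemb R ` L" if "i < n" for i using no *(1)[OF that] by blast
    then have "(\<Oplus>\<^bsub>?Q\<^esub> i\<in>{..<n}. x i \<otimes>\<^bsub>?Q\<^esub> k i) \<in> qemb R ` L" by (intro p.finsum_in LQ(1-3))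
    then show False using notin[OF L] *(2) by simp
  qed
  obtain x k where xk: "x \<in> qemb R ` I" "k \<in> K" "x \<otimes>\<^bsub>?Q\<^esub> k \<notin> qemb R ` P" using nz[OF PI(1,3)] by blast
  obtain x' k' where xk': "x' \<in> qemb R ` I" "k' \<in> K" "x' \<otimes>\<^bsub>?Q\<^esub> k' \<notin> qemb R ` P'" using nz[OF PI(2,4)] by blast
  \<comment> \<open>The inverse is only known to be closed under sums and multiples from
    \<open>R\<close>. Negatives come from multiplication by -1, and zero is then
    \<open>k - k\<close> for the element \<open>k\<close> at hand.\<close>
  have mone: "\<ominus>\<^bsub>?Q\<^esub> \<one>\<^bsub>?Q\<^esub> \<in> Rin R" using RQ(4)[OF one] .
  have Km: "\<ominus>\<^bsub>?Q\<^esub> a \<in> K" if "a \<in> K" for a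
  proof -
    have "a \<in> carrier ?Q" using that K(1) by blast
    then have "\<ominus>\<^bsub>?Q\<^esub> a = (\<ominus>\<^bsub>?Q\<^esub> \<one>\<^bsub>?Q\<^esub>) \<otimes>\<^bsub>?Q\<^esub> a" by (simp add: p.l_minus)
    then show ?thesis using K(2)[OF mone that] by simp
  qed
  have "k \<in> carrier ?Q" using xk K(1) by blast
  then have K0: "\<zero>\<^bsub>?Q\<^esub> \<in> K" using K(3)[OF xk(2) Km[OF xk(2)]] by (simp add: p.r_neg)
  have surj: "\<exists>u. \<phi> u = y" if "y \<in> qemb R ` I \<or> y \<in> K" for y
    using p.\<phi>_surj[of y] that K(1) IQ(1) by auto
  obtain u v where uv: "\<phi> u = x" "\<phi> v = k" using surj xk(1,2) by meson
  obtain u' v' where uv': "\<phi> u' = x'" "\<phi> v' = k'" using surj xk'(1,2) by meson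
  have s: "sgrp (p.pull (qemb R ` I))" "sgrp (p.pull K)" "sgrp (p.pull (qemb R ` P))" "sgrp (p.pull (qemb R ` P'))"
    by (intro p.sgrp_pull IQ(1-4), assumption+) (intro p.sgrp_pull K K0 Km PQ(1-4) PQ'(1-4), assumption+)+
  obtain y z where yz: "y \<in> p.pull (qemb R ` I)" "z \<in> p.pull K" "y * z \<notin> p.pull (qemb R ` P)" "y * z \<notin> p.pull (qemb R ` P')"
    by (rule avoid_two_product[OF s, of u v u' v']) (use xk xk' uv uv' in \<open>simp_all add: p.\<phi>_mult\<close>)
  obtain a where a: "a \<in> I" "\<phi> y = qemb R a" using yz by auto
  have aR: "a \<in> carrier R" using a idealD(1)[OF I(1)] by blast
  have "\<phi> y \<otimes>\<^bsub>?Q\<^esub> \<phi> z \<in> Rin R" using prod yz by simp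
  then obtain w where w: "w \<in> carrier R" "\<phi> y \<otimes>\<^bsub>?Q\<^esub> \<phi> z = qemb R w" unfolding Rin_def by blast
  then have "w \<notin> P" "w \<notin> P'" using yz by (auto simp: p.\<phi>_mult)
  then obtain w' where w': "w' \<in> carrier R" "w \<otimes> w' = \<one>" using cover[OF w(1)] by blast
  have ww: "qemb R w \<otimes>\<^bsub>?Q\<^esub> qemb R w' = \<one>\<^bsub>?Q\<^esub>"
    using h.hom_mult[OF w(1) w'(1)] unfolding w'(2) by simp
  have "qemb R a \<otimes>\<^bsub>?Q\<^esub> (\<phi> z \<otimes>\<^bsub>?Q\<^esub> qemb R w') = \<one>\<^bsub>?Q\<^esub>"
    using ww w w' a aR by (simp add: p.m_assoc[symmetric])
  then have "nzd R a" using nzd_qemb_unit[OF aR, of "\<phi> z \<otimes>\<^bsub>?Q\<^esub> qemb R w'"] w'(1) by simp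
  moreover have "\<exists>b\<in>carrier R. i = a \<otimes> b" if i: "i \<in> I" for i
  proof -
    have iR: "i \<in> carrier R" using i idealD(1)[OF I(1)] by blast
    have "qemb R i \<otimes>\<^bsub>?Q\<^esub> \<phi> z \<in> Rin R" using prod yz i by simp
    then obtain c where c: "c \<in> carrier R" "qemb R i \<otimes>\<^bsub>?Q\<^esub> \<phi> z = qemb R c" unfolding Rin_def by blast
    have "qemb R (a \<otimes> (c \<otimes> w')) = qemb R a \<otimes>\<^bsub>?Q\<^esub> (qemb R c \<otimes>\<^bsub>?Q\<^esub> qemb R w')" using aR c w' by simp
    also have "\<dots> = qemb R i \<otimes>\<^bsub>?Q\<^esub> ((qemb R a \<otimes>\<^bsub>?Q\<^esub> \<phi> z) \<otimes>\<^bsub>?Q\<^esub> qemb R w')"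
      unfolding c(2)[symmetric] using iR aR w' by (simp add: p.m_ac)
    also have "\<dots> = qemb R i" using ww w(2) a(2) iR by simp
    finally have "a \<otimes> (c \<otimes> w') = i" using qemb_inj aR c w' iR unfolding inj_on_def by simp
    then show ?thesis using c w' by (metis m_closed)
  qed
  ultimately show ?thesis using a by blast
qed

end

section \<open>Transfer along the presentation\<close>

locale dim1_pres = dim1_local R M m + Q: presented "TotQ R" \<phi>
  for R :: "('a, 'b) ring_scheme" (structure) and M m and \<phi> :: "'f::comm_ring_1 \<Rightarrow> ('a \<times> 'a) set"
begin

abbreviation Q where "Q \<equiv> TotQ R"
abbreviation "pull \<equiv> Q.pull"

interpretation h: ring_hom_cring R "TotQ R" "qemb R" by (rule ring_hom_qemb)

definition mm where "mm = (SOME x. \<phi> x = qemb R m)"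
definition im where "im = (SOME x. \<phi> x = frac R \<one> m)"

lemma \<phi>_mm: "\<phi> mm = qemb R m" and \<phi>_im: "\<phi> im = frac R \<one> m"
proof -
  have "qemb R m \<in> carrier Q" "frac R \<one> m \<in> carrier Q" using nzdD[OF nzd_m] by (simp_all add: frac_in nzd_m)
  then have "\<exists>x. \<phi> x = qemb R m" "\<exists>x. \<phi> x = frac R \<one> m" using Q.\<phi>_surj by blast+
  then show "\<phi> mm = qemb R m" "\<phi> im = frac R \<one> m" unfolding mm_def im_def
    using someI_ex[of "\<lambda>x. \<phi> x = qemb R m"] someI_ex[of "\<lambda>x. \<phi> x = frac R \<one> m"] by simp_all
qed

lemma Rin_Q: "Rin R \<subseteq> carrier Q" unfolding Rin_def by auto


lemma subr_pull_Rin: "subr (pull (Rin R))"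
proof -
  note * = qemb_ideal[OF oneideal, folded Rin_def]
  have "\<one>\<^bsub>Q\<^esub> \<in> Rin R" unfolding Rin_def using h.hom_one by (metis imageI one_closed)
  then show ?thesis unfolding subr_def using Q.sgrp_pull[OF *(1-4)] *(5) by (simp add: Q.\<phi>_one Q.\<phi>_mult)
qed

lemma qemb_in_M: "a \<in> carrier R \<Longrightarrow> qemb R a \<in> qemb R ` M \<longleftrightarrow> a \<in> M"
  using inj_on_image_mem_iff[OF qemb_inj _ idealD(1)[OF ideal_M]] by blast

lemma denominator_power:
  assumes "q \<in> carrier Q" shows "\<exists>k::nat. \<exists>a\<in>carrier R. qemb R (m [^] k) \<otimes>\<^bsub>Q\<^esub> q = qemb R a"
proof -
  obtain a t where q: "a \<in> carrier R" "nzd R t" "q = frac R a t" by (rule TotQ_E[OF assms])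
  obtain k r where kr: "r \<in> carrier R" "m [^] (k::nat) = r \<otimes> t" using nzd_power[OF q(2) m_M] by blast
  have t: "t \<in> carrier R" by (rule nzdD[OF q(2)])
  have "qemb R (m [^] k) \<otimes>\<^bsub>Q\<^esub> q = qemb R r \<otimes>\<^bsub>Q\<^esub> (qemb R t \<otimes>\<^bsub>Q\<^esub> q)" unfolding kr(2) using kr(1) t assms by (simp add: Q.m_assoc)
  also have "\<dots> = qemb R (r \<otimes> a)" unfolding q(3) frac_qemb[OF q(2,1)] using kr q by simp
  finally show ?thesis using kr(1) q(1) by blast
qed

text \<open>The kernel of \<open>\<phi>\<close> plays the part of \<open>I\<close>. The assumptions
  \<open>denom\<close> and \<open>rad\<close> both rest on \<open>nzd_power\<close>.\<close>

sublocale c: ctx "pull {\<zero>\<^bsub>Q\<^esub>}" "pull (Rin R)" "pull (qemb R ` M)" mm im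
proof
  note Ro = qemb_ideal[OF oneideal, folded Rin_def] and Mo = qemb_ideal[OF ideal_M]
  show "ideal_of UNIV (pull {\<zero>\<^bsub>Q\<^esub>})"
    unfolding ideal_of_def by (auto intro!: sgrpI simp: Q.\<phi>_simps)
  show "subr (pull (Rin R))" by (rule subr_pull_Rin)
  show "pull {\<zero>\<^bsub>Q\<^esub>} \<subseteq> pull (Rin R)" "pull {\<zero>\<^bsub>Q\<^esub>} \<subseteq> pull (qemb R ` M)" using Ro(2) Mo(2) by auto
  have "qemb R ` M \<subseteq> Rin R" unfolding Rin_def using idealD(1)[OF ideal_M] by blast
  then show "ideal_of (pull (Rin R)) (pull (qemb R ` M))"
    unfolding ideal_of_def using Q.sgrp_pull[OF Mo(1-4)] Mo(5) Q.pull_subset by (auto simp: Q.\<phi>_mult)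
  have "qemb R \<one> \<notin> qemb R ` M" using qemb_in_M[OF one_closed] one_M by blast
  then show "1 \<notin> pull (qemb R ` M)" by (simp add: Q.\<phi>_one)
  show "mm \<in> pull (qemb R ` M)" using m_M by (simp add: \<phi>_mm)
  show "mm * im - 1 \<in> pull {\<zero>\<^bsub>Q\<^esub>}"
    using qemb_inverse[OF nzd_m] by (simp add: Q.\<phi>_mult Q.\<phi>_one \<phi>_mm \<phi>_im Q.\<phi>_eq)
  show "\<exists>s\<in>pull (Rin R). r * s - 1 \<in> pull {\<zero>\<^bsub>Q\<^esub>}" if r: "r \<in> pull (Rin R)" "r \<notin> pull (qemb R ` M)" for r
  proof -
    obtain a where a: "a \<in> carrier R" "\<phi> r = qemb R a" using r(1) unfolding Rin_def by auto
    then have "a \<in> Units R" using unit_R r(2) by auto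
    then obtain b where b: "b \<in> carrier R" "a \<otimes> b = \<one>" unfolding Units_def by blast
    obtain s where s: "\<phi> s = qemb R b" using Q.\<phi>_surj[of "qemb R b"] b by auto
    have "qemb R a \<otimes>\<^bsub>Q\<^esub> qemb R b = \<one>\<^bsub>Q\<^esub>" using h.hom_mult[OF a(1) b(1)] unfolding b(2) by simp
    then show ?thesis using s b a unfolding Rin_def by (intro bexI[of _ s]) (auto simp: Q.\<phi>_eq Q.\<phi>_mult Q.\<phi>_one)
  qed
  show "\<exists>k. mm ^ k * q \<in> pull (Rin R)" for q
  proof -
    obtain k :: nat and a where "a \<in> carrier R" "qemb R (m [^] k) \<otimes>\<^bsub>Q\<^esub> \<phi> q = qemb R a"
      using denominator_power[OF Q.\<phi>_closed] by blast
    then show ?thesis unfolding Rin_def using m_carrier by (intro exI[of _ k]) (simp add: Q.\<phi>_mult Q.\<phi>_power \<phi>_mm)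
  qed
  show "\<exists>k. im * x ^ k \<in> pull (Rin R)" if x: "x \<in> pull (qemb R ` M)" for x
  proof -
    obtain a where a: "a \<in> M" "\<phi> x = qemb R a" using x by auto
    obtain k r where kr: "r \<in> carrier R" "a [^] (k::nat) = r \<otimes> m" using nzd_power[OF nzd_m a(1)] by blast
    have aR: "a \<in> carrier R" using a idealD(1)[OF ideal_M] by blast
    have "\<phi> (im * x ^ k) = frac R \<one> m \<otimes>\<^bsub>Q\<^esub> qemb R (a [^] k)"
      using a aR by (simp add: Q.\<phi>_mult Q.\<phi>_power \<phi>_im)
    also have "\<dots> = qemb R r \<otimes>\<^bsub>Q\<^esub> (qemb R m \<otimes>\<^bsub>Q\<^esub> frac R \<one> m)"
      unfolding kr(2) using kr(1) m_carrier frac_in[OF one_closed nzd_m] by (simp add: Q.m_ac)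
    also have "\<dots> = qemb R r" using kr(1) qemb_inverse[OF nzd_m] by simp
    finally show ?thesis unfolding Rin_def using kr by (intro exI[of _ k]) simp
  qed
qed

lemma cong_iff: "c.cong x y \<longleftrightarrow> \<phi> x = \<phi> y"
  unfolding c.cong_def by (simp add: Q.\<phi>_eq)

lemma pull_image: assumes "sgrp L" "pull {\<zero>\<^bsub>Q\<^esub>} \<subseteq> L" shows "pull (\<phi> ` L) = L"
proof
  show "pull (\<phi> ` L) \<subseteq> L"
  proof
    fix x assume "x \<in> pull (\<phi> ` L)"
    then obtain y where "y \<in> L" "\<phi> x = \<phi> y" by auto
    then show "x \<in> L" using c.cong_mem[OF assms, of x y] by (simp add: cong_iff)
  qed
qed auto

section \<open>Intermediate rings, their ideals and radicals\<close>

lemma cring_sub: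
  assumes "B \<subseteq> carrier Q" "subr (pull B)" shows "cring (Q\<lparr>carrier := B\<rparr>)"
proof -
  note BD = subrD[OF assms(2)]
  have rep: "\<exists>x. \<phi> x = b" if "b \<in> B" for b using that assms(1) Q.\<phi>_surj by blast
  have "subring B Q"
  proof (rule Q.subringI)
    show "B \<subseteq> carrier Q" by (rule assms)
    show "\<one>\<^bsub>Q\<^esub> \<in> B" using BD(3) by (simp add: Q.\<phi>_one)
    fix a assume a: "a \<in> B"
    then obtain x where x: "\<phi> x = a" using rep by blast
    show "\<ominus>\<^bsub>Q\<^esub> a \<in> B" using BD(7)[of x] a x by (simp add: Q.\<phi>_minus)
    fix b assume b: "b \<in> B"
    then obtain y where y: "\<phi> y = b" using rep by blast
    show "a \<otimes>\<^bsub>Q\<^esub> b \<in> B" "a \<oplus>\<^bsub>Q\<^esub> b \<in> B" using BD(4,5)[of x y] a b x y by (simp_all add: Q.\<phi>_mult Q.\<phi>_add)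
  qed
  then show ?thesis using Q.subcring_iff[OF assms(1)] Q.subcringI' by blast
qed

lemma ideal_pull:
  assumes B: "B \<subseteq> carrier Q" "subr (pull B)"
  shows "ideal N (Q\<lparr>carrier := B\<rparr>) \<longleftrightarrow> N \<subseteq> B \<and> ideal_of (pull B) (pull N)"
proof -
  interpret B: cring "Q\<lparr>carrier := B\<rparr>" by (rule cring_sub[OF B])
  note BD = subrD[OF B(2)]
  have rep: "\<exists>x. \<phi> x = b" if "b \<in> B" for b using that B(1) Q.\<phi>_surj by blast
  show ?thesis
  proof
    assume N: "ideal N (Q\<lparr>carrier := B\<rparr>)"
    note ND = B.idealD[OF N, simplified]
    have mult: "a * x \<in> pull N" if "a \<in> pull B" "x \<in> pull N" for a x using that ND(6) by (simp add: Q.\<phi>_mult)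
    have "sgrp (pull N)"
    proof (rule sgrpI)
      show "0 \<in> pull N" using ND(2) by (simp add: Q.\<phi>_zero)
      fix x y assume xy: "x \<in> pull N" "y \<in> pull N"
      have "- 1 \<in> pull B" using BD(3,7) by blast
      from mult[OF this xy(2)] have "\<phi> x \<oplus>\<^bsub>Q\<^esub> \<phi> (- 1 * y) \<in> N" using ND(3) xy(1) by simp
      then show "x - y \<in> pull N" by (simp add: Q.\<phi>_simps a_minus_def)
    qed
    then show "N \<subseteq> B \<and> ideal_of (pull B) (pull N)" unfolding ideal_of_def using mult ND(1) Q.pull_subset by simp
  next
    assume N: "N \<subseteq> B \<and> ideal_of (pull B) (pull N)"
    then have ND: "N \<subseteq> B" and NI: "ideal_of (pull B) (pull N)" by auto
    note ND' = ideal_ofD[OF NI]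
    show "ideal N (Q\<lparr>carrier := B\<rparr>)"
    proof (rule B.ideal_if_closed)
      show "N \<subseteq> carrier (Q\<lparr>carrier := B\<rparr>)" using ND by simp
      show "\<zero>\<^bsub>Q\<lparr>carrier := B\<rparr>\<^esub> \<in> N" using sgrp_zero[OF ND'(1)] by (simp add: Q.\<phi>_zero)
      fix a assume a: "a \<in> N"
      obtain x where x: "\<phi> x = a" using rep a ND by blast
      show "a \<oplus>\<^bsub>Q\<lparr>carrier := B\<rparr>\<^esub> b \<in> N" if b: "b \<in> N" for b
      proof -
        obtain y where y: "\<phi> y = b" using rep b ND by blast
        show ?thesis using sgrp_add[OF ND'(1), of x y] a b x y by (simp add: Q.\<phi>_add)
      qed
      show "b \<otimes>\<^bsub>Q\<lparr>carrier := B\<rparr>\<^esub> a \<in> N" if b: "b \<in> carrier (Q\<lparr>carrier := B\<rparr>)" for b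
      proof -
        obtain y where y: "\<phi> y = b" using rep b by auto
        show ?thesis using ND'(3)[of y x] a b x y by (simp add: Q.\<phi>_mult)
      qed
    qed
  qed
qed

lemma max_ideal_pull:
  assumes B: "B \<subseteq> carrier Q" "subr (pull B)" and N: "N \<subseteq> carrier Q"
  shows "maximalideal N (Q\<lparr>carrier := B\<rparr>) \<longleftrightarrow> N \<subseteq> B \<and> c.max_ideal (pull B) (pull N)"
proof -
  interpret B: cring "Q\<lparr>carrier := B\<rparr>" by (rule cring_sub[OF B])
  have *: "(\<forall>x\<in>B. x \<notin> N \<longrightarrow> (\<exists>b\<in>B. \<exists>n\<in>N. x \<otimes>\<^bsub>Q\<^esub> b = n \<oplus>\<^bsub>Q\<^esub> \<one>\<^bsub>Q\<^esub>)) \<longleftrightarrow>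
      (\<forall>x\<in>pull B. x \<notin> pull N \<longrightarrow> (\<exists>b\<in>pull B. x * b - 1 \<in> pull N))" (is "?L \<longleftrightarrow> ?R")
  proof
    assume L: ?L
    show ?R
    proof (intro ballI impI)
      fix x assume x: "x \<in> pull B" "x \<notin> pull N"
      then obtain b n where bn: "b \<in> B" "n \<in> N" "\<phi> x \<otimes>\<^bsub>Q\<^esub> b = n \<oplus>\<^bsub>Q\<^esub> \<one>\<^bsub>Q\<^esub>" using L by auto
      obtain b' n' where "\<phi> b' = b" "\<phi> n' = n" using Q.\<phi>_surj bn B(1) N by (meson subsetD)
      then have "\<phi> (x * b') = \<phi> (n' + 1)" "b' \<in> pull B" "n' \<in> pull N" using bn by (simp_all add: Q.\<phi>_simps)
      moreover have "\<phi> (x * b' - 1) = \<phi> n'"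
      proof -
        have "\<phi> (x * b' - 1) = \<phi> ((n' + 1) - 1)" unfolding Q.\<phi>_diff calculation(1) ..
        then show ?thesis by simp
      qed
      ultimately show "\<exists>b\<in>pull B. x * b - 1 \<in> pull N" by (intro bexI[of _ b']) simp_all
    qed
  next
    assume R: ?R
    show ?L
    proof (intro ballI impI)
      fix y assume y: "y \<in> B" "y \<notin> N"
      obtain x where x: "\<phi> x = y" using Q.\<phi>_surj y B(1) by blast
      then obtain b where b: "b \<in> pull B" "x * b - 1 \<in> pull N" using R y by auto
      have "\<phi> x \<otimes>\<^bsub>Q\<^esub> \<phi> b = \<phi> ((x * b - 1) + 1)" by (simp add: Q.\<phi>_mult)
      also have "\<dots> = \<phi> (x * b - 1) \<oplus>\<^bsub>Q\<^esub> \<one>\<^bsub>Q\<^esub>" by (simp only: Q.\<phi>_add Q.\<phi>_one)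
      finally have "y \<otimes>\<^bsub>Q\<^esub> \<phi> b = \<phi> (x * b - 1) \<oplus>\<^bsub>Q\<^esub> \<one>\<^bsub>Q\<^esub>" unfolding x .
      moreover have "\<phi> b \<in> B" "\<phi> (x * b - 1) \<in> N" using b by simp_all
      ultimately show "\<exists>b\<in>B. \<exists>n\<in>N. y \<otimes>\<^bsub>Q\<^esub> b = n \<oplus>\<^bsub>Q\<^esub> \<one>\<^bsub>Q\<^esub>" by blast
    qed
  qed
  have I: "pull {\<zero>\<^bsub>Q\<^esub>} \<subseteq> pull N" if "ideal_of (pull B) (pull N)"
    using sgrp_zero[OF ideal_ofD(1)[OF that]] by (auto simp: Q.\<phi>_zero)
  show ?thesis
    unfolding B.maximalideal_iff' c.max_ideal_def ideal_pull[OF B] using * I by (auto simp: Q.\<phi>_one)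
qed

lemma max_ideal_pullE:
  assumes B: "B \<subseteq> carrier Q" "subr (pull B)" and L: "c.max_ideal (pull B) L"
  obtains N where "maximalideal N (Q\<lparr>carrier := B\<rparr>)" "L = pull N"
proof -
  have "ideal_of (pull B) L" "pull {\<zero>\<^bsub>Q\<^esub>} \<subseteq> L" using L unfolding c.max_ideal_def by auto
  then have "pull (\<phi> ` L) = L" "\<phi> ` L \<subseteq> B" using pull_image ideal_ofD(1,2) by (blast, force)
  then have "maximalideal (\<phi> ` L) (Q\<lparr>carrier := B\<rparr>)" using max_ideal_pull[OF B, of "\<phi> ` L"] L B(1) by auto
  then show ?thesis using that \<open>pull (\<phi> ` L) = L\<close> by blast
qed

lemma maximalideal_sub_subset: "maximalideal N (Q\<lparr>carrier := B\<rparr>) \<Longrightarrow> N \<subseteq> B"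
  using additive_subgroup.a_subset[OF ideal.axioms(1)[OF maximalideal.axioms(1)]] by fastforce

lemma jac_pull:
  assumes B: "B \<subseteq> carrier Q" "subr (pull B)" shows "c.jac (pull B) = pull (Jac (Q\<lparr>carrier := B\<rparr>))"
proof -
  have "(\<forall>L. c.max_ideal (pull B) L \<longrightarrow> x \<in> L) \<longleftrightarrow> (\<forall>N. maximalideal N (Q\<lparr>carrier := B\<rparr>) \<longrightarrow> \<phi> x \<in> N)" for x
  proof
    assume L: "\<forall>L. c.max_ideal (pull B) L \<longrightarrow> x \<in> L"
    show "\<forall>N. maximalideal N (Q\<lparr>carrier := B\<rparr>) \<longrightarrow> \<phi> x \<in> N"
    proof (intro allI impI)
      fix N assume N: "maximalideal N (Q\<lparr>carrier := B\<rparr>)"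
      then have "N \<subseteq> carrier Q" using maximalideal_sub_subset B(1) by blast
      then have "c.max_ideal (pull B) (pull N)" using max_ideal_pull[OF B] N by blast
      then show "\<phi> x \<in> N" using L by auto
    qed
  next
    assume N: "\<forall>N. maximalideal N (Q\<lparr>carrier := B\<rparr>) \<longrightarrow> \<phi> x \<in> N"
    show "\<forall>L. c.max_ideal (pull B) L \<longrightarrow> x \<in> L"
    proof (intro allI impI)
      fix L assume "c.max_ideal (pull B) L"
      then obtain N where "maximalideal N (Q\<lparr>carrier := B\<rparr>)" "L = pull N" by (rule max_ideal_pullE[OF B])
      then show "x \<in> L" using N by simp
    qed
  qed
  then show ?thesis unfolding c.jac_def Jac_def by auto
qed

lemma Rs_pull: "c.Rs i = pull (Rseq R i) \<and> Rseq R i \<subseteq> carrier Q"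
proof (induction i)
  case 0 then show ?case using Rin_Q by simp
next
  case (Suc i)
  then have "subr (pull (Rseq R i))" using c.subr_Rs[of i] by simp
  then have j: "c.jac (c.Rs i) = pull (Jac (Q\<lparr>carrier := Rseq R i\<rparr>))" using jac_pull Suc by simp
  have "Jac (Q\<lparr>carrier := Rseq R i\<rparr>) \<subseteq> carrier Q" using Suc unfolding Jac_def by auto
  then have "c.Rs (Suc i) = pull (Rseq R (Suc i))" by (simp add: j Q.mults_pull)
  then show ?case by (auto simp: Eset_def)
qed

lemma Rinf_pull: "c.Rinf = pull (Rinf R)" "Rinf R \<subseteq> carrier Q"
proof -
  have "(\<Union>i\<in>{1..}. Rseq R i) = (\<Union>i. Rseq R (Suc i))"
  proof -
    have "{1..} = range Suc" by (auto simp: image_iff Suc_le_eq gr0_conv_Suc)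
    then show ?thesis by (simp only: image_image)
  qed
  then show "c.Rinf = pull (Rinf R)" "Rinf R \<subseteq> carrier Q"
    unfolding c.Rinf_def Rinf_def using Rs_pull by (auto simp del: c.Rs.simps Rseq.simps)
qed

lemma quadr_pull:
  assumes "Rin R \<subseteq> T" "T \<subseteq> carrier Q" shows "quadratic_ext Q (Rin R) T \<longleftrightarrow> c.quadr (pull T)"
proof
  assume q: "quadratic_ext Q (Rin R) T"
  show "c.quadr (pull T)" unfolding c.quadr_def
  proof (intro ballI)
    fix x y assume "x \<in> pull T" "y \<in> pull T"
    then have "\<phi> x \<in> T" "\<phi> y \<in> T" by auto
    then have "\<exists>a\<in>Rin R. \<exists>b\<in>Rin R. \<exists>c\<in>Rin R.
        \<phi> x \<otimes>\<^bsub>Q\<^esub> \<phi> y = (\<phi> x \<otimes>\<^bsub>Q\<^esub> a) \<oplus>\<^bsub>Q\<^esub> (\<phi> y \<otimes>\<^bsub>Q\<^esub> b) \<oplus>\<^bsub>Q\<^esub> c"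
      using q unfolding quadratic_ext_def by simp
    then obtain a b c where abc: "a \<in> Rin R" "b \<in> Rin R" "c \<in> Rin R"
      "\<phi> x \<otimes>\<^bsub>Q\<^esub> \<phi> y = (\<phi> x \<otimes>\<^bsub>Q\<^esub> a) \<oplus>\<^bsub>Q\<^esub> (\<phi> y \<otimes>\<^bsub>Q\<^esub> b) \<oplus>\<^bsub>Q\<^esub> c"
      by blast
    obtain a' b' c' where r: "\<phi> a' = a" "\<phi> b' = b" "\<phi> c' = c" using Q.\<phi>_surj abc Rin_Q by (meson subsetD)
    have "\<phi> (x * y) = \<phi> (x * a' + y * b' + c')" using abc(4) r by (simp add: Q.\<phi>_simps)
    then have "\<phi> (x * y) = \<phi> (a' * x + b' * y + c')" by (simp add: mult.commute)
    \<comment> \<open>The relation lifts only up to the kernel of \<open>\<phi>\<close>. With the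
      difference itself as constant term it holds exactly.\<close>
    then have e: "\<phi> (x * y - (a' * x + b' * y)) = c"
      using r by (metis Q.\<phi>_diff add_diff_cancel_left')
    have "x * y = a' * x + b' * y + (x * y - (a' * x + b' * y))" by simp
    moreover have "a' \<in> pull (Rin R)" "b' \<in> pull (Rin R)" "x * y - (a' * x + b' * y) \<in> pull (Rin R)"
      using r e abc by simp_all
    ultimately show "\<exists>a\<in>pull (Rin R). \<exists>b\<in>pull (Rin R). \<exists>c\<in>pull (Rin R). x * y = a * x + b * y + c" by blast
  qed
next
  assume q: "c.quadr (pull T)"
  show "quadratic_ext Q (Rin R) T" unfolding quadratic_ext_def
  proof (intro conjI ballI assms)
    fix u v assume uv: "u \<in> T" "v \<in> T"
    obtain x y where x: "\<phi> x = u" "\<phi> y = v" using Q.\<phi>_surj uv assms(2) by (meson subsetD)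
    then have "x \<in> pull T" "y \<in> pull T" using uv by auto
    then obtain a b c where abc: "a \<in> pull (Rin R)" "b \<in> pull (Rin R)" "c \<in> pull (Rin R)" "x * y = a * x + b * y + c"
      using q unfolding c.quadr_def by blast
    have "\<phi> (x * y) = \<phi> (x * a + y * b + c)" using abc(4) by (simp add: mult.commute)
    then have "u \<otimes>\<^bsub>Q\<^esub> v = u \<otimes>\<^bsub>Q\<^esub> \<phi> a \<oplus>\<^bsub>Q\<^esub> v \<otimes>\<^bsub>Q\<^esub> \<phi> b \<oplus>\<^bsub>Q\<^esub> \<phi> c" by (simp add: Q.\<phi>_simps x)
    then show "\<exists>a\<in>Rin R. \<exists>b\<in>Rin R. \<exists>c\<in>Rin R. u \<otimes>\<^bsub>Q\<^esub> v = u \<otimes>\<^bsub>Q\<^esub> a \<oplus>\<^bsub>Q\<^esub> v \<otimes>\<^bsub>Q\<^esub> b \<oplus>\<^bsub>Q\<^esub> c"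
      using abc by auto
  qed
qed

end

section \<open>Integral equations as polynomial values\<close>

lemma (in cring) finsum_lessThan_Suc:
  assumes "\<And>i::nat. i < Suc n \<Longrightarrow> f i \<in> carrier R"
  shows "(\<Oplus>i\<in>{..<Suc n}. f i) = f n \<oplus> (\<Oplus>i\<in>{..<n}. f i)"
  unfolding lessThan_Suc using assms by (intro finsum_insert funcsetI) auto

lemma (in cring) finsum_lessThan_Suc_shift:
  "(\<And>i::nat. i < Suc n \<Longrightarrow> f i \<in> carrier R) \<Longrightarrow>
    (\<Oplus>i\<in>{..<Suc n}. f i) = f 0 \<oplus> (\<Oplus>i\<in>{..<n}. f (Suc i))"
proof (induction n)
  case (Suc n)
  have c: "f i \<in> carrier R" if "i < Suc (Suc n)" for i using Suc.prems that by blast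
  have s: "(\<Oplus>i\<in>{..<n}. f (Suc i)) \<in> carrier R" by (intro finsum_closed funcsetI) (use c in auto)
  have "(\<Oplus>i\<in>{..<Suc (Suc n)}. f i) = f (Suc n) \<oplus> (\<Oplus>i\<in>{..<Suc n}. f i)"
    by (rule finsum_lessThan_Suc[OF c])
  also have "(\<Oplus>i\<in>{..<Suc n}. f i) = f 0 \<oplus> (\<Oplus>i\<in>{..<n}. f (Suc i))" using Suc by simp
  also have "f (Suc n) \<oplus> (f 0 \<oplus> (\<Oplus>i\<in>{..<n}. f (Suc i))) = f 0 \<oplus> (f (Suc n) \<oplus> (\<Oplus>i\<in>{..<n}. f (Suc i)))"
    using c[of 0] c[of "Suc n"] s by (simp add: a_lcomm)
  also have "f (Suc n) \<oplus> (\<Oplus>i\<in>{..<n}. f (Suc i)) = (\<Oplus>i\<in>{..<Suc n}. f (Suc i))"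
    by (rule finsum_lessThan_Suc[symmetric]) (use c in simp)
  finally show ?case .
qed (use finsum_lessThan_Suc[of 0 f] in simp)

context dim1_pres begin

interpretation h: ring_hom_cring R "TotQ R" "qemb R" by (rule ring_hom_qemb)

text \<open>The Horner form of the sum, which matches the recursion of \<open>lowp\<close>.\<close>

lemma poly_sum_shift:
  assumes "\<And>i. i < Suc n \<Longrightarrow> c i \<in> Rin R"
  shows "(\<Oplus>\<^bsub>Q\<^esub> i\<in>{..<Suc n}. c i \<otimes>\<^bsub>Q\<^esub> \<phi> x [^]\<^bsub>Q\<^esub> i) =
    c 0 \<oplus>\<^bsub>Q\<^esub> \<phi> x \<otimes>\<^bsub>Q\<^esub> (\<Oplus>\<^bsub>Q\<^esub> i\<in>{..<n}. c (Suc i) \<otimes>\<^bsub>Q\<^esub> \<phi> x [^]\<^bsub>Q\<^esub> i)"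
proof -
  have c: "c i \<in> carrier Q" if "i < Suc n" for i using assms[OF that] Rin_Q by blast
  have "(\<Oplus>\<^bsub>Q\<^esub> i\<in>{..<Suc n}. c i \<otimes>\<^bsub>Q\<^esub> \<phi> x [^]\<^bsub>Q\<^esub> i) =
      c 0 \<otimes>\<^bsub>Q\<^esub> \<phi> x [^]\<^bsub>Q\<^esub> (0::nat) \<oplus>\<^bsub>Q\<^esub> (\<Oplus>\<^bsub>Q\<^esub> i\<in>{..<n}. c (Suc i) \<otimes>\<^bsub>Q\<^esub> \<phi> x [^]\<^bsub>Q\<^esub> Suc i)"
    by (rule Q.finsum_lessThan_Suc_shift) (use c in simp)
  also have "(\<Oplus>\<^bsub>Q\<^esub> i\<in>{..<n}. c (Suc i) \<otimes>\<^bsub>Q\<^esub> \<phi> x [^]\<^bsub>Q\<^esub> Suc i) =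
      (\<Oplus>\<^bsub>Q\<^esub> i\<in>{..<n}. \<phi> x \<otimes>\<^bsub>Q\<^esub> (c (Suc i) \<otimes>\<^bsub>Q\<^esub> \<phi> x [^]\<^bsub>Q\<^esub> i))"
    by (rule Q.finsum_cong') (use c in \<open>auto simp: Q.m_ac\<close>)
  also have "\<dots> = \<phi> x \<otimes>\<^bsub>Q\<^esub> (\<Oplus>\<^bsub>Q\<^esub> i\<in>{..<n}. c (Suc i) \<otimes>\<^bsub>Q\<^esub> \<phi> x [^]\<^bsub>Q\<^esub> i)"
    by (rule Q.finsum_rdistr[symmetric]) (use c in auto)
  finally show ?thesis using c[of 0] by simp
qed

lemma lowp_imp_sum:
  "l \<in> lowp (pull (Rin R)) x n \<Longrightarrow> \<exists>c. (\<forall>i<n. c i \<in> Rin R) \<and> \<phi> l = (\<Oplus>\<^bsub>Q\<^esub> i\<in>{..<n}. c i \<otimes>\<^bsub>Q\<^esub> \<phi> x [^]\<^bsub>Q\<^esub> i)"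
proof (induction n arbitrary: l)
  case (Suc n)
  then obtain d l' where *: "l = d + x * l'" "d \<in> pull (Rin R)" "l' \<in> lowp (pull (Rin R)) x n" by auto
  obtain c where c: "\<forall>i<n. c i \<in> Rin R" "\<phi> l' = (\<Oplus>\<^bsub>Q\<^esub> i\<in>{..<n}. c i \<otimes>\<^bsub>Q\<^esub> \<phi> x [^]\<^bsub>Q\<^esub> i)" using Suc.IH[OF *(3)] by blast
  define e where "e = case_nat (\<phi> d) c"
  have e: "e i \<in> Rin R" if "i < Suc n" for i using that c(1) *(2) unfolding e_def by (cases i) auto
  have "\<phi> l = (\<Oplus>\<^bsub>Q\<^esub> i\<in>{..<Suc n}. e i \<otimes>\<^bsub>Q\<^esub> \<phi> x [^]\<^bsub>Q\<^esub> i)"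
  proof -
    have "\<phi> l = e 0 \<oplus>\<^bsub>Q\<^esub> \<phi> x \<otimes>\<^bsub>Q\<^esub> (\<Oplus>\<^bsub>Q\<^esub> i\<in>{..<n}. e (Suc i) \<otimes>\<^bsub>Q\<^esub> \<phi> x [^]\<^bsub>Q\<^esub> i)"
      unfolding *(1) Q.\<phi>_add Q.\<phi>_mult c(2) by (simp add: e_def)
    also have "\<dots> = (\<Oplus>\<^bsub>Q\<^esub> i\<in>{..<Suc n}. e i \<otimes>\<^bsub>Q\<^esub> \<phi> x [^]\<^bsub>Q\<^esub> i)" by (rule poly_sum_shift[OF e, symmetric])
    finally show ?thesis .
  qed
  then show ?case using e by blast
qed (simp add: Q.\<phi>_zero)

lemma sum_imp_lowp:
  "\<forall>i<n. c i \<in> Rin R \<Longrightarrow> \<exists>l\<in>lowp (pull (Rin R)) x n. \<phi> l = (\<Oplus>\<^bsub>Q\<^esub> i\<in>{..<n}. c i \<otimes>\<^bsub>Q\<^esub> \<phi> x [^]\<^bsub>Q\<^esub> i)"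
proof (induction n arbitrary: c)
  case (Suc n)
  obtain l where l: "l \<in> lowp (pull (Rin R)) x n" "\<phi> l = (\<Oplus>\<^bsub>Q\<^esub> i\<in>{..<n}. c (Suc i) \<otimes>\<^bsub>Q\<^esub> \<phi> x [^]\<^bsub>Q\<^esub> i)"
    using Suc.IH[of "\<lambda>i. c (Suc i)"] Suc.prems by auto
  have "c 0 \<in> Rin R" using Suc.prems by blast
  then obtain d where d: "\<phi> d = c 0" using Q.\<phi>_surj Rin_Q by blast
  have "d + x * l \<in> lowp (pull (Rin R)) x (Suc n)" using d \<open>c 0 \<in> Rin R\<close> l by (intro lowp_SucI[OF refl]) auto
  moreover have "\<phi> (d + x * l) = (\<Oplus>\<^bsub>Q\<^esub> i\<in>{..<Suc n}. c i \<otimes>\<^bsub>Q\<^esub> \<phi> x [^]\<^bsub>Q\<^esub> i)"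
    using poly_sum_shift[of n c x] Suc.prems d l(2) by (simp add: Q.\<phi>_add Q.\<phi>_mult)
  ultimately show ?case by blast
qed (simp add: Q.\<phi>_zero)

lemma one_not_zero: "\<one>\<^bsub>Q\<^esub> \<noteq> \<zero>\<^bsub>Q\<^esub>"
proof
  assume "\<one>\<^bsub>Q\<^esub> = \<zero>\<^bsub>Q\<^esub>"
  then have "1 \<in> pull {\<zero>\<^bsub>Q\<^esub>}" by (simp add: Q.\<phi>_one)
  then show False using c.one_M c.I_M by blast
qed

lemma S_pull: "c.S = pull (Rbar R)"
proof
  show "c.S \<subseteq> pull (Rbar R)"
  proof
    fix q assume "q \<in> c.S"
    then obtain n l where nl: "l \<in> lowp (pull (Rin R)) q (Suc n)" "q ^ Suc n + l = 0"
      unfolding c.S_def integral_over_def by blast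
    obtain c where c: "\<forall>i<Suc n. c i \<in> Rin R" "\<phi> l = (\<Oplus>\<^bsub>Q\<^esub> i\<in>{..<Suc n}. c i \<otimes>\<^bsub>Q\<^esub> \<phi> q [^]\<^bsub>Q\<^esub> i)"
      using lowp_imp_sum[OF nl(1)] by blast
    have "\<phi> q [^]\<^bsub>Q\<^esub> Suc n \<oplus>\<^bsub>Q\<^esub> \<phi> l = \<zero>\<^bsub>Q\<^esub>" using arg_cong[OF nl(2), of \<phi>] by (simp only: Q.\<phi>_simps)
    then have "\<exists>(n::nat) c. (\<forall>i<n. c i \<in> Rin R) \<and> \<phi> q [^]\<^bsub>Q\<^esub> n \<oplus>\<^bsub>Q\<^esub> (\<Oplus>\<^bsub>Q\<^esub> i\<in>{..<n}. c i \<otimes>\<^bsub>Q\<^esub> \<phi> q [^]\<^bsub>Q\<^esub> i) = \<zero>\<^bsub>Q\<^esub>"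
      unfolding c(2) using c(1) by (intro exI[of _ "Suc n"] exI[of _ c]) simp
    then show "q \<in> pull (Rbar R)" unfolding Rbar_def by simp
  qed
  show "pull (Rbar R) \<subseteq> c.S"
  proof
    fix q assume "q \<in> pull (Rbar R)"
    then obtain n :: nat and c where nc: "\<forall>i<n. c i \<in> Rin R"
      "\<phi> q [^]\<^bsub>Q\<^esub> n \<oplus>\<^bsub>Q\<^esub> (\<Oplus>\<^bsub>Q\<^esub> i\<in>{..<n}. c i \<otimes>\<^bsub>Q\<^esub> \<phi> q [^]\<^bsub>Q\<^esub> i) = \<zero>\<^bsub>Q\<^esub>"
      unfolding Rbar_def by auto
    obtain l where l: "l \<in> lowp (pull (Rin R)) q n" "\<phi> l = (\<Oplus>\<^bsub>Q\<^esub> i\<in>{..<n}. c i \<otimes>\<^bsub>Q\<^esub> \<phi> q [^]\<^bsub>Q\<^esub> i)"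
      using sum_imp_lowp[OF nc(1)] by blast
    have z: "\<phi> (q ^ n + l) = \<zero>\<^bsub>Q\<^esub>" using nc(2) unfolding l(2)[symmetric] by (simp add: Q.\<phi>_simps)
    show "q \<in> c.S"
    proof (cases n)
      case 0
      \<comment> \<open>\<open>Rbar\<close> admits equations of degree 0, unlike
        \<open>integral_over\<close>; such an equation would say that 1 is 0.\<close>
      then have "\<one>\<^bsub>Q\<^esub> = \<zero>\<^bsub>Q\<^esub>" using z l(1) by (simp add: Q.\<phi>_one)
      then show ?thesis using one_not_zero by blast
    next
      case (Suc k)
      \<comment> \<open>The lifted equation holds only up to the kernel element \<open>j\<close>. As
        the preimage of \<open>R\<close> contains the kernel, \<open>j\<close> can be absorbed by
        the constant coefficient.\<close>
      define j where "j = q ^ n + l"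
      have sR: "sgrp (pull (Rin R))" using c.RD by blast
      have "j \<in> pull {\<zero>\<^bsub>Q\<^esub>}" using z by (simp add: j_def)
      then have "j \<in> pull (Rin R)" using c.I_R by blast
      then have "l - j \<in> lowp (pull (Rin R)) q (Suc k)"
        using sgrp_diff[OF lowp_sgrp[OF sR]] lowp_const[OF sR] l(1) unfolding Suc by blast
      moreover have "q ^ Suc k + (l - j) = 0" by (simp add: j_def Suc)
      ultimately show ?thesis unfolding c.S_def integral_over_def by blast
    qed
  qed
qed

lemma Rbar_Q: "Rbar R \<subseteq> carrier Q" unfolding Rbar_def by auto

lemma subr_Rbar: "subr (pull (Rbar R))" using c.subr_S unfolding S_pull .

lemma Rin_Rbar: "Rin R \<subseteq> Rbar R"
  using Q.pull_inj[OF Rin_Q Rbar_Q] c.R_S unfolding S_pull .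

lemma cring_Rbar: "cring (Rbar_ring R)"
  unfolding Rbar_ring_def by (rule cring_sub[OF Rbar_Q subr_Rbar])

section \<open>Stability and invertibility\<close>

text \<open>The dual basis of a projective module provides the inverse ideal.\<close>

lemma stable_imp_invertible:
  assumes I: "ideal I R" "regular_set R I" and st: "stable_ideal R I"
  shows "c.invertible (pull (qemb R ` I))"
proof -
  define Y where "Y = qemb R ` I"
  define E where "E = Eset Q Y"
  note IQ = qemb_ideal[OF I(1), folded Y_def]
  obtain s where s: "s \<in> I" "nzd R s" using I(2) unfolding regular_set_def by blast
  define b where "b = qemb R s"
  define b' where "b' = frac R \<one> s"
  have bb: "b \<otimes>\<^bsub>Q\<^esub> b' = \<one>\<^bsub>Q\<^esub>" unfolding b_def b'_def by (rule qemb_inverse[OF s(2)])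
  have bY: "b \<in> Y" unfolding b_def Y_def using s by blast
  have bQ: "b \<in> carrier Q" using bY IQ(1) by blast
  have b'Q: "b' \<in> carrier Q" unfolding b'_def using s by (simp add: frac_in)
  have YQ: "x \<in> carrier Q" if "x \<in> Y" for x using that IQ(1) by blast
  have YR: "Y \<subseteq> Rin R" unfolding Y_def Rin_def using idealD(1)[OF I(1)] by blast
  have YE: "x \<in> E" if x: "x \<in> Y" for x unfolding E_def Eset_def using x YQ IQ(5) YR by blast
  have EQ: "E \<subseteq> carrier Q" unfolding E_def Eset_def by blast
  have E0: "\<zero>\<^bsub>Q\<^esub> \<in> E" using YE IQ(2) by blast
  have E1: "\<one>\<^bsub>Q\<^esub> \<in> E" unfolding E_def Eset_def using YQ by auto
  from st obtain Xs f g where fg: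
    "\<forall>x\<in>Y. f x \<in> free_mod Q E Xs"
    "\<forall>x\<in>Y. \<forall>y\<in>Y. f (x \<oplus>\<^bsub>Q\<^esub> y) = (\<lambda>i. f x i \<oplus>\<^bsub>Q\<^esub> f y i)"
    "\<forall>a\<in>E. \<forall>x\<in>Y. f (a \<otimes>\<^bsub>Q\<^esub> x) = (\<lambda>i. a \<otimes>\<^bsub>Q\<^esub> f x i)"
    "\<forall>\<psi>\<in>free_mod Q E Xs. g \<psi> \<in> Y"
    "\<forall>\<psi>\<in>free_mod Q E Xs. \<forall>\<chi>\<in>free_mod Q E Xs. g (\<lambda>i. \<psi> i \<oplus>\<^bsub>Q\<^esub> \<chi> i) = g \<psi> \<oplus>\<^bsub>Q\<^esub> g \<chi>"
    "\<forall>a\<in>E. \<forall>\<psi>\<in>free_mod Q E Xs. g (\<lambda>i. a \<otimes>\<^bsub>Q\<^esub> \<psi> i) = a \<otimes>\<^bsub>Q\<^esub> g \<psi>"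
    "\<forall>x\<in>Y. g (f x) = x"
    unfolding stable_ideal_def stable_frac_def projective_sub_def Y_def[symmetric] E_def[symmetric]
    by (elim exE conjE) (rule that)
  define F where "F = f b"
  have F: "F \<in> free_mod Q E Xs" unfolding F_def using fg(1) bY by simp
  then have FE: "F i \<in> E" and FX: "F i \<noteq> \<zero>\<^bsub>Q\<^esub> \<Longrightarrow> i \<in> Xs" and Ffin: "finite {i. F i \<noteq> \<zero>\<^bsub>Q\<^esub>}" for i
    unfolding free_mod_def by auto
  have FQ: "F i \<in> carrier Q" for i using FE EQ by blast
  have fm: "\<psi> \<in> free_mod Q E Xs" if "\<And>i. \<psi> i \<in> E" "finite A" "A \<subseteq> Xs" "\<And>i. i \<notin> A \<Longrightarrow> \<psi> i = \<zero>\<^bsub>Q\<^esub>" for \<psi> A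
  proof -
    have "{i. \<psi> i \<noteq> \<zero>\<^bsub>Q\<^esub>} \<subseteq> A" using that(4) by blast
    then have "finite {i. \<psi> i \<noteq> \<zero>\<^bsub>Q\<^esub>}" using that(2) by (rule finite_subset)
    moreover have "\<psi> i = \<zero>\<^bsub>Q\<^esub>" if "i \<notin> Xs" for i using \<open>A \<subseteq> Xs\<close> \<open>\<And>i. i \<notin> A \<Longrightarrow> \<psi> i = \<zero>\<^bsub>Q\<^esub>\<close> that by blast
    ultimately show ?thesis using that(1) unfolding free_mod_def by simp
  qed
  \<comment> \<open>The coordinates of \<open>f\<close> are multiplications by the elements
    \<open>b^-1 F_i\<close>: as the ideal is contained in \<open>E\<close>, linearity gives
    \<open>b f(x) = f(bx) = x f(b)\<close>. Hence \<open>b^-1 F_i\<close> belongs to the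
    inverse.\<close>
  have hE: "(b' \<otimes>\<^bsub>Q\<^esub> F i) \<otimes>\<^bsub>Q\<^esub> x \<in> E" if x: "x \<in> Y" for i x
  proof -
    have fx: "f x i \<in> E" using fg(1) x unfolding free_mod_def by blast
    have "f (b \<otimes>\<^bsub>Q\<^esub> x) = (\<lambda>i. b \<otimes>\<^bsub>Q\<^esub> f x i)" using fg(3) YE[OF bY] x by blast
    moreover have "f (x \<otimes>\<^bsub>Q\<^esub> b) = (\<lambda>i. x \<otimes>\<^bsub>Q\<^esub> F i)" unfolding F_def using fg(3) YE[OF x] bY by blast
    ultimately have eq: "b \<otimes>\<^bsub>Q\<^esub> f x i = x \<otimes>\<^bsub>Q\<^esub> F i" using Q.m_comm[OF bQ YQ[OF x]] by (metis (no_types))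
    have "(b' \<otimes>\<^bsub>Q\<^esub> F i) \<otimes>\<^bsub>Q\<^esub> x = b' \<otimes>\<^bsub>Q\<^esub> (x \<otimes>\<^bsub>Q\<^esub> F i)" using b'Q FQ YQ[OF x] by (simp add: Q.m_ac)
    also have "\<dots> = (b \<otimes>\<^bsub>Q\<^esub> b') \<otimes>\<^bsub>Q\<^esub> f x i" unfolding eq[symmetric] using b'Q bQ fx EQ by (simp add: Q.m_ac subset_iff)
    also have "\<dots> = f x i" unfolding bb using fx EQ by (simp add: subset_iff)
    finally show ?thesis using fx by simp
  qed
  have mu: "mults (pull Y) = pull E" unfolding E_def by (rule Q.mults_pull[OF IQ(1)])
  show ?thesis unfolding Y_def[symmetric] c.invertible_def mu
  proof (intro allI impI)
    fix N assume N: "sgrp N \<and> pull {\<zero>\<^bsub>Q\<^esub>} \<subseteq> N \<and> (\<forall>h\<in>colon (pull E) (pull Y). \<forall>k\<in>pull Y. h * k \<in> N)"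
    \<comment> \<open>\<open>F\<close> is built up from its finitely many nonzero coordinates. Each
      one adds the product of \<open>b^-1 F_j\<close> in the inverse with the image of a unit vector
      in \<open>Y\<close>. For the full support the value is
      \<open>b^-1 g(f(b)) = 1\<close>.\<close>
    have main: "\<phi> z = b' \<otimes>\<^bsub>Q\<^esub> g (\<lambda>i. if i \<in> A then F i else \<zero>\<^bsub>Q\<^esub>) \<longrightarrow> z \<in> N" if "finite A" "A \<subseteq> Xs" for A z
      using that
    proof (induction A arbitrary: z rule: finite_induct)
      case empty
      have z0: "(\<lambda>i. \<zero>\<^bsub>Q\<^esub>) \<in> free_mod Q E Xs" unfolding free_mod_def using E0 by simp
      have "g (\<lambda>i. \<zero>\<^bsub>Q\<^esub> \<otimes>\<^bsub>Q\<^esub> \<zero>\<^bsub>Q\<^esub>) = \<zero>\<^bsub>Q\<^esub> \<otimes>\<^bsub>Q\<^esub> g (\<lambda>i. \<zero>\<^bsub>Q\<^esub>)" by (rule fg(6)[rule_format, OF E0 z0])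
      moreover have "g (\<lambda>i. \<zero>\<^bsub>Q\<^esub>) \<in> carrier Q" using fg(4) z0 YQ by blast
      ultimately have "g (\<lambda>i. \<zero>\<^bsub>Q\<^esub>) = \<zero>\<^bsub>Q\<^esub>" by simp
      then show ?case using N b'Q by auto
    next
      case (insert j A)
      define G where "G = (\<lambda>i. if i \<in> A then F i else \<zero>\<^bsub>Q\<^esub>)"
      define d where "d = (\<lambda>i. if i = j then \<one>\<^bsub>Q\<^esub> else \<zero>\<^bsub>Q\<^esub>)"
      have G: "G \<in> free_mod Q E Xs"
        by (rule fm[of _ A]) (use FE E0 insert.prems insert.hyps in \<open>auto simp: G_def\<close>)
      have d: "d \<in> free_mod Q E Xs" by (rule fm[of _ "{j}"]) (use E0 E1 insert.prems in \<open>auto simp: d_def\<close>)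
      have Fd: "(\<lambda>i. F j \<otimes>\<^bsub>Q\<^esub> d i) \<in> free_mod Q E Xs"
        by (rule fm[of _ "{j}"]) (use E0 FE FQ insert.prems in \<open>auto simp: d_def\<close>)
      have "(\<lambda>i. if i \<in> insert j A then F i else \<zero>\<^bsub>Q\<^esub>) = (\<lambda>i. G i \<oplus>\<^bsub>Q\<^esub> F j \<otimes>\<^bsub>Q\<^esub> d i)"
        using insert.hyps(2) FQ by (auto simp: G_def d_def fun_eq_iff)
      then have "g (\<lambda>i. if i \<in> insert j A then F i else \<zero>\<^bsub>Q\<^esub>) = g G \<oplus>\<^bsub>Q\<^esub> F j \<otimes>\<^bsub>Q\<^esub> g d"
        using fg(5) fg(6) FE G d Fd by simp
      moreover have gY: "g G \<in> Y" "g d \<in> Y" using fg(4) G d by auto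
      ultimately have eq: "b' \<otimes>\<^bsub>Q\<^esub> g (\<lambda>i. if i \<in> insert j A then F i else \<zero>\<^bsub>Q\<^esub>) =
          b' \<otimes>\<^bsub>Q\<^esub> g G \<oplus>\<^bsub>Q\<^esub> (b' \<otimes>\<^bsub>Q\<^esub> F j) \<otimes>\<^bsub>Q\<^esub> g d"
        using b'Q FQ YQ by (simp add: Q.r_distr Q.m_assoc)
      obtain u where u: "\<phi> u = b' \<otimes>\<^bsub>Q\<^esub> g G" using Q.\<phi>_surj b'Q YQ gY by (meson Q.m_closed)
      obtain v where v: "\<phi> v = b' \<otimes>\<^bsub>Q\<^esub> F j" using Q.\<phi>_surj b'Q FQ by (meson Q.m_closed)
      obtain w where w: "\<phi> w = g d" using Q.\<phi>_surj YQ gY by meson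
      have "u \<in> N" using insert.IH[of u] insert.prems u unfolding G_def by simp
      moreover have "v \<in> colon (pull E) (pull Y)" unfolding colon_def using hE by (simp add: Q.\<phi>_mult v)
      then have "v * w \<in> N" using N gY(2) w by auto
      ultimately have uvN: "u + v * w \<in> N" using N sgrp_add by blast
      show ?case
      proof
        assume z: "\<phi> z = b' \<otimes>\<^bsub>Q\<^esub> g (\<lambda>i. if i \<in> insert j A then F i else \<zero>\<^bsub>Q\<^esub>)"
        have "\<phi> z = \<phi> (u + v * w)" unfolding z eq by (simp add: Q.\<phi>_simps u v w)
        then show "z \<in> N" using c.cong_mem[of N z "u + v * w"] uvN N by (simp add: cong_iff)
      qed
    qed
    have "(\<lambda>i. if i \<in> {i. F i \<noteq> \<zero>\<^bsub>Q\<^esub>} then F i else \<zero>\<^bsub>Q\<^esub>) = F" by (rule ext) simp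
    moreover have "g F = b" unfolding F_def using fg(7) bY by blast
    moreover have "\<phi> 1 = b' \<otimes>\<^bsub>Q\<^esub> b" using bb bQ b'Q by (simp add: Q.\<phi>_one Q.m_comm)
    moreover have "{i. F i \<noteq> \<zero>\<^bsub>Q\<^esub>} \<subseteq> Xs" using FX by blast
    ultimately show "1 \<in> N" using main[OF Ffin, of 1] by simp
  qed
qed

text \<open>\<open>K'\<close> is \<open>uK\<close> with \<open>u\<close> a unit. Scaling leaves the
  multiplier ring unchanged and divides the inverse by \<open>u\<close>. This carries invertibility
  from an ideal of \<open>R\<close> to a module with denominators.\<close>

lemma invertible_scale:
  assumes c: "c.cong (u * u') 1" and K: "sgrp K" "pull {\<zero>\<^bsub>Q\<^esub>} \<subseteq> K" and K': "\<And>x. x \<in> K' \<longleftrightarrow> u' * x \<in> K"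
    and inv: "c.invertible K'"
  shows "c.invertible K"
proof -
  have mem: "u * k \<in> K'" if "k \<in> K" for k
  proof -
    have "c.cong ((u * u') * k) k" by (rule c.cong_mult1[OF c])
    then have "c.cong (u' * (u * k)) k" by (simp only: ac_simps)
    then show ?thesis unfolding K' using c.cong_mem[OF K] that by blast
  qed
  have mu: "mults K' = mults K"
  proof -
    have "q \<in> mults K" if q: "q \<in> mults K'" for q
      unfolding mults_def
    proof (intro CollectI ballI)
      fix k assume k: "k \<in> K"
      have "u' * (q * (u * k)) \<in> K" using q mem[OF k] K' unfolding mults_def by blast
      moreover have "c.cong ((u * u') * (q * k)) (q * k)" by (rule c.cong_mult1[OF c])
      ultimately show "q * k \<in> K" using c.cong_mem[OF K, of "(u * u') * (q * k)" "q * k"] by (simp add: ac_simps)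
    qed
    moreover have "q \<in> mults K'" if q: "q \<in> mults K" for q
      unfolding mults_def
    proof (intro CollectI ballI)
      fix k assume "k \<in> K'"
      then have "q * (u' * k) \<in> K" using q K' unfolding mults_def by blast
      then show "q * k \<in> K'" unfolding K' by (simp only: mult.left_commute)
    qed
    ultimately show ?thesis by blast
  qed
  show ?thesis unfolding c.invertible_def
  proof (intro allI impI)
    fix N assume N: "sgrp N \<and> pull {\<zero>\<^bsub>Q\<^esub>} \<subseteq> N \<and> (\<forall>h\<in>colon (mults K) K. \<forall>k\<in>K. h * k \<in> N)"
    have "h * k \<in> N" if h: "h \<in> colon (mults K') K'" and k: "k \<in> K'" for h k
    proof -
      have "(h * u) * x \<in> mults K" if "x \<in> K" for x
        using h mem[OF that] unfolding colon_def mu by (simp add: mult.assoc)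
      then have "h * u \<in> colon (mults K) K" unfolding colon_def by blast
      then have "(h * u) * (u' * k) \<in> N" using N k K' by blast
      moreover have "c.cong ((u * u') * (h * k)) (h * k)" by (rule c.cong_mult1[OF c])
      ultimately show ?thesis using N c.cong_mem[of N "(u * u') * (h * k)" "h * k"] by (simp add: ac_simps)
    qed
    then show "1 \<in> N" using inv N unfolding c.invertible_def by blast
  qed
qed

text \<open>A power \<open>m^k\<close> carries the generators into \<open>R\<close>. The ideal they
  generate there is regular, hence stable and invertible, and the module differs from it by the unit
  \<open>m^k\<close>.\<close>

lemma fin_stable_ring_imp: assumes "fin_stable_ring R" shows "c.fin_stable"
  unfolding c.fin_stable_def
proof (intro allI impI)
  fix ps assume "\<exists>u\<in>lin (pull (Rin R)) ps. \<exists>v. c.cong (u * v) 1"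
  then obtain u v where uv: "u \<in> lin (pull (Rin R)) ps" "c.cong (u * v) 1" by blast
  have den: "\<exists>k. \<forall>p\<in>set ps. mm ^ k * p \<in> pull (Rin R)"
  proof (induction ps)
    case (Cons p ps)
    then obtain k where k: "\<forall>p\<in>set ps. mm ^ k * p \<in> pull (Rin R)" by blast
    obtain l where l: "mm ^ l * p \<in> pull (Rin R)" using c.denom by blast
    have mR: "mm ^ j \<in> pull (Rin R)" for j using subr_power[OF c.subr_R] c.m_M c.MD(2) by blast
    have "mm ^ (k + l) * q \<in> pull (Rin R)" if q: "q \<in> set (p # ps)" for q
    proof (cases "q = p")
      case True
      have "mm ^ (k + l) * q = mm ^ k * (mm ^ l * p)" using True by (simp add: power_add mult.assoc)
      then show ?thesis using c.RD(4)[OF mR l] by simp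
    next
      case False
      have "mm ^ (k + l) * q = mm ^ l * (mm ^ k * q)" by (simp add: power_add ac_simps)
      then show ?thesis using c.RD(4)[OF mR, of "mm ^ k * q"] k q False by simp
    qed
    then show ?case by blast
  qed simp
  then obtain k where k: "\<forall>p\<in>set ps. mm ^ k * p \<in> pull (Rin R)" by blast
  have "\<forall>p\<in>set ps. \<exists>a. a \<in> carrier R \<and> \<phi> (mm ^ k * p) = qemb R a" using k unfolding Rin_def by (simp add: image_iff) blast
  then obtain \<alpha> where \<alpha>: "\<And>p. p \<in> set ps \<Longrightarrow> \<alpha> p \<in> carrier R \<and> \<phi> (mm ^ k * p) = qemb R (\<alpha> p)"
    unfolding bchoice_iff by blast
  define S where "S = \<alpha> ` set ps"
  define I where "I = Idl S"
  have S: "finite S" "S \<subseteq> carrier R" unfolding S_def using \<alpha> by auto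
  have I: "ideal I R" unfolding I_def by (rule genideal_ideal[OF S(2)])
  note IQ = qemb_ideal[OF I]
  have inv: "c.cong (mm ^ k * im ^ k) 1" by (rule c.inv_power[OF c.m_im'])
  \<comment> \<open>To be contained in the module scaled by \<open>m^k\<close> is a property of all
    of \<open>I\<close> by minimality of the generated ideal, once the elements with this property
    are seen to form an ideal.\<close>
  let ?L = "{a \<in> carrier R. \<forall>x. \<phi> x = qemb R a \<longrightarrow> im ^ k * x \<in> c.gen ps}"
  have gen_c: "x \<in> c.gen ps \<longleftrightarrow> y \<in> c.gen ps" if "\<phi> x = \<phi> y" for x y
    using c.cong_mem[OF c.sgrp_gen c.I_gen, of x y ps] that by (simp add: cong_iff)
  have L: "ideal ?L R"
  proof (rule ideal_if_closed)
    have "im ^ k * x \<in> c.gen ps" if "\<phi> x = qemb R \<zero>" for x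
      using gen_c[of "im ^ k * x" 0] that sgrp_zero[OF c.sgrp_gen[of ps]] by (simp add: Q.\<phi>_mult Q.\<phi>_zero)
    then show "\<zero> \<in> ?L" by blast
    fix a assume a: "a \<in> ?L"
    then obtain x where x: "\<phi> x = qemb R a" using Q.\<phi>_surj by blast
    have xg: "im ^ k * x \<in> c.gen ps" using a x by blast
    show "a \<oplus> b \<in> ?L" if b: "b \<in> ?L" for b
    proof -
      obtain y where y: "\<phi> y = qemb R b" using Q.\<phi>_surj b by blast
      then have yg: "im ^ k * y \<in> c.gen ps" using b by blast
      have "im ^ k * z \<in> c.gen ps" if z: "\<phi> z = qemb R (a \<oplus> b)" for z
      proof -
        have "\<phi> (im ^ k * z) = \<phi> (im ^ k * x + im ^ k * y)" using a b z x y by (simp add: Q.\<phi>_mult Q.\<phi>_add Q.r_distr)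
        then show ?thesis using gen_c sgrp_add[OF c.sgrp_gen xg yg] by blast
      qed
      then show ?thesis using a b by simp
    qed
    show "r \<otimes> a \<in> ?L" if r: "r \<in> carrier R" for r
    proof -
      obtain y where y: "\<phi> y = qemb R r" using Q.\<phi>_surj[of "qemb R r"] r by auto
      then have yR: "y \<in> pull (Rin R)" using r unfolding Rin_def by simp
      have smul: "c.gen ps \<subseteq> {z. y * z \<in> c.gen ps}"
      proof (rule c.gen_subset)
        show "sgrp {z. y * z \<in> c.gen ps}" using c.sgrp_gen[of ps] by (auto simp: sgrp_def right_diff_distrib)
        show "pull {\<zero>\<^bsub>Q\<^esub>} \<subseteq> {z. y * z \<in> c.gen ps}" using c.I_gen c.I_mult(1) by blast
        show "s * p \<in> {z. y * z \<in> c.gen ps}" if "s \<in> pull (Rin R)" "p \<in> set ps" for s p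
          using lin_mem[OF c.RD(1) that(2) c.RD(4)[OF yR that(1)]] c.lin_gen by (auto simp: mult.assoc)
      qed
      have "im ^ k * z \<in> c.gen ps" if z: "\<phi> z = qemb R (r \<otimes> a)" for z
      proof -
        have "\<phi> (im ^ k * z) = \<phi> (y * (im ^ k * x))" using a r z x y by (simp add: Q.\<phi>_mult Q.m_ac)
        then show ?thesis using gen_c smul xg by blast
      qed
      then show ?thesis using a r by simp
    qed
  qed blast
  have "S \<subseteq> ?L"
  proof
    fix a assume "a \<in> S"
    then obtain p where p: "p \<in> set ps" "a = \<alpha> p" unfolding S_def by blast
    have "im ^ k * x \<in> c.gen ps" if x: "\<phi> x = qemb R a" for x
    proof -
      have "\<phi> x = \<phi> (mm ^ k * p)" using x \<alpha>[OF p(1)] p(2) by simp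
      then have "\<phi> (im ^ k * x) = \<phi> (im ^ k * (mm ^ k * p))" by (simp only: Q.\<phi>_mult)
      also have "\<dots> = \<phi> ((mm ^ k * im ^ k) * p)" by (simp only: ac_simps)
      also have "\<dots> = \<phi> p" using c.cong_mult1[OF inv, of p] by (simp add: cong_iff)
      finally show ?thesis using gen_c c.gen_mem[OF p(1)] by blast
    qed
    then show "a \<in> ?L" using \<alpha> p by simp
  qed
  then have IL: "I \<subseteq> ?L" unfolding I_def by (rule genideal_minimal[OF L])
  have gI: "c.gen ps \<subseteq> {y. \<phi> (mm ^ k * y) \<in> qemb R ` I}"
  proof (rule c.gen_subset)
    have "sgrp (pull (qemb R ` I))" by (rule Q.sgrp_pull[OF IQ(1-4)])
    then show "sgrp {y. \<phi> (mm ^ k * y) \<in> qemb R ` I}" by (auto simp: sgrp_def right_diff_distrib)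
    show "pull {\<zero>\<^bsub>Q\<^esub>} \<subseteq> {y. \<phi> (mm ^ k * y) \<in> qemb R ` I}" 
    proof
      fix y assume "y \<in> pull {\<zero>\<^bsub>Q\<^esub>}"
      then have "\<phi> (mm ^ k * y) = \<zero>\<^bsub>Q\<^esub>" by (simp add: Q.\<phi>_mult)
      then show "y \<in> {y. \<phi> (mm ^ k * y) \<in> qemb R ` I}" using IQ(2) by (simp only: mem_Collect_eq)
    qed
    fix r p assume r: "r \<in> pull (Rin R)" and p: "p \<in> set ps"
    have "\<alpha> p \<in> I" unfolding I_def using genideal_self[OF S(2)] p unfolding S_def by blast
    then have "\<phi> r \<otimes>\<^bsub>Q\<^esub> \<phi> (mm ^ k * p) \<in> qemb R ` I" using IQ(5) r \<alpha>[OF p] by simp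
    then show "r * p \<in> {y. \<phi> (mm ^ k * y) \<in> qemb R ` I}" by (simp add: Q.\<phi>_mult[symmetric] mult.left_commute)
  qed
  have K': "x \<in> pull (qemb R ` I) \<longleftrightarrow> im ^ k * x \<in> c.gen ps" for x
  proof
    assume "x \<in> pull (qemb R ` I)" then show "im ^ k * x \<in> c.gen ps" using IL by auto
  next
    assume "im ^ k * x \<in> c.gen ps"
    then have "\<phi> (mm ^ k * (im ^ k * x)) \<in> qemb R ` I" using gI by blast
    moreover have "\<phi> (mm ^ k * (im ^ k * x)) = \<phi> x" using c.cong_mult1[OF inv, of x] by (simp add: cong_iff mult.assoc)
    ultimately show "x \<in> pull (qemb R ` I)" by simp
  qed
  have "regular_set R I"
  proof -
    have "u \<in> c.gen ps" using uv c.lin_gen by blast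
    then obtain a where a: "a \<in> I" "\<phi> (mm ^ k * u) = qemb R a" using gI by blast
    have "c.cong ((mm ^ k * im ^ k) * (u * v)) (1 * 1)" by (intro c.cong_mult inv uv)
    then have "\<phi> ((mm ^ k * u) * (im ^ k * v)) = \<one>\<^bsub>Q\<^esub>" by (simp add: cong_iff ac_simps Q.\<phi>_one)
    then have "qemb R a \<otimes>\<^bsub>Q\<^esub> \<phi> (im ^ k * v) = \<one>\<^bsub>Q\<^esub>" unfolding a(2)[symmetric] Q.\<phi>_mult[symmetric] .
    then have "nzd R a" using nzd_qemb_unit[OF _ Q.\<phi>_closed] a(1) idealD(1)[OF I] by blast
    then show ?thesis unfolding regular_set_def using a by blast
  qed
  then have "stable_ideal R I" using assms I S unfolding fin_stable_ring_def I_def by blast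
  then have "c.invertible (pull (qemb R ` I))" using stable_imp_invertible I \<open>regular_set R I\<close> by blast
  then show "c.invertible (c.gen ps)" by (rule invertible_scale[OF inv c.sgrp_gen c.I_gen K'])
qed

section \<open>The implications for the ring and its integral closure\<close>

lemma Rbar_one: "\<one>\<^bsub>Rbar_ring R\<^esub> = \<one>\<^bsub>Q\<^esub>" and Rbar_zero: "\<zero>\<^bsub>Rbar_ring R\<^esub> = \<zero>\<^bsub>Q\<^esub>"
  and Rbar_mult: "x \<otimes>\<^bsub>Rbar_ring R\<^esub> y = x \<otimes>\<^bsub>Q\<^esub> y" and Rbar_carrier: "carrier (Rbar_ring R) = Rbar R"
  by (simp_all add: Rbar_ring_def)

lemma max_ideal_S: "maximalideal N (Rbar_ring R) \<Longrightarrow> c.max_ideal c.S (pull N) \<and> N \<subseteq> Rbar R"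
  unfolding S_pull Rbar_ring_def
  using max_ideal_pull[OF Rbar_Q subr_Rbar, of N] maximalideal_sub_subset[of N "Rbar R"] Rbar_Q by blast

lemma covering_maximals:
  assumes "at_most_two_max (Rbar_ring R)"
  shows "\<exists>N N'. c.max_ideal c.S N \<and> c.max_ideal c.S N' \<and> c.covers c.S N N'"
proof -
  interpret A: cring "Rbar_ring R" by (rule cring_Rbar)
  have "\<one>\<^bsub>Rbar_ring R\<^esub> \<noteq> \<zero>\<^bsub>Rbar_ring R\<^esub>" using one_not_zero by (simp add: Rbar_one Rbar_zero)
  from A.at_most_two_cover[OF assms this] obtain P P' where P: "maximalideal P (Rbar_ring R)" "maximalideal P' (Rbar_ring R)"
    "\<forall>x\<in>Rbar R. x \<notin> P \<longrightarrow> x \<notin> P' \<longrightarrow> (\<exists>y\<in>Rbar R. x \<otimes>\<^bsub>Q\<^esub> y = \<one>\<^bsub>Q\<^esub>)"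
    unfolding Rbar_one Rbar_mult Rbar_carrier by blast
  have "c.covers c.S (pull P) (pull P')" unfolding c.covers_def S_pull
  proof (intro ballI impI)
    fix x assume "x \<in> pull (Rbar R)" "x \<notin> pull P \<and> x \<notin> pull P'"
    then obtain y where y: "y \<in> Rbar R" "\<phi> x \<otimes>\<^bsub>Q\<^esub> y = \<one>\<^bsub>Q\<^esub>" using P(3) by auto
    then obtain z where "\<phi> z = y" using Q.\<phi>_surj Rbar_Q by blast
    then show "\<exists>b\<in>pull (Rbar R). c.cong (x * b) 1" using y
      by (intro bexI[of _ z]) (simp_all add: cong_iff Q.\<phi>_mult Q.\<phi>_one)
  qed
  then show ?thesis using max_ideal_S[OF P(1)] max_ideal_S[OF P(2)] by blast
qed

lemma Rin_Rinf: "Rin R \<subseteq> Rinf R"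
  using Q.pull_inj[OF Rin_Q Rinf_pull(2)] c.Rinf_props(2) unfolding Rinf_pull(1) .

lemma regular_M: "regular_set R M"
  unfolding regular_set_def using m_M nzd_m by blast

lemma fin_stable_imp:
  assumes "fin_stable_ring R"
  shows "at_most_two_max (Rbar_ring R)" "quadratic_ext Q (Rin R) (Rinf R)"
proof -
  interpret A: cring "Rbar_ring R" by (rule cring_Rbar)
  have fs: "c.fin_stable" by (rule fin_stable_ring_imp[OF assms])
  show at2: "at_most_two_max (Rbar_ring R)"
  proof (rule A.at_most_two_maxI)
    fix P P' P'' assume P: "maximalideal P (Rbar_ring R)" "maximalideal P' (Rbar_ring R)" "maximalideal P'' (Rbar_ring R)"
      and ne: "P \<noteq> P'" "P \<noteq> P''" "P' \<noteq> P''"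
    have sub: "P \<subseteq> carrier Q" "P' \<subseteq> carrier Q" "P'' \<subseteq> carrier Q" using P max_ideal_S Rbar_Q by blast+
    have "pull P \<noteq> pull P'" "pull P \<noteq> pull P''" "pull P' \<noteq> pull P''"
      using ne Q.image_pull[OF sub(1)] Q.image_pull[OF sub(2)] Q.image_pull[OF sub(3)] by metis+
    then show False using c.fin_stable_not_three[OF fs] P max_ideal_S by blast
  qed
  then obtain N N' where "c.max_ideal c.S N" "c.max_ideal c.S N'" "c.covers c.S N N'"
    using covering_maximals by blast
  then have "c.quadr c.Rinf" by (rule c.fin_stable_imp_quadratic[OF fs])
  then show "quadratic_ext Q (Rin R) (Rinf R)" using quadr_pull[OF Rin_Rinf Rinf_pull(2)] by (simp add: Rinf_pull(1))
qed

text \<open>If \<open>s\<close> kills a fraction \<open>y\<close>, it kills some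
  \<open>m^k y\<close> in \<open>R\<close>, hence in \<open>B\<close>, so this is zero and so is
  \<open>y\<close>. Thus \<open>s\<close> is regular in Q(R), where regular elements are
  units.\<close>

lemma nzd_intermediate_unit:
  assumes B: "Rin R \<subseteq> B" "B \<subseteq> carrier Q" and s: "nzd (Q\<lparr>carrier := B\<rparr>) s"
  shows "\<exists>s'\<in>carrier Q. s \<otimes>\<^bsub>Q\<^esub> s' = \<one>\<^bsub>Q\<^esub>"
proof (rule nzd_TotQ_unit)
  have sB: "s \<in> B" "\<forall>y\<in>B. s \<otimes>\<^bsub>Q\<^esub> y = \<zero>\<^bsub>Q\<^esub> \<longrightarrow> y = \<zero>\<^bsub>Q\<^esub>" using s by (auto simp: nzd_def)
  have sQ: "s \<in> carrier Q" using sB B by blast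
  have "y = \<zero>\<^bsub>Q\<^esub>" if y: "y \<in> carrier Q" "s \<otimes>\<^bsub>Q\<^esub> y = \<zero>\<^bsub>Q\<^esub>" for y
  proof -
    obtain k :: nat and a where ka: "a \<in> carrier R" "qemb R (m [^] k) \<otimes>\<^bsub>Q\<^esub> y = qemb R a"
      using denominator_power[OF y(1)] by blast
    have mk: "nzd R (m [^] k)" "m [^] k \<in> carrier R" using nzd_pow[OF nzd_m] m_carrier by auto
    have "qemb R a \<in> B" using ka B unfolding Rin_def by blast
    moreover have "s \<otimes>\<^bsub>Q\<^esub> qemb R a = qemb R (m [^] k) \<otimes>\<^bsub>Q\<^esub> (s \<otimes>\<^bsub>Q\<^esub> y)"
      unfolding ka(2)[symmetric] using sQ y(1) mk by (simp add: Q.m_lcomm)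
    then have "s \<otimes>\<^bsub>Q\<^esub> qemb R a = \<zero>\<^bsub>Q\<^esub>" unfolding y(2) using mk by simp
    ultimately have z: "qemb R (m [^] k) \<otimes>\<^bsub>Q\<^esub> y = \<zero>\<^bsub>Q\<^esub>" using sB(2) ka(2) by auto
    have f: "frac R \<one> (m [^] k) \<in> carrier Q" using mk by (simp add: frac_in)
    have "y = (qemb R (m [^] k) \<otimes>\<^bsub>Q\<^esub> frac R \<one> (m [^] k)) \<otimes>\<^bsub>Q\<^esub> y" using qemb_inverse[OF mk(1)] y by simp
    also have "\<dots> = frac R \<one> (m [^] k) \<otimes>\<^bsub>Q\<^esub> (qemb R (m [^] k) \<otimes>\<^bsub>Q\<^esub> y)" using f mk y by (simp add: Q.m_ac)
    finally show ?thesis unfolding z using f by simp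
  qed
  then show "nzd Q s" using sQ by (simp add: nzd_def)
qed

lemma quadratic_imp:
  assumes M: "stable_ideal R M" and q: "quadratic_ext Q (Rin R) (Rinf R)" and at2: "at_most_two_max (Rbar_ring R)"
  shows "quadratic_ext Q (Rin R) (Rbar R)" "dedekind_ring (Rbar_ring R)"
proof -
  interpret A: cring "Rbar_ring R" by (rule cring_Rbar)
  obtain N N' where N: "c.max_ideal c.S N" "c.max_ideal c.S N'" "c.covers c.S N N'"
    using covering_maximals[OF at2] by blast
  have inv: "c.invertible (pull (qemb R ` M))" by (rule stable_imp_invertible[OF ideal_M regular_M M])
  have qu: "c.quadr c.Rinf" using q quadr_pull[OF Rin_Rinf Rinf_pull(2)] by (simp add: Rinf_pull(1))
  note main = c.quadratic_imp_dedekind[OF inv qu N]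
  show "quadratic_ext Q (Rin R) (Rbar R)" using main(1) quadr_pull[OF Rin_Rbar Rbar_Q] by (simp add: S_pull)
  show "dedekind_ring (Rbar_ring R)" unfolding dedekind_ring_def
  proof (intro allI impI)
    fix I assume "ideal I (Rbar_ring R) \<and> regular_set (Rbar_ring R) I"
    then obtain s where I: "ideal I (Rbar_ring R)" and s: "s \<in> I" "nzd (Rbar_ring R) s"
      unfolding regular_set_def by blast
    have IB: "I \<subseteq> Rbar R" using A.idealD(1)[OF I] by (simp add: Rbar_carrier)
    have G: "ideal_of c.S (pull I)" unfolding S_pull using ideal_pull[OF Rbar_Q subr_Rbar, of I] I unfolding Rbar_ring_def by blast
    have IG: "pull {\<zero>\<^bsub>Q\<^esub>} \<subseteq> pull I" using A.idealD(2)[OF I] by (auto simp: Rbar_zero)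
    obtain s' where s': "s' \<in> carrier Q" "s \<otimes>\<^bsub>Q\<^esub> s' = \<one>\<^bsub>Q\<^esub>"
      using nzd_intermediate_unit[OF Rin_Rbar Rbar_Q] s(2) unfolding Rbar_ring_def by blast
    have sQ: "s \<in> carrier Q" using s IB Rbar_Q by blast
    obtain t where t: "\<phi> t = s" using Q.\<phi>_surj[OF sQ] by blast
    obtain t' where t': "\<phi> t' = s'" using Q.\<phi>_surj[OF s'(1)] by blast
    have "t \<in> pull I" "c.cong (t * t') 1" using s s' t t' by (simp_all add: cong_iff Q.\<phi>_mult Q.\<phi>_one)
    from main(2)[OF G IG this] obtain y y' where y: "y \<in> pull I" "c.cong (y * y') 1" "\<forall>p\<in>pull I. y' * p \<in> c.S" by blast
    have yy: "\<phi> y \<otimes>\<^bsub>Q\<^esub> \<phi> y' = \<one>\<^bsub>Q\<^esub>" using y(2) by (simp add: cong_iff Q.\<phi>_mult Q.\<phi>_one)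
    have cancel: "\<phi> y \<otimes>\<^bsub>Q\<^esub> (\<phi> y' \<otimes>\<^bsub>Q\<^esub> z) = z" if "z \<in> carrier Q" for z
      using yy that by (simp add: Q.m_assoc[symmetric])
    show "invertible_ideal (Rbar_ring R) I"
    proof (rule A.invertible_ideal_principal[OF I])
      show yI: "\<phi> y \<in> I" using y by simp
      show "nzd (Rbar_ring R) (\<phi> y)" unfolding nzd_def Rbar_carrier Rbar_mult Rbar_zero
      proof (intro conjI ballI impI)
        show "\<phi> y \<in> Rbar R" using yI IB by blast
        fix z assume z: "z \<in> Rbar R" "\<phi> y \<otimes>\<^bsub>Q\<^esub> z = \<zero>\<^bsub>Q\<^esub>"
        have zQ: "z \<in> carrier Q" using z Rbar_Q by blast
        have "z = \<phi> y' \<otimes>\<^bsub>Q\<^esub> (\<phi> y \<otimes>\<^bsub>Q\<^esub> z)" using cancel[OF zQ] zQ by (simp add: Q.m_lcomm)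
        then show "z = \<zero>\<^bsub>Q\<^esub>" unfolding z(2) by simp
      qed
      fix i assume i: "i \<in> I"
      have iQ: "i \<in> carrier Q" using i IB Rbar_Q by blast
      obtain j where j: "\<phi> j = i" using Q.\<phi>_surj[OF iQ] by blast
      then have "y' * j \<in> c.S" using y(3) i by simp
      then have "\<phi> y' \<otimes>\<^bsub>Q\<^esub> i \<in> Rbar R" using j unfolding S_pull by (simp add: Q.\<phi>_mult)
      moreover have "i = \<phi> y \<otimes>\<^bsub>Q\<^esub> (\<phi> y' \<otimes>\<^bsub>Q\<^esub> i)" by (rule cancel[OF iQ, symmetric])
      ultimately show "\<exists>a\<in>carrier (Rbar_ring R). i = \<phi> y \<otimes>\<^bsub>Rbar_ring R\<^esub> a" unfolding Rbar_carrier Rbar_mult by blast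
    qed
  qed
qed

lemma dedekind_imp_sp:
  assumes q: "quadratic_ext Q (Rin R) (Rbar R)" and dd: "dedekind_ring (Rbar_ring R)" and at2: "at_most_two_max (Rbar_ring R)"
  shows "sp_ring R"
  unfolding sp_ring_def
proof (intro allI impI)
  interpret A: cring "Rbar_ring R" by (rule cring_Rbar)
  obtain N N' where N: "c.max_ideal c.S N" "c.max_ideal c.S N'" "c.covers c.S N N'"
    using covering_maximals[OF at2] by blast
  have qu: "c.quadr c.S" using q quadr_pull[OF Rin_Rbar Rbar_Q] by (simp add: S_pull)
  fix I assume "ideal I R \<and> regular_set R I"
  then obtain s where I: "ideal I R" and s: "s \<in> I" "nzd R s" unfolding regular_set_def by blast
  note IQ = qemb_ideal[OF I]
  have sR: "s \<in> carrier R" by (rule nzdD[OF s(2)])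
  have IR: "qemb R ` I \<subseteq> Rin R" unfolding Rin_def using idealD(1)[OF I] by blast
  have IA: "qemb R ` I \<subseteq> carrier (Rbar_ring R)" unfolding Rbar_carrier using IR Rin_Rbar by blast
  \<comment> \<open>The extension of \<open>I\<close> to the integral closure, to which the Dedekind
    property is applied.\<close>
  define H where "H = Idl\<^bsub>Rbar_ring R\<^esub> (qemb R ` I)"
  have H: "ideal H (Rbar_ring R)" unfolding H_def by (rule A.genideal_ideal[OF IA])
  have IH: "qemb R ` I \<subseteq> H" unfolding H_def by (rule A.genideal_self[OF IA])
  have HB: "H \<subseteq> Rbar R" using A.idealD(1)[OF H] by (simp add: Rbar_carrier)
  have "nzd (Rbar_ring R) (qemb R s)" unfolding nzd_def Rbar_carrier Rbar_mult Rbar_zero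
  proof (intro conjI ballI impI)
    show "qemb R s \<in> Rbar R" using IH HB s by blast
    fix z assume z: "z \<in> Rbar R" "qemb R s \<otimes>\<^bsub>Q\<^esub> z = \<zero>\<^bsub>Q\<^esub>"
    have c: "z \<in> carrier Q" "frac R \<one> s \<in> carrier Q" "qemb R s \<in> carrier Q" using z Rbar_Q s sR by (auto simp: frac_in)
    have "z = (qemb R s \<otimes>\<^bsub>Q\<^esub> frac R \<one> s) \<otimes>\<^bsub>Q\<^esub> z" unfolding qemb_inverse[OF s(2)] using c by simp
    also have "\<dots> = frac R \<one> s \<otimes>\<^bsub>Q\<^esub> (qemb R s \<otimes>\<^bsub>Q\<^esub> z)" using c by (simp add: Q.m_ac)
    finally show "z = \<zero>\<^bsub>Q\<^esub>" unfolding z(2) using c by simp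
  qed
  then have "regular_set (Rbar_ring R) H" unfolding regular_set_def using IH s by blast
  then have Hinv: "invertible_ideal (Rbar_ring R) H" using dd H unfolding dedekind_ring_def by blast
  have "\<one>\<^bsub>Rbar_ring R\<^esub> \<noteq> \<zero>\<^bsub>Rbar_ring R\<^esub>" using one_not_zero by (simp add: Rbar_one Rbar_zero)
  from A.at_most_two_cover[OF at2 this] obtain P P' where P: "maximalideal P (Rbar_ring R)" "maximalideal P' (Rbar_ring R)"
    "\<forall>x\<in>carrier (Rbar_ring R). x \<notin> P \<longrightarrow> x \<notin> P' \<longrightarrow> (\<exists>y\<in>carrier (Rbar_ring R). x \<otimes>\<^bsub>Rbar_ring R\<^esub> y = \<one>\<^bsub>Rbar_ring R\<^esub>)"
    by blast
  from A.invertible_imp_principal[OF H Hinv P(1,2)] P(3)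
  obtain y where y: "y \<in> H" "nzd (Rbar_ring R) y" "\<forall>i\<in>H. \<exists>a\<in>Rbar R. i = y \<otimes>\<^bsub>Q\<^esub> a"
    unfolding Rbar_carrier Rbar_mult by blast
  have yB: "y \<in> Rbar R" using y(1) HB by blast
  have yQ: "y \<in> carrier Q" using yB Rbar_Q by blast
  obtain y' where y': "y' \<in> carrier Q" "y \<otimes>\<^bsub>Q\<^esub> y' = \<one>\<^bsub>Q\<^esub>"
    using nzd_intermediate_unit[OF Rin_Rbar Rbar_Q] y(2) unfolding Rbar_ring_def by blast
  obtain t where t: "\<phi> t = y" using Q.\<phi>_surj[OF yQ] by blast
  obtain t' where t': "\<phi> t' = y'" using Q.\<phi>_surj[OF y'(1)] by blast
  have y'i: "y' \<otimes>\<^bsub>Q\<^esub> (y \<otimes>\<^bsub>Q\<^esub> a) = a" if "a \<in> carrier Q" for a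
  proof -
    have "y' \<otimes>\<^bsub>Q\<^esub> (y \<otimes>\<^bsub>Q\<^esub> a) = (y \<otimes>\<^bsub>Q\<^esub> y') \<otimes>\<^bsub>Q\<^esub> a" using y' yQ that by (simp add: Q.m_ac)
    then show ?thesis using y' that by simp
  qed
  have tt: "c.cong (t * t') 1" using y' t t' by (simp add: cong_iff Q.\<phi>_mult Q.\<phi>_one)
  have "sgrp (pull (qemb R ` I))" by (rule Q.sgrp_pull[OF IQ(1-4)])
  then have G: "ideal_of (pull (Rin R)) (pull (qemb R ` I))"
    unfolding ideal_of_def using IQ(5) Q.pull_subset[OF IR] by (auto simp: Q.\<phi>_mult)
  have t'S: "t' * k \<in> c.S" if "k \<in> pull (qemb R ` I)" for k
  proof -
    have "\<phi> k \<in> H" using that IH by auto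
    then obtain a where a: "a \<in> Rbar R" "\<phi> k = y \<otimes>\<^bsub>Q\<^esub> a" using y(3) by blast
    have "\<phi> (t' * k) = a" using a y'i[of a] Rbar_Q t' by (auto simp: Q.\<phi>_mult)
    then show ?thesis using a unfolding S_pull by simp
  qed
  have gen: "1 \<in> L" if L: "ideal_of c.S L" "pull {\<zero>\<^bsub>Q\<^esub>} \<subseteq> L" "\<And>k. k \<in> pull (qemb R ` I) \<Longrightarrow> t' * k \<in> L" for L
  proof -
    have LL: "pull (\<phi> ` L) = L" by (rule pull_image[OF ideal_ofD(1)[OF L(1)] L(2)])
    \<comment> \<open>The elements whose quotient by \<open>y\<close> lies in \<open>L\<close> form
      an ideal of the integral closure that contains \<open>I\<close>. It therefore contains the
      extension ideal and in particular \<open>y\<close>, so 1 is in \<open>L\<close>.\<close>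
    let ?Z = "{z \<in> Rbar R. y' \<otimes>\<^bsub>Q\<^esub> z \<in> \<phi> ` L}"
    have mem: "y' \<otimes>\<^bsub>Q\<^esub> \<phi> z \<in> \<phi> ` L \<longleftrightarrow> t' * z \<in> L" for z
      using LL by (metis Q.\<phi>_mult Q.pull_mem t')
    have rep: "\<exists>x. \<phi> x = b" if "b \<in> Rbar R" for b using that Rbar_Q Q.\<phi>_surj by blast
    note LD = ideal_ofD[OF L(1)] and BD = subrD[OF subr_Rbar]
    have "ideal ?Z (Rbar_ring R)"
    proof (rule A.ideal_if_closed)
      show "?Z \<subseteq> carrier (Rbar_ring R)" by (auto simp: Rbar_carrier)
      show "\<zero>\<^bsub>Rbar_ring R\<^esub> \<in> ?Z" using mem[of 0] sgrp_zero[OF LD(1)] BD(2) by (simp add: Rbar_zero Q.\<phi>_zero)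
      fix a assume a: "a \<in> ?Z"
      then obtain x where x: "\<phi> x = a" using rep by blast
      then have xL: "t' * x \<in> L" "x \<in> pull (Rbar R)" using a mem[of x] by auto
      show "a \<oplus>\<^bsub>Rbar_ring R\<^esub> b \<in> ?Z" if b: "b \<in> ?Z" for b
      proof -
        obtain z where z: "\<phi> z = b" using rep b by blast
        then have "t' * z \<in> L" "z \<in> pull (Rbar R)" using b mem[of z] by auto
        then have "t' * (x + z) \<in> L" "x + z \<in> pull (Rbar R)" using xL sgrp_add[OF LD(1)] BD(5) by (simp_all only: distrib_left)
        then show ?thesis using mem[of "x + z"] x z by (simp add: Q.\<phi>_add Rbar_ring_def)
      qed
      show "r \<otimes>\<^bsub>Rbar_ring R\<^esub> a \<in> ?Z" if r: "r \<in> carrier (Rbar_ring R)" for r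
      proof -
        have rB: "r \<in> Rbar R" using r by (simp add: Rbar_carrier)
        then obtain z where z: "\<phi> z = r" using rep by blast
        then have zB: "z \<in> pull (Rbar R)" using rB by simp
        then have "z * (t' * x) \<in> L" using LD(3)[of z "t' * x"] xL unfolding S_pull by blast
        then have "t' * (z * x) \<in> L" by (simp only: mult.left_commute)
        moreover have "z * x \<in> pull (Rbar R)" using BD(4)[OF zB xL(2)] .
        ultimately show ?thesis using mem[of "z * x"] x z by (simp add: Q.\<phi>_mult Rbar_mult)
      qed
    qed
    moreover have "qemb R ` I \<subseteq> ?Z"
    proof
      fix z assume z: "z \<in> qemb R ` I"
      then obtain x where x: "\<phi> x = z" using Q.\<phi>_surj IQ(1) by blast
      then have "t' * x \<in> L" using L(3) z by simp
      then show "z \<in> ?Z" using mem[of x] x z IH HB by auto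
    qed
    ultimately have "H \<subseteq> ?Z" unfolding H_def by (rule A.genideal_minimal)
    then have "t' * t \<in> L" using y(1) t mem[of t] by auto
    then show ?thesis using c.cong_mem[OF LD(1) L(2) tt] by (simp add: mult.commute)
  qed
  from c.dedekind_imp_stable[OF qu N G tt t'S gen]
  obtain x x' where x: "x \<in> pull (qemb R ` I)" "c.cong (x * x') 1"
    "\<forall>a\<in>pull (qemb R ` I). \<forall>b\<in>pull (qemb R ` I). \<exists>d\<in>pull (qemb R ` I). c.cong (a * b) (x * d)" by blast
  obtain x0 where x0: "x0 \<in> I" "\<phi> x = qemb R x0" using x(1) by auto
  have IRc: "a \<in> carrier R" if "a \<in> I" for a using that idealD(1)[OF I] by blast
  have "qemb R x0 \<otimes>\<^bsub>Q\<^esub> \<phi> x' = \<one>\<^bsub>Q\<^esub>" using x(2) x0 by (simp add: cong_iff Q.\<phi>_mult Q.\<phi>_one)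
  then have "nzd R x0" by (rule nzd_qemb_unit[OF IRc[OF x0(1)] Q.\<phi>_closed])
  moreover have "\<exists>d\<in>I. a \<otimes> b = x0 \<otimes> d" if ab: "a \<in> I" "b \<in> I" for a b
  proof -
    obtain u v where uv: "\<phi> u = qemb R a" "\<phi> v = qemb R b" using Q.\<phi>_surj IQ(1) ab by (meson image_subset_iff)
    then have "u \<in> pull (qemb R ` I)" "v \<in> pull (qemb R ` I)" using ab by auto
    then obtain w where w: "w \<in> pull (qemb R ` I)" "c.cong (u * v) (x * w)" using x(3) by blast
    obtain d where d: "d \<in> I" "\<phi> w = qemb R d" using w(1) by auto
    have "qemb R (a \<otimes> b) = qemb R (x0 \<otimes> d)"
      using w(2) uv d x0 IRc ab by (simp add: cong_iff Q.\<phi>_mult)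
    then have "a \<otimes> b = x0 \<otimes> d" using inj_onD[OF qemb_inj] IRc ab d x0 by simp
    then show ?thesis using d by blast
  qed
  ultimately show "\<exists>x\<in>I. nzd R x \<and> (\<forall>a\<in>I. \<forall>b\<in>I. \<exists>c\<in>I. a \<otimes> b = x \<otimes> c)" using x0 by blast
qed

end

text \<open>From \<open>I^2 = xI\<close> it follows that \<open>x^-1 I\<close> is contained in E(I),
  so \<open>I = xE(I)\<close> is free on the generator \<open>x\<close>. The maps \<open>f\<close>
  and \<open>g\<close> are division and multiplication by \<open>x\<close>.\<close>

lemma (in cring) sp_imp_stable: assumes "sp_ring R" shows "stable_ring R"
  unfolding stable_ring_def
proof (intro allI impI)
  let ?Q = "TotQ R"
  interpret Q: cring ?Q by (rule cring_TotQ)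
  interpret h: ring_hom_cring R ?Q "qemb R" by (rule ring_hom_qemb)
  fix I assume I: "ideal I R \<and> regular_set R I"
  then obtain x where x: "x \<in> I" "nzd R x" "\<And>a b. a \<in> I \<Longrightarrow> b \<in> I \<Longrightarrow> \<exists>c\<in>I. a \<otimes> b = x \<otimes> c"
    using assms unfolding sp_ring_def by meson
  have IR: "a \<in> carrier R" if "a \<in> I" for a using that idealD(1) I by blast
  note IQ = qemb_ideal[OF conjunct1[OF I]]
  define Y where "Y = qemb R ` I"
  define E where "E = Eset ?Q Y"
  define u where "u = qemb R x"
  define v where "v = frac R \<one> x"
  have u: "u \<in> Y" "u \<in> carrier ?Q" unfolding u_def Y_def using x IR by auto
  have v: "v \<in> carrier ?Q" unfolding v_def using x by (simp add: frac_in)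
  have uv: "u \<otimes>\<^bsub>?Q\<^esub> v = \<one>\<^bsub>?Q\<^esub>" unfolding u_def v_def by (rule qemb_inverse[OF x(2)])
  have YQ: "y \<in> carrier ?Q" if "y \<in> Y" for y using that IQ(1) unfolding Y_def by blast
  have EQ: "e \<in> carrier ?Q" if "e \<in> E" for e using that unfolding E_def Eset_def by blast
  have uv': "u \<otimes>\<^bsub>?Q\<^esub> (v \<otimes>\<^bsub>?Q\<^esub> y) = y" if "y \<in> carrier ?Q" for y
    using that u v uv by (simp add: Q.m_assoc[symmetric])
  have vE: "v \<otimes>\<^bsub>?Q\<^esub> y \<in> E" if y: "y \<in> Y" for y
    unfolding E_def Eset_def
  proof (intro CollectI conjI ballI)
    show "v \<otimes>\<^bsub>?Q\<^esub> y \<in> carrier ?Q" using v YQ[OF y] by simp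
    fix z assume z: "z \<in> Y"
    obtain a b where ab: "a \<in> I" "b \<in> I" "y = qemb R a" "z = qemb R b" using y z unfolding Y_def by blast
    then obtain c where c: "c \<in> I" "a \<otimes> b = x \<otimes> c" using x(3) by blast
    have "y \<otimes>\<^bsub>?Q\<^esub> z = u \<otimes>\<^bsub>?Q\<^esub> qemb R c"
      using h.hom_mult[of a b] h.hom_mult[of x c] c ab IR x(1) unfolding u_def by simp
    then have "v \<otimes>\<^bsub>?Q\<^esub> y \<otimes>\<^bsub>?Q\<^esub> z = v \<otimes>\<^bsub>?Q\<^esub> (u \<otimes>\<^bsub>?Q\<^esub> qemb R c)" using v YQ y z by (simp add: Q.m_assoc)
    also have "\<dots> = qemb R c" using uv'[of "qemb R c"] u v IR[OF c(1)] by (simp add: Q.m_lcomm)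
    finally show "v \<otimes>\<^bsub>?Q\<^esub> y \<otimes>\<^bsub>?Q\<^esub> z \<in> Y" unfolding Y_def using c by simp
  qed
  have E0: "\<zero>\<^bsub>?Q\<^esub> \<in> E" unfolding E_def Eset_def using YQ IQ(2) by (auto simp: Y_def)
  define f where "f = (\<lambda>y i. if i = u then v \<otimes>\<^bsub>?Q\<^esub> y else \<zero>\<^bsub>?Q\<^esub>)"
  define g where "g = (\<lambda>\<psi>. \<psi> u \<otimes>\<^bsub>?Q\<^esub> u)"
  have fm: "\<psi> u \<in> E" "\<psi> u \<in> carrier ?Q" if "\<psi> \<in> free_mod ?Q E {u}" for \<psi> using that EQ unfolding free_mod_def by auto
  have "projective_sub ?Q E Y" unfolding projective_sub_def
  proof (intro exI[of _ "{u}"] exI[of _ f] exI[of _ g] conjI ballI)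
    fix y assume y: "y \<in> Y"
    have "{i. f y i \<noteq> \<zero>\<^bsub>?Q\<^esub>} \<subseteq> {u}" unfolding f_def by auto
    then have "finite {i. f y i \<noteq> \<zero>\<^bsub>?Q\<^esub>}" by (rule finite_subset) simp
    then show "f y \<in> free_mod ?Q E {u}" unfolding free_mod_def using vE[OF y] E0 by (simp add: f_def)
    show "g (f y) = y" using uv'[OF YQ[OF y]] u v YQ[OF y] by (simp add: f_def g_def Q.m_comm)
    show "f (y \<oplus>\<^bsub>?Q\<^esub> z) = (\<lambda>i. f y i \<oplus>\<^bsub>?Q\<^esub> f z i)" if "z \<in> Y" for z
      using v YQ[OF y] YQ[OF that] by (auto simp: f_def fun_eq_iff Q.r_distr)
  next
    fix a y assume "a \<in> E" "y \<in> Y"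
    then show "f (a \<otimes>\<^bsub>?Q\<^esub> y) = (\<lambda>i. a \<otimes>\<^bsub>?Q\<^esub> f y i)"
      using v EQ YQ by (auto simp: f_def fun_eq_iff Q.m_lcomm)
  next
    fix \<psi> assume \<psi>: "\<psi> \<in> free_mod ?Q E {u}"
    show "g \<psi> \<in> Y" using fm(1)[OF \<psi>] u unfolding g_def E_def Eset_def by blast
    show "g (\<lambda>i. \<psi> i \<oplus>\<^bsub>?Q\<^esub> \<chi> i) = g \<psi> \<oplus>\<^bsub>?Q\<^esub> g \<chi>" if "\<chi> \<in> free_mod ?Q E {u}" for \<chi>
      using fm(2)[OF \<psi>] fm(2)[OF that] u by (simp add: g_def Q.l_distr)
  next
    fix a \<psi> assume "a \<in> E" "\<psi> \<in> free_mod ?Q E {u}"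
    then show "g (\<lambda>i. a \<otimes>\<^bsub>?Q\<^esub> \<psi> i) = a \<otimes>\<^bsub>?Q\<^esub> g \<psi>" using fm(2) EQ u by (simp add: g_def Q.m_assoc)
  qed
  then show "stable_ideal R I" unfolding stable_ideal_def stable_frac_def E_def Y_def .
qed

context dim1_local begin

text \<open>Proved from the locale assumptions rather than from the dimension, so that the last
  equivalence applies to the quotient as well.\<close>

theorem stable_equivalences:
  "stable_ring R \<longleftrightarrow> fin_stable_ring R \<and> stable_ideal R M"
  "stable_ring R \<longleftrightarrow> stable_ideal R M \<and> quadratic_ext (TotQ R) (Rin R) (Rinf R) \<and> at_most_two_max (Rbar_ring R)"
  "stable_ring R \<longleftrightarrow> quadratic_ext (TotQ R) (Rin R) (Rbar R) \<and> dedekind_ring (Rbar_ring R) \<and> at_most_two_max (Rbar_ring R)"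
  "stable_ring R \<longleftrightarrow> sp_ring R"
proof -
  obtain \<phi> :: "((('a \<times> 'a) set) multiset \<Rightarrow>\<^sub>0 int) \<Rightarrow> ('a \<times> 'a) set" where "presented (TotQ R) \<phi>" by (rule presented_TotQ)
  then interpret p: dim1_pres R M m \<phi>
    by (intro dim1_pres.intro dim1_local_axioms)
  have 12: "fin_stable_ring R \<and> stable_ideal R M" if "stable_ring R"
    using that p.regular_M ideal_M unfolding stable_ring_def fin_stable_ring_def by blast
  have 23: "stable_ideal R M \<and> quadratic_ext (TotQ R) (Rin R) (Rinf R) \<and> at_most_two_max (Rbar_ring R)"
    if "fin_stable_ring R \<and> stable_ideal R M" using that p.fin_stable_imp by blast
  have 34: "quadratic_ext (TotQ R) (Rin R) (Rbar R) \<and> dedekind_ring (Rbar_ring R) \<and> at_most_two_max (Rbar_ring R)"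
    if "stable_ideal R M \<and> quadratic_ext (TotQ R) (Rin R) (Rinf R) \<and> at_most_two_max (Rbar_ring R)"
    using that p.quadratic_imp by blast
  have 45: "sp_ring R"
    if "quadratic_ext (TotQ R) (Rin R) (Rbar R) \<and> dedekind_ring (Rbar_ring R) \<and> at_most_two_max (Rbar_ring R)"
    using that p.dedekind_imp_sp by blast
  show "stable_ring R \<longleftrightarrow> fin_stable_ring R \<and> stable_ideal R M"
    "stable_ring R \<longleftrightarrow> stable_ideal R M \<and> quadratic_ext (TotQ R) (Rin R) (Rinf R) \<and> at_most_two_max (Rbar_ring R)"
    "stable_ring R \<longleftrightarrow> quadratic_ext (TotQ R) (Rin R) (Rbar R) \<and> dedekind_ring (Rbar_ring R) \<and> at_most_two_max (Rbar_ring R)"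
    "stable_ring R \<longleftrightarrow> sp_ring R"
    using 12 23 34 45 sp_imp_stable by argo+
qed

section \<open>Passage to the quotient by the powers of m\<close>

definition pow_inter :: "'a set" where
  "pow_inter = {x \<in> carrier R. \<forall>i::nat. i > 0 \<longrightarrow> (\<exists>r\<in>carrier R. x = m [^] i \<otimes> r)}"

lemma pow_inter_sub: "pow_inter \<subseteq> carrier R" unfolding pow_inter_def by blast

lemma pow_interD: "x \<in> pow_inter \<Longrightarrow> 0 < i \<Longrightarrow> \<exists>r\<in>carrier R. x = m [^] (i::nat) \<otimes> r"
  unfolding pow_inter_def by simp

lemma ideal_pow_inter: "ideal pow_inter R"
proof (rule ideal_if_closed)
  show "pow_inter \<subseteq> carrier R" by (rule pow_inter_sub)
  show "\<zero> \<in> pow_inter" unfolding pow_inter_def using m_carrier by (auto intro!: bexI[of _ \<zero>])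
  show "a \<oplus> b \<in> pow_inter" if ab: "a \<in> pow_inter" "b \<in> pow_inter" for a b
  proof -
    have "\<exists>r\<in>carrier R. a \<oplus> b = m [^] i \<otimes> r" if i: "i > 0" for i :: nat
    proof -
      obtain r s where "r \<in> carrier R" "s \<in> carrier R" "a = m [^] i \<otimes> r" "b = m [^] i \<otimes> s"
        using pow_interD[OF ab(1) i] pow_interD[OF ab(2) i] by blast
      then show ?thesis using m_carrier by (intro bexI[of _ "r \<oplus> s"]) (simp_all add: r_distr)
    qed
    moreover have "a \<in> carrier R" "b \<in> carrier R" using ab pow_inter_sub by blast+
    ultimately show ?thesis unfolding pow_inter_def by simp
  qed
  show "x \<otimes> a \<in> pow_inter" if a: "a \<in> pow_inter" and x: "x \<in> carrier R" for a x
  proof -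
    have "\<exists>r\<in>carrier R. x \<otimes> a = m [^] i \<otimes> r" if i: "i > 0" for i :: nat
    proof -
      obtain r where "r \<in> carrier R" "a = m [^] i \<otimes> r" using pow_interD[OF a i] by blast
      then show ?thesis using m_carrier x by (intro bexI[of _ "x \<otimes> r"]) (simp_all add: m_lcomm)
    qed
    moreover have "a \<in> carrier R" using a pow_inter_sub by blast
    ultimately show ?thesis using x unfolding pow_inter_def by simp
  qed
qed

lemmas JD = idealD[OF ideal_pow_inter]

lemma pow_inter_M: "pow_inter \<subseteq> M"
proof
  fix x assume "x \<in> pow_inter"
  then obtain r where "r \<in> carrier R" "x = m [^] (1::nat) \<otimes> r" using pow_interD[of x 1] by auto
  then show "x \<in> M" using idealD(7)[OF ideal_M m_M] m_carrier by simp
qed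

lemma pow_inter_cancel:
  assumes y: "y \<in> carrier R" "m [^] (k::nat) \<otimes> y \<in> pow_inter" shows "y \<in> pow_inter"
proof -
  have "\<exists>r\<in>carrier R. y = m [^] i \<otimes> r" if i: "i > 0" for i :: nat
  proof -
    have "\<exists>r\<in>carrier R. m [^] k \<otimes> y = m [^] (k + i) \<otimes> r" using y(2) i by (intro pow_interD) simp_all
    then obtain r where r: "r \<in> carrier R" "m [^] k \<otimes> y = m [^] (k + i) \<otimes> r" by (rule bexE)
    then have "m [^] k \<otimes> y = m [^] k \<otimes> (m [^] i \<otimes> r)" using m_carrier by (simp add: nat_pow_mult[symmetric] m_assoc)
    then have "y = m [^] i \<otimes> r" by (rule nzd_cancel[OF nzd_pow[OF nzd_m], rotated 2]) (use y(1) r(1) m_carrier in simp_all)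
    then show ?thesis using r by blast
  qed
  then show ?thesis using y unfolding pow_inter_def by blast
qed

lemma pow_inter_divide:
  assumes "j \<in> pow_inter" obtains j' where "j' \<in> pow_inter" "j = m [^] (k::nat) \<otimes> j'"
proof -
  \<comment> \<open>The exponent is \<open>k + 1\<close> because the intersection runs over positive
    exponents and \<open>k\<close> may be 0; the extra factor \<open>m\<close> is left in the
    quotient.\<close>
  have "\<exists>r\<in>carrier R. j = m [^] (k + 1) \<otimes> r" using assms by (intro pow_interD) simp_all
  then obtain r where r: "r \<in> carrier R" "j = m [^] (k + 1) \<otimes> r" by (rule bexE)
  then have eq: "j = m [^] k \<otimes> (m \<otimes> r)" using m_carrier by (simp add: m_assoc)
  then have "m \<otimes> r \<in> pow_inter" using pow_inter_cancel[of "m \<otimes> r" k] assms r m_carrier by simp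
  then show ?thesis using that eq by blast
qed

text \<open>\<open>x\<close> divides some \<open>m^k\<close>, and \<open>J = m^k J\<close>.\<close>

lemma pow_inter_absorb:
  assumes x: "nzd R x" and j: "j \<in> pow_inter" shows "\<exists>d\<in>pow_inter. j = x \<otimes> d"
proof -
  obtain k r where kr: "r \<in> carrier R" "m [^] (k::nat) = r \<otimes> x"
    using nzd_power[OF x m_M] by (elim exE bexE) (rule that)
  obtain j' where j': "j' \<in> pow_inter" "j = m [^] k \<otimes> j'" by (rule pow_inter_divide[OF j])
  have "x \<in> carrier R" "j' \<in> carrier R" using nzdD[OF x] j'(1) pow_inter_sub by (auto dest: subsetD)
  then have "j = x \<otimes> (r \<otimes> j')" using j' kr by (simp add: m_ac)
  then show ?thesis using JD(6)[OF j'(1) kr(1)] by blast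
qed

section \<open>The projection to the quotient and the descent of (SP)\<close>

abbreviation "RJ \<equiv> R Quot pow_inter"
abbreviation proj where "proj a \<equiv> pow_inter +> a"
abbreviation projs where "projs Y \<equiv> (\<lambda>a. pow_inter +> a) ` Y"

interpretation J: ideal pow_inter R by (rule ideal_pow_inter)
interpretation p: ring_hom_cring R RJ "(+>) pow_inter" by (rule J.rcos_ring_hom_cring[OF cring_axioms])

lemma proj_eq: "a \<in> carrier R \<Longrightarrow> b \<in> carrier R \<Longrightarrow> proj a = proj b \<longleftrightarrow> a \<ominus> b \<in> pow_inter"
  using quotient_eq_iff_same_a_r_cos[OF ideal_pow_inter] by simp

lemma proj_eqE:
  assumes "a \<in> carrier R" "b \<in> carrier R" "proj a = proj b" obtains j where "j \<in> pow_inter" "a = j \<oplus> b"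
proof -
  have "a \<ominus> b \<in> pow_inter" using proj_eq[OF assms(1,2)] assms(3) by simp
  moreover have "a = (a \<ominus> b) \<oplus> b" using assms by (simp add: a_minus_def a_assoc l_neg)
  ultimately show ?thesis using that by blast
qed

lemma proj_zero: "a \<in> carrier R \<Longrightarrow> proj a = \<zero>\<^bsub>RJ\<^esub> \<longleftrightarrow> a \<in> pow_inter"
  unfolding p.hom_zero[symmetric] by (subst proj_eq) (simp_all add: a_minus_def)

lemma proj_surj: "\<eta> \<in> carrier RJ \<Longrightarrow> \<exists>a\<in>carrier R. \<eta> = proj a"
  unfolding FactRing_def A_RCOSETS_def' by simp

lemma proj_mem:
  assumes I: "ideal I R" "pow_inter \<subseteq> I" and a: "a \<in> carrier R" shows "proj a \<in> projs I \<longleftrightarrow> a \<in> I"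
proof
  assume "proj a \<in> projs I"
  then obtain b where b: "b \<in> I" "proj a = proj b" by blast
  then have "b \<in> carrier R" using idealD(1)[OF I(1)] by blast
  then obtain j where "j \<in> pow_inter" "a = j \<oplus> b" using proj_eqE[OF a] b by blast
  then show "a \<in> I" using idealD(3)[OF I(1)] b I(2) by blast
qed blast

lemma proj_ideal: assumes I: "ideal I R" shows "ideal (projs I) RJ"
proof (rule p.S.ideal_if_closed)
  note ID = idealD[OF I]
  have c: "a \<in> carrier R" if "a \<in> I" for a using that ID by blast
  show "projs I \<subseteq> carrier RJ" using c by auto
  show "\<zero>\<^bsub>RJ\<^esub> \<in> projs I" using ID(2) p.hom_zero by (metis imageI)
  fix \<eta> assume "\<eta> \<in> projs I"
  then obtain a where a: "a \<in> I" "\<eta> = proj a" by blast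
  show "\<eta> \<oplus>\<^bsub>RJ\<^esub> \<tau> \<in> projs I" if t: "\<tau> \<in> projs I" for \<tau>
  proof -
    obtain b where b: "b \<in> I" "\<tau> = proj b" using t by blast
    then have "\<eta> \<oplus>\<^bsub>RJ\<^esub> \<tau> = proj (a \<oplus> b)" using a c p.hom_add[of a b] by simp
    then show ?thesis using ID(3)[OF a(1) b(1)] by blast
  qed
  show "\<tau> \<otimes>\<^bsub>RJ\<^esub> \<eta> \<in> projs I" if t: "\<tau> \<in> carrier RJ" for \<tau>
  proof -
    obtain b where b: "b \<in> carrier R" "\<tau> = proj b" using proj_surj[OF t] by blast
    then have "\<tau> \<otimes>\<^bsub>RJ\<^esub> \<eta> = proj (b \<otimes> a)" using a c p.hom_mult[of b a] by simp
    then show ?thesis using ID(6)[OF a(1) b(1)] by blast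
  qed
qed

lemma proj_ideal_pull:
  assumes I: "ideal I RJ" shows "ideal {a \<in> carrier R. proj a \<in> I} R"
proof (rule ideal_if_closed)
  note ID = p.S.idealD[OF I]
  show "\<zero> \<in> {a \<in> carrier R. proj a \<in> I}" using ID(2) p.hom_zero by simp
  fix a assume a: "a \<in> {a \<in> carrier R. proj a \<in> I}"
  show "a \<oplus> b \<in> {a \<in> carrier R. proj a \<in> I}" if "b \<in> {a \<in> carrier R. proj a \<in> I}" for b
    using a that ID(3)[of "proj a" "proj b"] p.hom_add[of a b] by simp
  show "b \<otimes> a \<in> {a \<in> carrier R. proj a \<in> I}" if "b \<in> carrier R" for b
    using a that ID(6)[of "proj a" "proj b"] p.hom_mult[of b a] p.hom_closed[of b] by simp
qed blast

lemma proj_power: "a \<in> carrier R \<Longrightarrow> proj (a [^] (n::nat)) = proj a [^]\<^bsub>RJ\<^esub> n"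
  by (induction n) (simp_all add: p.hom_one p.hom_mult)

lemma nzd_proj: "a \<in> carrier R \<Longrightarrow> nzd RJ (proj a) \<longleftrightarrow> (\<forall>w\<in>carrier R. w \<otimes> a \<in> pow_inter \<longrightarrow> w \<in> pow_inter)"
proof -
  assume a: "a \<in> carrier R"
  have eq: "proj a \<otimes>\<^bsub>RJ\<^esub> proj w = \<zero>\<^bsub>RJ\<^esub> \<longleftrightarrow> w \<otimes> a \<in> pow_inter" if "w \<in> carrier R" for w
    using a that p.hom_mult[of a w] proj_zero[of "a \<otimes> w"] by (simp add: m_comm)
  show "nzd RJ (proj a) \<longleftrightarrow> (\<forall>w\<in>carrier R. w \<otimes> a \<in> pow_inter \<longrightarrow> w \<in> pow_inter)"
  proof
    assume n: "nzd RJ (proj a)"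
    show "\<forall>w\<in>carrier R. w \<otimes> a \<in> pow_inter \<longrightarrow> w \<in> pow_inter"
    proof (intro ballI impI)
      fix w assume w: "w \<in> carrier R" "w \<otimes> a \<in> pow_inter"
      then have "proj w = \<zero>\<^bsub>RJ\<^esub>" using n eq p.hom_closed[OF w(1)] unfolding nzd_def by blast
      then show "w \<in> pow_inter" using proj_zero w by blast
    qed
  next
    assume n: "\<forall>w\<in>carrier R. w \<otimes> a \<in> pow_inter \<longrightarrow> w \<in> pow_inter"
    show "nzd RJ (proj a)" unfolding nzd_def
    proof (intro conjI ballI impI)
      show "proj a \<in> carrier RJ" using a by simp
      fix \<tau> assume t: "\<tau> \<in> carrier RJ" "proj a \<otimes>\<^bsub>RJ\<^esub> \<tau> = \<zero>\<^bsub>RJ\<^esub>"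
      then obtain w where w: "w \<in> carrier R" "\<tau> = proj w" using proj_surj by blast
      then have "w \<in> pow_inter" using n eq t(2) by simp
      then show "\<tau> = \<zero>\<^bsub>RJ\<^esub>" using proj_zero w by simp
    qed
  qed
qed

text \<open>The locale knows nothing of prime ideals, so the power statement modulo \<open>J\<close>
  enters as an assumption. It is what \<open>nzd_power\<close> for the quotient amounts to after
  lifting to \<open>R\<close>.\<close>

lemma dim1_local_quotient:
  assumes "\<And>s x. \<lbrakk>s \<in> carrier R; \<And>w. w \<in> carrier R \<Longrightarrow> w \<otimes> s \<in> pow_inter \<Longrightarrow> w \<in> pow_inter; x \<in> M\<rbrakk>
    \<Longrightarrow> \<exists>k::nat. \<exists>r\<in>carrier R. \<exists>j\<in>pow_inter. x [^] k = j \<oplus> r \<otimes> s"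
  shows "dim1_local RJ (projs M) (proj m)"
proof (rule dim1_local.intro[OF p.S.cring_axioms], rule dim1_local_axioms.intro)
  show "ideal (projs M) RJ" by (rule proj_ideal[OF ideal_M])
  show "\<one>\<^bsub>RJ\<^esub> \<notin> projs M" using proj_mem[OF ideal_M pow_inter_M one_closed] one_M p.hom_one by simp
  show "proj m \<in> projs M" using m_M by blast
  show "nzd RJ (proj m)" unfolding nzd_proj[OF m_carrier]
  proof (intro ballI impI)
    fix w assume w: "w \<in> carrier R" "w \<otimes> m \<in> pow_inter"
    then have "m [^] (1::nat) \<otimes> w \<in> pow_inter" using m_carrier by (simp add: m_comm)
    then show "w \<in> pow_inter" by (rule pow_inter_cancel[OF w(1)])
  qed
  show "\<eta> \<in> Units RJ" if s: "\<eta> \<in> carrier RJ" "\<eta> \<notin> projs M" for \<eta>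
  proof -
    obtain a where a: "a \<in> carrier R" "\<eta> = proj a" using proj_surj[OF s(1)] by blast
    then have "a \<in> Units R" using unit_R s(2) by blast
    then obtain b where b: "b \<in> carrier R" "b \<otimes> a = \<one>" "a \<otimes> b = \<one>" unfolding Units_def by blast
    have "proj b \<otimes>\<^bsub>RJ\<^esub> proj a = \<one>\<^bsub>RJ\<^esub>" "proj a \<otimes>\<^bsub>RJ\<^esub> proj b = \<one>\<^bsub>RJ\<^esub>"
      using p.hom_mult[OF b(1) a(1)] p.hom_mult[OF a(1) b(1)] b p.hom_one by simp_all
    then show ?thesis unfolding Units_def using a b(1) by (auto intro!: bexI[of _ "proj b"])
  qed
  show "\<exists>k::nat. \<exists>\<rho>\<in>carrier RJ. \<xi> [^]\<^bsub>RJ\<^esub> k = \<rho> \<otimes>\<^bsub>RJ\<^esub> \<eta>" if s: "nzd RJ \<eta>" and x: "\<xi> \<in> projs M" for \<eta> \<xi>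
  proof -
    obtain a where a: "a \<in> M" "\<xi> = proj a" using x by blast
    have "\<eta> \<in> carrier RJ" using s unfolding nzd_def by blast
    then obtain b where b: "b \<in> carrier R" "\<eta> = proj b" using proj_surj by blast
    have "\<exists>k::nat. \<exists>r\<in>carrier R. \<exists>j\<in>pow_inter. a [^] k = j \<oplus> r \<otimes> b"
      using assms[OF b(1) _ a(1)] s nzd_proj[OF b(1)] b(2) by blast
    then obtain k :: nat and r j where krj: "r \<in> carrier R" "j \<in> pow_inter" "a [^] k = j \<oplus> r \<otimes> b" by blast
    have aR: "a \<in> carrier R" using a idealD(1)[OF ideal_M] by blast
    have jR: "j \<in> carrier R" using krj JD by blast
    have "\<xi> [^]\<^bsub>RJ\<^esub> k = proj (j \<oplus> r \<otimes> b)" using a aR krj(3) by (simp add: proj_power[symmetric])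
    also have "\<dots> = proj j \<oplus>\<^bsub>RJ\<^esub> proj r \<otimes>\<^bsub>RJ\<^esub> \<eta>" using jR krj(1) b by (simp add: p.hom_add p.hom_mult)
    also have "\<dots> = proj r \<otimes>\<^bsub>RJ\<^esub> \<eta>" using proj_zero[OF jR] krj b by simp
    finally show ?thesis using p.hom_closed[OF krj(1)] by blast
  qed
qed

text \<open>A regular ideal of \<open>R\<close> contains \<open>J\<close>, since
  \<open>J = sJ\<close> for a regular \<open>s\<close> in it, and for the same reason regular
  elements stay regular modulo \<open>J\<close>. Conversely lifts of regular elements are regular,
  and a relation \<open>ab = xc + j\<close> with \<open>j\<close> in \<open>J\<close> is corrected
  to \<open>ab = x(c + d)\<close> by \<open>j = xd\<close> with \<open>d\<close> in
  \<open>J\<close>.\<close>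

lemma sp_quotient:
  assumes "dim1_local RJ (projs M) (proj m)"
  shows "sp_ring RJ \<longleftrightarrow> sp_ring R"
proof
  interpret q: dim1_local RJ "projs M" "proj m" by (rule assms)
  assume sp: "sp_ring RJ"
  show "sp_ring R" unfolding sp_ring_def
  proof (intro allI impI)
    fix I assume "ideal I R \<and> regular_set R I"
    then obtain s where I: "ideal I R" and s: "s \<in> I" "nzd R s" unfolding regular_set_def by blast
    note ID = idealD[OF I]
    have IR: "a \<in> carrier R" if "a \<in> I" for a using that ID by blast
    have JI: "pow_inter \<subseteq> I"
    proof
      fix j assume "j \<in> pow_inter"
      then obtain d where "d \<in> pow_inter" "j = s \<otimes> d" using pow_inter_absorb[OF s(2)] by blast
      then show "j \<in> I" using ID(7)[OF s(1)] JD by blast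
    qed
    have "nzd RJ (proj s)" unfolding nzd_proj[OF IR[OF s(1)]]
    proof (intro ballI impI)
      fix w assume w: "w \<in> carrier R" "w \<otimes> s \<in> pow_inter"
      then obtain d where d: "d \<in> pow_inter" "w \<otimes> s = s \<otimes> d" using pow_inter_absorb[OF s(2)] by blast
      have "w = d" by (rule nzd_cancel[OF s(2)]) (use w d JD IR[OF s(1)] in \<open>auto simp: m_comm\<close>)
      then show "w \<in> pow_inter" using d by simp
    qed
    then have reg: "regular_set RJ (projs I)" unfolding regular_set_def using s by blast
    obtain \<xi> where \<xi>: "\<xi> \<in> projs I" "nzd RJ \<xi>"
      "\<forall>a\<in>projs I. \<forall>b\<in>projs I. \<exists>c\<in>projs I. a \<otimes>\<^bsub>RJ\<^esub> b = \<xi> \<otimes>\<^bsub>RJ\<^esub> c"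
      using sp_ringD[OF sp proj_ideal[OF I] reg] by (elim conjE bexE) (rule that)
    obtain x where x: "x \<in> I" "\<xi> = proj x" using \<xi>(1) by blast
    have xR: "x \<in> carrier R" by (rule IR[OF x(1)])
    \<comment> \<open>In \<open>m^k = j + rx\<close> write \<open>j = m^k j'\<close> with
      \<open>j'\<close> in \<open>J\<close>. Then \<open>m^k (1 - j') = rx\<close>, where
      \<open>1 - j'\<close> is a unit, so \<open>x\<close> divides \<open>m^k\<close>.\<close>
    have nx: "nzd R x"
    proof -
      obtain k :: nat and \<rho> where k: "\<rho> \<in> carrier RJ" "proj m [^]\<^bsub>RJ\<^esub> k = \<rho> \<otimes>\<^bsub>RJ\<^esub> \<xi>"
        using q.nzd_power[OF \<xi>(2) imageI[OF m_M]] by (elim exE bexE) (rule that)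
      obtain r where r: "r \<in> carrier R" "\<rho> = proj r" using proj_surj[OF k(1)] by blast
      have "proj (m [^] k) = proj (r \<otimes> x)" using k(2) r x(2) xR m_carrier by (simp add: proj_power p.hom_mult)
      then obtain j where j: "j \<in> pow_inter" "m [^] k = j \<oplus> r \<otimes> x" using proj_eqE[of "m [^] k" "r \<otimes> x"] r xR m_carrier by auto
      obtain j' where j': "j' \<in> pow_inter" "j = m [^] k \<otimes> j'" by (rule pow_inter_divide[OF j(1)])
      have jR: "j' \<in> carrier R" using j' JD by blast
      have "\<one> \<ominus> j' \<notin> M"
      proof
        assume "\<one> \<ominus> j' \<in> M"
        then have "(\<one> \<ominus> j') \<oplus> j' \<in> M" using idealD(3)[OF ideal_M] j' pow_inter_M by blast
        then show False using one_M jR by (simp add: a_minus_def a_assoc l_neg)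
      qed
      then obtain u where u: "u \<in> carrier R" "(\<one> \<ominus> j') \<otimes> u = \<one>" using unit_R[of "\<one> \<ominus> j'"] jR unfolding Units_def by auto
      have "m [^] k \<otimes> (\<one> \<ominus> j') = m [^] k \<ominus> j" using jR m_carrier j' by (simp add: a_minus_def r_distr r_minus)
      also have "\<dots> = r \<otimes> x"
      proof -
        have "j \<in> carrier R" using j JD by blast
        then have "(j \<oplus> r \<otimes> x) \<ominus> j = r \<otimes> x" using r xR by (simp add: a_minus_def a_comm[of j] a_assoc r_neg)
        then show ?thesis using j(2) by simp
      qed
      finally have e: "m [^] k \<otimes> (\<one> \<ominus> j') = r \<otimes> x" .
      have "m [^] k = (m [^] k \<otimes> (\<one> \<ominus> j')) \<otimes> u" using u jR m_carrier by (simp add: m_assoc)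
      also have "\<dots> = x \<otimes> (r \<otimes> u)" unfolding e using r u xR by (simp add: m_ac)
      finally have "nzd R (x \<otimes> (r \<otimes> u))" using nzd_pow[OF nzd_m, of k] by simp
      then show ?thesis by (rule nzd_factor) (use xR r u in auto)
    qed
    have "\<exists>c\<in>I. a \<otimes> b = x \<otimes> c" if ab: "a \<in> I" "b \<in> I" for a b
    proof -
      have "\<exists>\<tau>\<in>projs I. proj a \<otimes>\<^bsub>RJ\<^esub> proj b = \<xi> \<otimes>\<^bsub>RJ\<^esub> \<tau>" by (rule \<xi>(3)[rule_format]) (use ab in auto)
      then obtain \<tau> where "\<tau> \<in> projs I" "proj a \<otimes>\<^bsub>RJ\<^esub> proj b = \<xi> \<otimes>\<^bsub>RJ\<^esub> \<tau>" by (rule bexE)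
      then obtain c where c: "c \<in> I" "proj a \<otimes>\<^bsub>RJ\<^esub> proj b = \<xi> \<otimes>\<^bsub>RJ\<^esub> proj c" by blast
      then have "proj (a \<otimes> b) = proj (x \<otimes> c)" using IR ab x by (simp add: p.hom_mult)
      then obtain j where j: "j \<in> pow_inter" "a \<otimes> b = j \<oplus> x \<otimes> c" using proj_eqE[of "a \<otimes> b" "x \<otimes> c"] IR ab x c by auto
      obtain d where d: "d \<in> pow_inter" "j = x \<otimes> d" using pow_inter_absorb[OF nx j(1)] by blast
      have "d \<in> carrier R" using d JD by blast
      then have "a \<otimes> b = x \<otimes> (d \<oplus> c)" using j d xR IR[OF c(1)] by (simp add: r_distr)
      moreover have "d \<oplus> c \<in> I" using ID(3) d JI c by blast
      ultimately show ?thesis by blast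
    qed
    then show "\<exists>x\<in>I. nzd R x \<and> (\<forall>a\<in>I. \<forall>b\<in>I. \<exists>c\<in>I. a \<otimes> b = x \<otimes> c)" using x nx by blast
  qed
next
  interpret q: dim1_local RJ "projs M" "proj m" by (rule assms)
  assume sp: "sp_ring R"
  show "sp_ring RJ" unfolding sp_ring_def
  proof (intro allI impI)
    fix H assume "ideal H RJ \<and> regular_set RJ H"
    then obtain \<eta> where H: "ideal H RJ" and \<eta>: "\<eta> \<in> H" "nzd RJ \<eta>" unfolding regular_set_def by blast
    note HD = p.S.idealD[OF H]
    let ?I = "{a \<in> carrier R. proj a \<in> H}"
    have I: "ideal ?I R" by (rule proj_ideal_pull[OF H])
    obtain k :: nat and \<rho> where k: "\<rho> \<in> carrier RJ" "proj m [^]\<^bsub>RJ\<^esub> k = \<rho> \<otimes>\<^bsub>RJ\<^esub> \<eta>"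
      using q.nzd_power[OF \<eta>(2) imageI[OF m_M]] by (elim exE bexE) (rule that)
    \<comment> \<open>A regular element of the quotient divides a power of the image of
      \<open>m\<close>. Hence the preimage of \<open>H\<close> contains a power of \<open>m\<close>
      and is regular.\<close>
    have "proj (m [^] k) \<in> H" using k HD(6)[OF \<eta>(1) k(1)] m_carrier by (simp add: proj_power)
    then have "m [^] k \<in> ?I" using m_carrier by simp
    then have reg: "regular_set R ?I" unfolding regular_set_def using nzd_pow[OF nzd_m] by blast
    obtain x where x: "x \<in> ?I" "nzd R x" "\<forall>a\<in>?I. \<forall>b\<in>?I. \<exists>c\<in>?I. a \<otimes> b = x \<otimes> c"
      using sp_ringD[OF sp I reg] by (elim conjE bexE) (rule that)
    have xR: "x \<in> carrier R" using x by blast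
    have "nzd RJ (proj x)" unfolding nzd_proj[OF xR]
    proof (intro ballI impI)
      fix w assume w: "w \<in> carrier R" "w \<otimes> x \<in> pow_inter"
      then obtain d where d: "d \<in> pow_inter" "w \<otimes> x = x \<otimes> d" using pow_inter_absorb[OF x(2)] by blast
      have "w = d" by (rule nzd_cancel[OF x(2)]) (use w d JD xR in \<open>auto simp: m_comm\<close>)
      then show "w \<in> pow_inter" using d by simp
    qed
    moreover have "\<exists>c\<in>H. a \<otimes>\<^bsub>RJ\<^esub> b = proj x \<otimes>\<^bsub>RJ\<^esub> c" if ab: "a \<in> H" "b \<in> H" for a b
    proof -
      have "a \<in> carrier RJ" "b \<in> carrier RJ" using ab HD(1) by (auto dest: subsetD)
      then obtain a' b' where *: "a' \<in> carrier R" "b' \<in> carrier R" "a = proj a'" "b = proj b'"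
        using proj_surj[of a] proj_surj[of b] by blast
      then have "a' \<in> ?I" "b' \<in> ?I" using ab by auto
      then obtain c where c: "c \<in> ?I" "a' \<otimes> b' = x \<otimes> c" using x(3) by blast
      have "a \<otimes>\<^bsub>RJ\<^esub> b = proj x \<otimes>\<^bsub>RJ\<^esub> proj c"
        using p.hom_mult[OF *(1,2)] p.hom_mult[of x c] c xR unfolding *(3,4) by simp
      then show ?thesis using c by blast
    qed
    ultimately show "\<exists>x\<in>H. nzd RJ x \<and> (\<forall>a\<in>H. \<forall>b\<in>H. \<exists>c\<in>H. a \<otimes>\<^bsub>RJ\<^esub> b = x \<otimes>\<^bsub>RJ\<^esub> c)" using x(1) by blast
  qed
qed

end

theorem theorem4p2:
  fixes R :: "('a, 'b) ring_scheme" and M :: "'a set" and m :: 'a and J :: "'a set"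
  assumes "cring R"
    and "local_ring R" and "maximalideal M R"
    and "krull_dim_one R"
    and "regular_set R M"
    and "m \<in> M" and "nzd R m"
    and "J = {x \<in> carrier R. \<forall>i::nat. i > 0 \<longrightarrow> (\<exists>r\<in>carrier R. x = m [^]\<^bsub>R\<^esub> i \<otimes>\<^bsub>R\<^esub> r)}"
  shows "(stable_ring R \<longleftrightarrow> fin_stable_ring R \<and> stable_ideal R M)
       \<and> (stable_ring R \<longleftrightarrow> quadratic_ring R \<and> at_most_two_max (Rbar_ring R))
       \<and> (stable_ring R \<longleftrightarrow> quadratic_ext (TotQ R) (Rin R) (Rbar R)
                              \<and> dedekind_ring (Rbar_ring R) \<and> at_most_two_max (Rbar_ring R))
       \<and> (stable_ring R \<longleftrightarrow> stable_ring (R Quot J))"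
proof -
  interpret R: dim1_local R M m
    by (rule dim1_localI[OF assms(1-4,6,7)])
  have J: "J = R.pow_inter" unfolding R.pow_inter_def by (rule assms(8))
  have uniq: "P = M" if "maximalideal P R" for P using assms(2,3) that unfolding local_ring_def by blast
  have below: "P \<subseteq> M" if P: "primeideal P R" for P
  proof -
    have "\<one>\<^bsub>R\<^esub> \<notin> P" using primeideal.I_notcarr[OF P] ideal.one_imp_carrier[OF primeideal.axioms(1)[OF P]] by blast
    then obtain L where "maximalideal L R" "P \<subseteq> L" by (rule R.in_maximal_ideal[OF primeideal.axioms(1)[OF P]])
    then show ?thesis using uniq by blast
  qed
  have q: "quadratic_ring R \<longleftrightarrow> stable_ideal R M \<and> quadratic_ext (TotQ R) (Rin R) (Rinf R)"
    using uniq assms(2,3,5) unfolding quadratic_ring_def by blast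
  have Q: "dim1_local (R Quot R.pow_inter) ((\<lambda>a. R.pow_inter +>\<^bsub>R\<^esub> a) ` M) (R.pow_inter +>\<^bsub>R\<^esub> m)"
    by (rule R.dim1_local_quotient)
      (rule R.power_in_regular_ideal[OF assms(4) below R.maximalideal_prime[OF assms(3)] R.ideal_pow_inter])
  have "stable_ring (R Quot J) \<longleftrightarrow> sp_ring R"
    unfolding J dim1_local.stable_equivalences(4)[OF Q] by (rule R.sp_quotient[OF Q])
  then show ?thesis using R.stable_equivalences q by argo
qed

end
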